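(* Let $\nabla$ be an $A$-anisotropic connection on $M$ and let $v\in A$. Then there exist an open neighbourhood $\Omega\subset M$ of $\pi(v)$ and an $A$-admissible vector field $V$ on $\Omega$ extending $v$ such that $$\nabla^v_XV=0\qquad\text{for every } X\in\mathfrak X(\Omega).$$ Furthermore, for such a $V$: (1) if $T\in\mathfrak T^r_s(M,A)$ and $X\in\mathfrak T^1_0(M,A)$, then $(\nabla_XT)_v=(\nabla^V_X(T_V))_{\pi(v)}$; (2) the curvature tensor $R$ of $\nabla$ satisfies $R_v(X,Y)Z=R^V_{\pi(v)}(X,Y)Z$ for all $X,Y,Z\in\mathfrak X(\Omega)$, and if moreover $[X,Y]=0$, then $$R_v(X,Y)Z=(\nabla^V_X\nabla^V_YZ)_{\pi(v)}-(\nabla^V_Y\nabla^V_XZ)_{\pi(v)};$$ (3) for all $X,Y,Z,W\in\mathfrak X(\Omega)$ whose mutual Lie brackets are all zero, $$(\nabla_XR)_v(Y,Z)W=(\nabla^V_XR^V)_{\pi(v)}(Y,Z)W-P_v(Z,W,\nabla^V_X\nabla^V_YV)+P_v(Y,W,\nabla^V_X\nabla^V_ZV).$$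
   Context: $M$ is a smooth manifold, $\pi:TM\to M$ its tangent bundle, $A\subset TM$ an open subset with $\pi(A)=M$, $\mathcal F(\cdot)$ denotes smooth real functions, $\mathfrak X(\cdot)$ smooth vector fields. $\mathfrak T^1_0(M,A)$ (resp. $\mathfrak T^0_1(M,A)$) is the set of smooth maps $v\in A\mapsto \mathcal X_v\in T_{\pi(v)}M$ (resp. $\theta_v\in T^*_{\pi(v)}M$); vector fields and one-forms on $M$ are regarded as such maps via $v\mapsto X_{\pi(v)}$, $v\mapsto\theta_{\pi(v)}$. An $A$-anisotropic tensor of type $(r,s)$ is an $\mathcal F(A)$-multilinear map $T:\mathfrak T^0_1(M,A)^r\times\mathfrak T^1_0(M,A)^s\to\mathcal F(A)$ (the space of these is $\mathfrak T^r_s(M,A)$); it amounts to multilinear maps $T_v$ on $T^*_{\pi(v)}M$, $T_{\pi(v)}M$ depending smoothly on $v\in A$, and $\mathcal F(A)$-multilinear maps $\mathfrak T^1_0(M,A)^s\to\mathfrak T^1_0(M,A)$ are also regarded as anisotropic tensors. A vector field $V$ on an open $\Omega\subset M$ is $A$-admissible if $V_p\in A$ for all $p\in\Omega$; it extends $v\in A$ if $V_{\pi(v)}=v$; $T_V$ is the classical tensor on $\Omega$ with $(T_V)_p=T_{V_p}$. The vertical derivative is $(\partial^\nu T)_v(\ldots,z)=\frac{d}{dt}T_{v+tz}(\ldots)|_{t=0}$, $z\in T_{\pi(v)}M$. An $A$-anisotropic connection is a map $\nabla:A\times\mathfrak X(M)\times\mathfrak X(M)\to TM$, $(v,X,Y)\mapsto\nabla^v_XY\in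 T_{\pi(v)}M$, additive in $Y$, with $\nabla^v_X(fY)=X_{\pi(v)}(f)Y_{\pi(v)}+f(\pi(v))\nabla^v_XY$, $\nabla^v_{fX+hY}Z=f(\pi(v))\nabla^v_XZ+h(\pi(v))\nabla^v_YZ$ for $f,h\in\mathcal F(M)$, and such that $v\mapsto\nabla^v_XY$ is smooth, i.e. $\nabla_XY\in\mathfrak T^1_0(M,A)$. For an $A$-admissible $V$ on $\Omega$, $\nabla^V$ is the affine connection on $\Omega$ with $(\nabla^V_XY)_p=\nabla^{V_p}_XY$. Derivatives: for any $A$-admissible local extension $V$ of $v$ (the results do not depend on $V$), $(\nabla_Xh)(v)=X_{\pi(v)}(h(V))-(\partial^\nu h)_v(\nabla^v_XV)$ for $h\in\mathcal F(A)$; $\nabla^v_X\mathcal Y=\nabla^v_X(\mathcal Y_V)-(\partial^\nu\mathcal Y)_v(\nabla^v_XV)$ for $\mathcal Y\in\mathfrak T^1_0(M,A)$; $(\nabla_X\theta)_v(Y)=X_{\pi(v)}(\theta(Y))-\theta(\nabla^v_XY)$ for one-forms $\theta$ on $M$; and $\nabla_XT$ is defined by the product rule $(\nabla_XT)(\theta^1,\ldots,X_s)=\nabla_X(T(\theta^1,\ldots,X_s))-\sum_iT(\ldots,\nabla_X\theta^i,\ldots)-\sum_jT(\ldots,\nabla_XX_j,\ldots)$ (also for tensors with values in $\mathfrak T^1_0(M,A)$). $(\nabla_XT)_v$ depends on $X$ only through its value at $v$ (a vector of $T_{\pi(v)}M$), so it is defined also for $X\in\mathfrak T^1_0(M,A)$;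 likewise $(\nabla^V_X\,\cdot)_{\pi(v)}$ then means $\nabla^V$-differentiation at $\pi(v)$ in the direction $X_v$. The vertical derivative of $\nabla$ is the anisotropic tensor $P_v(X,Y,Z)=\frac{\partial}{\partial t}\big(\nabla^{v+tZ}_XY\big)|_{t=0}$. The curvature tensor of $\nabla$ is the anisotropic tensor $R_v(X,Y)Z=\nabla^v_X(\nabla_YZ)-\nabla^v_Y(\nabla_XZ)-\nabla^v_{[X,Y]}Z$ for $X,Y,Z\in\mathfrak X(M)$. $R^V$ is the curvature of the affine connection $\nabla^V$: $R^V(X,Y)Z=\nabla^V_X\nabla^V_YZ-\nabla^V_Y\nabla^V_XZ-\nabla^V_{[X,Y]}Z$. *)

theory Defs
  imports "HOL-Analysis.Analysis"
begin

section \<open>Smooth maps between Euclidean spaces\<close>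

text \<open>Meant for open \<open>S\<close>: all iterated directional derivatives exist and are continuous.\<close>

primrec Ck_on :: "nat \<Rightarrow> 'a::real_normed_vector set \<Rightarrow> ('a \<Rightarrow> 'b::real_normed_vector) \<Rightarrow> bool" where
  "Ck_on 0 S f \<longleftrightarrow> continuous_on S f"
| "Ck_on (Suc k) S f \<longleftrightarrow>
     (\<forall>x\<in>S. f differentiable (at x)) \<and>
     (\<forall>d. Ck_on k S (\<lambda>x. frechet_derivative f (at x) d))"

definition smooth_on :: "'a::real_normed_vector set \<Rightarrow> ('a \<Rightarrow> 'b::real_normed_vector) \<Rightarrow> bool" where
  "smooth_on S f \<longleftrightarrow> (\<forall>k. Ck_on k S f)"


section \<open>Smooth manifolds\<close>

text \<open>A chart is a pair of its domain and its coordinate map. The smooth structure is given by a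
  (not necessarily maximal) atlas on a type of points, which is Hausdorff and second countable by
  its sort.\<close>

type_synonym ('m, 'e) chart = "'m set \<times> ('m \<Rightarrow> 'e)"

definition chart_inv :: "('m, 'e) chart \<Rightarrow> 'e \<Rightarrow> 'm" where
  "chart_inv c = inv_into (fst c) (snd c)"

definition smooth_manifold ::
    "('m::{t2_space, second_countable_topology}, 'e::euclidean_space) chart set \<Rightarrow> bool" where
  "smooth_manifold \<A> \<longleftrightarrow>
     (\<Union>c\<in>\<A>. fst c) = UNIV \<and>
     (\<forall>c\<in>\<A>. open (fst c) \<and> open (snd c ` fst c) \<and>
        homeomorphism (fst c) (snd c ` fst c) (snd c) (chart_inv c)) \<and>
     (\<forall>c\<in>\<A>. \<forall>c'\<in>\<A>. smooth_on (snd c ` (fst c \<inter> fst c')) (snd c' \<circ> chart_inv c))"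

context
  fixes \<A> :: "('m::{t2_space, second_countable_topology}, 'e::euclidean_space) chart set"
begin

subsection \<open>Tangent bundle, functions, fields, forms\<close>

text \<open>Every tangent space is identified with the model space \<open>'e\<close> through a preferred chart at the
  base point: \<open>(p, u) :: 'm \<times> 'e\<close> stands for the tangent vector at \<open>p\<close> whose coordinates in
  \<open>chart_at p\<close> are \<open>u\<close>, and the bundle projection is \<open>fst\<close>. The preferred chart jumps
  with \<open>p\<close>, so neither the topology nor the smooth structure of the tangent bundle is that of the
  product type; they are defined below through the bundle charts. Covectors at \<open>p\<close> are
  elements of \<open>'e \<Rightarrow>\<^sub>L real\<close>.\<close>

definition chart_at :: "'m \<Rightarrow> ('m, 'e) chart" where
  "chart_at p = (SOME c. c \<in> \<A> \<and> p \<in> fst c)"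

text \<open>The coordinates in \<open>c\<close> of the tangent vector \<open>u\<close> at \<open>p\<close>, and conversely the tangent vector
  at \<open>p\<close> with coordinates \<open>e\<close> in \<open>c\<close>.\<close>

definition tcoord :: "('m, 'e) chart \<Rightarrow> 'm \<Rightarrow> 'e \<Rightarrow> 'e" where
  "tcoord c p u =
     frechet_derivative (snd c \<circ> chart_inv (chart_at p)) (at (snd (chart_at p) p)) u"

definition tvec :: "('m, 'e) chart \<Rightarrow> 'm \<Rightarrow> 'e \<Rightarrow> 'e" where
  "tvec c p e = frechet_derivative (snd (chart_at p) \<circ> chart_inv c) (at (snd c p)) e"

text \<open>The inverse of the bundle chart induced by \<open>c\<close>, and the part of its domain over
  a subset \<open>A\<close> of the tangent bundle.\<close>

definition tm_param :: "('m, 'e) chart \<Rightarrow> 'e \<times> 'e \<Rightarrow> 'm \<times> 'e" where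
  "tm_param c z = (chart_inv c (fst z), tvec c (chart_inv c (fst z)) (snd z))"

definition tm_dom :: "('m, 'e) chart \<Rightarrow> ('m \<times> 'e) set \<Rightarrow> ('e \<times> 'e) set" where
  "tm_dom c A = {z. fst z \<in> snd c ` fst c \<and> tm_param c z \<in> A}"

definition tm_open :: "('m \<times> 'e) set \<Rightarrow> bool" where
  "tm_open A \<longleftrightarrow> (\<forall>c\<in>\<A>. open (tm_dom c A))"

definition smooth_fun :: "'m set \<Rightarrow> ('m \<Rightarrow> real) \<Rightarrow> bool" where
  "smooth_fun \<Omega> f \<longleftrightarrow> (\<forall>c\<in>\<A>. smooth_on (snd c ` (fst c \<inter> \<Omega>)) (f \<circ> chart_inv c))"

definition field_rep :: "('m, 'e) chart \<Rightarrow> ('m \<Rightarrow> 'e) \<Rightarrow> 'e \<Rightarrow> 'e" where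
  "field_rep c X x = tcoord c (chart_inv c x) (X (chart_inv c x))"

definition vector_field :: "'m set \<Rightarrow> ('m \<Rightarrow> 'e) \<Rightarrow> bool" where
  "vector_field \<Omega> X \<longleftrightarrow> (\<forall>c\<in>\<A>. smooth_on (snd c ` (fst c \<inter> \<Omega>)) (field_rep c X))"

definition one_form :: "'m set \<Rightarrow> ('m \<Rightarrow> 'e \<Rightarrow>\<^sub>L real) \<Rightarrow> bool" where
  "one_form \<Omega> \<theta> \<longleftrightarrow> (\<forall>c\<in>\<A>. \<forall>e. smooth_on (snd c ` (fst c \<inter> \<Omega>))
     (\<lambda>x. blinfun_apply (\<theta> (chart_inv c x)) (tvec c (chart_inv c x) e)))"

definition dir_deriv :: "'m \<Rightarrow> 'e \<Rightarrow> ('m \<Rightarrow> real) \<Rightarrow> real" where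
  "dir_deriv p u f = frechet_derivative (f \<circ> chart_inv (chart_at p)) (at (snd (chart_at p) p)) u"

definition lie_bracket :: "('m \<Rightarrow> 'e) \<Rightarrow> ('m \<Rightarrow> 'e) \<Rightarrow> 'm \<Rightarrow> 'e" where
  "lie_bracket X Y p =
     (let c = chart_at p; x = snd c p in
        frechet_derivative (field_rep c Y) (at x) (field_rep c X x) -
        frechet_derivative (field_rep c X) (at x) (field_rep c Y x))"


subsection \<open>Global extensions\<close>

text \<open>Arbitrary choices; they serve to evaluate tensorial or local expressions, in which the
  choice does not matter.\<close>

definition ext_vec :: "'m \<Rightarrow> 'e \<Rightarrow> 'm \<Rightarrow> 'e" where
  "ext_vec p u = (SOME X. vector_field UNIV X \<and> X p = u)"

definition ext_covec :: "'m \<Rightarrow> ('e \<Rightarrow>\<^sub>L real) \<Rightarrow> 'm \<Rightarrow> 'e \<Rightarrow>\<^sub>L real" where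
  "ext_covec p \<alpha> = (SOME \<theta>. one_form UNIV \<theta> \<and> \<theta> p = \<alpha>)"

definition ext_germ :: "'m \<Rightarrow> ('m \<Rightarrow> 'e) \<Rightarrow> 'm \<Rightarrow> 'e" where
  "ext_germ p Y =
     (SOME Y'. vector_field UNIV Y' \<and> (\<exists>U. open U \<and> p \<in> U \<and> (\<forall>q\<in>U. Y' q = Y q)))"


subsection \<open>Classical affine connections\<close>

text \<open>An affine connection is represented by \<open>D p u Y\<close>, the derivative at \<open>p\<close> of the local
  field \<open>Y\<close> in the direction of the tangent vector \<open>u\<close> at \<open>p\<close>.\<close>

definition cov_field ::
    "('m \<Rightarrow> 'e \<Rightarrow> ('m \<Rightarrow> 'e) \<Rightarrow> 'e) \<Rightarrow> ('m \<Rightarrow> 'e) \<Rightarrow> ('m \<Rightarrow> 'e) \<Rightarrow> 'm \<Rightarrow> 'e" where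
  "cov_field D X Y q = D q (X q) Y"

text \<open>Product rule for one-forms; here \<open>C\<close> is the connection at the one point \<open>p\<close>.\<close>

definition form_deriv ::
    "'m \<Rightarrow> ('e \<Rightarrow> ('m \<Rightarrow> 'e) \<Rightarrow> 'e) \<Rightarrow> 'e \<Rightarrow> ('m \<Rightarrow> 'e \<Rightarrow>\<^sub>L real) \<Rightarrow> 'e \<Rightarrow>\<^sub>L real" where
  "form_deriv p C u \<theta> = Blinfun (\<lambda>w.
     dir_deriv p u (\<lambda>q. blinfun_apply (\<theta> q) (ext_vec p w q)) -
     blinfun_apply (\<theta> p) (C u (ext_vec p w)))"

text \<open>A classical tensor field \<open>S\<close> assigns to each point a multilinear function of a list of
  covectors and a list of vectors.\<close>

definition classical_tensor_deriv ::
    "('m \<Rightarrow> 'e \<Rightarrow> ('m \<Rightarrow> 'e) \<Rightarrow> 'e) \<Rightarrow> ('m \<Rightarrow> ('e \<Rightarrow>\<^sub>L real) list \<Rightarrow> 'e list \<Rightarrow> real) \<Rightarrow>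
     'm \<Rightarrow> 'e \<Rightarrow> ('e \<Rightarrow>\<^sub>L real) list \<Rightarrow> 'e list \<Rightarrow> real" where
  "classical_tensor_deriv D S p u \<alpha>s us =
     (let \<theta>s = map (ext_covec p) \<alpha>s; Xs = map (ext_vec p) us in
        dir_deriv p u (\<lambda>q. S q (map (\<lambda>\<theta>. \<theta> q) \<theta>s) (map (\<lambda>X. X q) Xs))
        - (\<Sum>i<length \<alpha>s. S p (\<alpha>s[i := form_deriv p (D p) u (\<theta>s ! i)]) us)
        - (\<Sum>j<length us. S p \<alpha>s (us[j := D p u (Xs ! j)])))"

text \<open>\<open>R(X,Y)Z\<close>, and \<open>(\<nabla>\<^sub>X R)(Y,Z)W\<close> by the product rule.\<close>

definition classical_curv ::
    "('m \<Rightarrow> 'e \<Rightarrow> ('m \<Rightarrow> 'e) \<Rightarrow> 'e) \<Rightarrow> ('m \<Rightarrow> 'e) \<Rightarrow> ('m \<Rightarrow> 'e) \<Rightarrow> ('m \<Rightarrow> 'e) \<Rightarrow> 'm \<Rightarrow> 'e" where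
  "classical_curv D X Y Z p =
     cov_field D X (cov_field D Y Z) p - cov_field D Y (cov_field D X Z) p
     - cov_field D (lie_bracket X Y) Z p"

definition classical_curv_deriv ::
    "('m \<Rightarrow> 'e \<Rightarrow> ('m \<Rightarrow> 'e) \<Rightarrow> 'e) \<Rightarrow> ('m \<Rightarrow> 'e) \<Rightarrow> ('m \<Rightarrow> 'e) \<Rightarrow> ('m \<Rightarrow> 'e) \<Rightarrow> ('m \<Rightarrow> 'e) \<Rightarrow>
     'm \<Rightarrow> 'e" where
  "classical_curv_deriv D X Y Z W p =
     cov_field D X (classical_curv D Y Z W) p
     - classical_curv D (cov_field D X Y) Z W p
     - classical_curv D Y (cov_field D X Z) W p
     - classical_curv D Y Z (cov_field D X W) p"


section \<open>Anisotropic tensors and connections\<close>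

text \<open>Anisotropic objects are total functions on pairs (base point, vector); only their values
  on \<open>A\<close> matter.\<close>

context
  fixes A :: "('m \<times> 'e) set"
begin

definition aniso_fun :: "('m \<times> 'e \<Rightarrow> real) \<Rightarrow> bool" where
  "aniso_fun h \<longleftrightarrow> (\<forall>c\<in>\<A>. smooth_on (tm_dom c A) (h \<circ> tm_param c))"

definition aniso_field :: "('m \<times> 'e \<Rightarrow> 'e) \<Rightarrow> bool" where
  "aniso_field X \<longleftrightarrow> (\<forall>c\<in>\<A>. smooth_on (tm_dom c A)
     (\<lambda>z. tcoord c (fst (tm_param c z)) (X (tm_param c z))))"

definition aniso_form :: "('m \<times> 'e \<Rightarrow> 'e \<Rightarrow>\<^sub>L real) \<Rightarrow> bool" where
  "aniso_form \<theta> \<longleftrightarrow> (\<forall>c\<in>\<A>. \<forall>e. smooth_on (tm_dom c A)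
     (\<lambda>z. blinfun_apply (\<theta> (tm_param c z)) (tvec c (fst (tm_param c z)) e)))"

text \<open>Maps on \<open>r\<close>-tuples of forms and \<open>s\<close>-tuples of fields, given as lists, with values in the
  smooth functions on \<open>A\<close>, and multilinear over those functions.\<close>

definition aniso_tensor ::
    "nat \<Rightarrow> nat \<Rightarrow> (('m \<times> 'e \<Rightarrow> 'e \<Rightarrow>\<^sub>L real) list \<Rightarrow> ('m \<times> 'e \<Rightarrow> 'e) list \<Rightarrow> 'm \<times> 'e \<Rightarrow> real) \<Rightarrow> bool"
  where
  "aniso_tensor r s T \<longleftrightarrow>
     (\<forall>\<theta>s Xs. length \<theta>s = r \<and> length Xs = s \<and>
        (\<forall>\<theta>\<in>set \<theta>s. aniso_form \<theta>) \<and> (\<forall>X\<in>set Xs. aniso_field X) \<longrightarrow>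
        aniso_fun (T \<theta>s Xs) \<and>
        (\<forall>i<r. \<forall>f g \<theta> \<eta>. aniso_fun f \<and> aniso_fun g \<and> aniso_form \<theta> \<and> aniso_form \<eta> \<longrightarrow>
           (\<forall>v\<in>A. T (\<theta>s[i := (\<lambda>w. f w *\<^sub>R \<theta> w + g w *\<^sub>R \<eta> w)]) Xs v =
                  f v * T (\<theta>s[i := \<theta>]) Xs v + g v * T (\<theta>s[i := \<eta>]) Xs v)) \<and>
        (\<forall>j<s. \<forall>f g X Y. aniso_fun f \<and> aniso_fun g \<and> aniso_field X \<and> aniso_field Y \<longrightarrow>
           (\<forall>v\<in>A. T \<theta>s (Xs[j := (\<lambda>w. f w *\<^sub>R X w + g w *\<^sub>R Y w)]) v =
                  f v * T \<theta>s (Xs[j := X]) v + g v * T \<theta>s (Xs[j := Y]) v)))"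

definition admissible :: "'m set \<Rightarrow> ('m \<Rightarrow> 'e) \<Rightarrow> bool" where
  "admissible \<Omega> V \<longleftrightarrow> open \<Omega> \<and> vector_field \<Omega> V \<and> (\<forall>p\<in>\<Omega>. (p, V p) \<in> A)"

text \<open>Some admissible local extension of \<open>v\<close>, on which derivatives at \<open>v\<close> do not depend.\<close>

definition local_ext :: "'m \<times> 'e \<Rightarrow> 'm \<Rightarrow> 'e" where
  "local_ext v =
     (SOME V. \<exists>\<Omega>. admissible \<Omega> V \<and> fst v \<in> \<Omega> \<and> V (fst v) = snd v)"

text \<open>\<open>nabla v X Y\<close> is used for \<open>v\<close> in \<open>A\<close> and global vector fields \<open>X\<close>, \<open>Y\<close> only.\<close>

definition aniso_connection ::
    "('m \<times> 'e \<Rightarrow> ('m \<Rightarrow> 'e) \<Rightarrow> ('m \<Rightarrow> 'e) \<Rightarrow> 'e) \<Rightarrow> bool" where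
  "aniso_connection nabla \<longleftrightarrow>
     (\<forall>X Y. vector_field UNIV X \<and> vector_field UNIV Y \<longrightarrow> aniso_field (\<lambda>v. nabla v X Y)) \<and>
     (\<forall>v\<in>A. \<forall>X Y Z f h. vector_field UNIV X \<and> vector_field UNIV Y \<and> vector_field UNIV Z \<and>
        smooth_fun UNIV f \<and> smooth_fun UNIV h \<longrightarrow>
        nabla v X (\<lambda>q. Y q + Z q) = nabla v X Y + nabla v X Z \<and>
        nabla v X (\<lambda>q. f q *\<^sub>R Y q) =
          dir_deriv (fst v) (X (fst v)) f *\<^sub>R Y (fst v) + f (fst v) *\<^sub>R nabla v X Y \<and>
        nabla v (\<lambda>q. f q *\<^sub>R X q + h q *\<^sub>R Y q) Z =
          f (fst v) *\<^sub>R nabla v X Z + h (fst v) *\<^sub>R nabla v Y Z)"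

end

text \<open>The vertical derivative in direction \<open>z\<close>, for functions and for sections.\<close>

definition vert_deriv :: "('m \<times> 'e \<Rightarrow> 'b::real_normed_vector) \<Rightarrow> 'm \<times> 'e \<Rightarrow> 'e \<Rightarrow> 'b" where
  "vert_deriv h v z = vector_derivative (\<lambda>t. h (fst v, snd v + t *\<^sub>R z)) (at 0)"

context
  fixes nabla :: "'m \<times> 'e \<Rightarrow> ('m \<Rightarrow> 'e) \<Rightarrow> ('m \<Rightarrow> 'e) \<Rightarrow> 'e"
begin

text \<open>The connection at \<open>v\<close> on a tangent vector \<open>u\<close> at the base point of \<open>v\<close> and a vector field
  \<open>Y\<close> defined near that point.\<close>

definition cov :: "'m \<times> 'e \<Rightarrow> 'e \<Rightarrow> ('m \<Rightarrow> 'e) \<Rightarrow> 'e" where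
  "cov v u Y = nabla v (ext_vec (fst v) u) (ext_germ (fst v) Y)"

definition induced_connection :: "('m \<Rightarrow> 'e) \<Rightarrow> 'm \<Rightarrow> 'e \<Rightarrow> ('m \<Rightarrow> 'e) \<Rightarrow> 'e" where
  "induced_connection V p u Y = cov (p, V p) u Y"

text \<open>\<open>P\<^sub>v(u,Y,z)\<close>\<close>

definition vert_connection :: "'m \<times> 'e \<Rightarrow> 'e \<Rightarrow> ('m \<Rightarrow> 'e) \<Rightarrow> 'e \<Rightarrow> 'e" where
  "vert_connection v u Y z = vert_deriv (\<lambda>w. cov w u Y) v z"

context
  fixes A :: "('m \<times> 'e) set"
begin

text \<open>\<open>V\<close> extends \<open>v\<close> over \<open>\<Omega>\<close> and its derivative vanishes at \<open>v\<close>.\<close>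

definition adapted_ext :: "'m \<times> 'e \<Rightarrow> 'm set \<Rightarrow> ('m \<Rightarrow> 'e) \<Rightarrow> bool" where
  "adapted_ext v \<Omega> V \<longleftrightarrow> admissible A \<Omega> V \<and> fst v \<in> \<Omega> \<and> V (fst v) = snd v \<and>
     (\<forall>X. vector_field \<Omega> X \<longrightarrow> cov v (X (fst v)) V = 0)"

text \<open>Derivatives at \<open>v\<close> in the direction of the tangent vector \<open>u\<close>.\<close>

definition fun_deriv :: "('m \<times> 'e \<Rightarrow> real) \<Rightarrow> 'm \<times> 'e \<Rightarrow> 'e \<Rightarrow> real" where
  "fun_deriv h v u =
     (let V = local_ext A v in
        dir_deriv (fst v) u (\<lambda>q. h (q, V q)) - vert_deriv h v (cov v u V))"

definition field_deriv :: "('m \<times> 'e \<Rightarrow> 'e) \<Rightarrow> 'm \<times> 'e \<Rightarrow> 'e \<Rightarrow> 'e" where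
  "field_deriv Y v u =
     (let V = local_ext A v in cov v u (\<lambda>q. Y (q, V q)) - vert_deriv Y v (cov v u V))"

text \<open>The multilinear map \<open>T\<^sub>v\<close> on the cotangent and tangent spaces at the base point of \<open>v\<close>.\<close>

definition tensor_at ::
    "(('m \<times> 'e \<Rightarrow> 'e \<Rightarrow>\<^sub>L real) list \<Rightarrow> ('m \<times> 'e \<Rightarrow> 'e) list \<Rightarrow> 'm \<times> 'e \<Rightarrow> real) \<Rightarrow>
     'm \<times> 'e \<Rightarrow> ('e \<Rightarrow>\<^sub>L real) list \<Rightarrow> 'e list \<Rightarrow> real" where
  "tensor_at T v \<alpha>s us =
     T (map (\<lambda>\<alpha>. SOME \<theta>. aniso_form A \<theta> \<and> \<theta> v = \<alpha>) \<alpha>s)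
       (map (\<lambda>u. SOME X. aniso_field A X \<and> X v = u) us) v"

text \<open>The classical tensor field \<open>T\<^sub>V\<close>.\<close>

definition tensor_along ::
    "(('m \<times> 'e \<Rightarrow> 'e \<Rightarrow>\<^sub>L real) list \<Rightarrow> ('m \<times> 'e \<Rightarrow> 'e) list \<Rightarrow> 'm \<times> 'e \<Rightarrow> real) \<Rightarrow>
     ('m \<Rightarrow> 'e) \<Rightarrow> 'm \<Rightarrow> ('e \<Rightarrow>\<^sub>L real) list \<Rightarrow> 'e list \<Rightarrow> real" where
  "tensor_along T V p = tensor_at T (p, V p)"

text \<open>The derivative of \<open>T\<close> at \<open>v\<close> in direction \<open>u\<close>, evaluated on covectors and vectors: the product
  rule applied to one-forms and vector fields on the manifold that extend them.\<close>

definition tensor_deriv ::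
    "(('m \<times> 'e \<Rightarrow> 'e \<Rightarrow>\<^sub>L real) list \<Rightarrow> ('m \<times> 'e \<Rightarrow> 'e) list \<Rightarrow> 'm \<times> 'e \<Rightarrow> real) \<Rightarrow>
     'm \<times> 'e \<Rightarrow> 'e \<Rightarrow> ('e \<Rightarrow>\<^sub>L real) list \<Rightarrow> 'e list \<Rightarrow> real" where
  "tensor_deriv T v u \<alpha>s us =
     (let \<theta>s = map (ext_covec (fst v)) \<alpha>s; Xs = map (ext_vec (fst v)) us in
        fun_deriv (T (map (\<lambda>\<theta>. \<theta> \<circ> fst) \<theta>s) (map (\<lambda>X. X \<circ> fst) Xs)) v u
        - (\<Sum>i<length \<alpha>s. tensor_at T v (\<alpha>s[i := form_deriv (fst v) (cov v) u (\<theta>s ! i)]) us)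
        - (\<Sum>j<length us. tensor_at T v \<alpha>s (us[j := cov v u (Xs ! j)])))"

text \<open>\<open>R\<^sub>v(X,Y)Z\<close> for vector fields on the manifold, and the trilinear map \<open>R\<^sub>v\<close> on the tangent space.\<close>

definition curv :: "'m \<times> 'e \<Rightarrow> ('m \<Rightarrow> 'e) \<Rightarrow> ('m \<Rightarrow> 'e) \<Rightarrow> ('m \<Rightarrow> 'e) \<Rightarrow> 'e" where
  "curv v X Y Z =
     field_deriv (\<lambda>w. nabla w Y Z) v (X (fst v)) - field_deriv (\<lambda>w. nabla w X Z) v (Y (fst v))
     - nabla v (lie_bracket X Y) Z"

definition curv_at :: "'m \<times> 'e \<Rightarrow> 'e \<Rightarrow> 'e \<Rightarrow> 'e \<Rightarrow> 'e" where
  "curv_at v x y z = curv v (ext_vec (fst v) x) (ext_vec (fst v) y) (ext_vec (fst v) z)"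

text \<open>\<open>(\<nabla>\<^sub>u R)\<^sub>v(y,z)w\<close> by the product rule.\<close>

definition curv_deriv :: "'m \<times> 'e \<Rightarrow> 'e \<Rightarrow> 'e \<Rightarrow> 'e \<Rightarrow> 'e \<Rightarrow> 'e" where
  "curv_deriv v u y z w =
     (let Y = ext_vec (fst v) y; Z = ext_vec (fst v) z; W = ext_vec (fst v) w in
        field_deriv (\<lambda>v'. curv v' Y Z W) v u
        - curv_at v (cov v u Y) z w
        - curv_at v y (cov v u Z) w
        - curv_at v y z (cov v u W))"

end
end
end

end

theory Submission
  imports Defs
begin

text \<open>
  In a chart, \<open>\<nabla>\<^sup>v\<^sub>X Y = DY(X) + \<Gamma>(x, y)(X, Y)\<close> with Christoffel symbols \<open>\<Gamma>\<close> that are smooth in the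
  coordinates \<open>(x, y)\<close> of \<open>v\<close>; cutting off gives the reduction to a chart. The affine field with
  value \<open>y\<close> and derivative \<open>u \<mapsto> - \<Gamma>(x, y)(u, y)\<close> at the base point is then an extension \<open>V\<close> of \<open>v\<close>
  with vanishing derivative, and along it the vertical corrections in the derivatives of functions
  and fields disappear, which gives (1) and (2). For (3), write \<open>R\<^sub>V\<close> for the anisotropic curvature
  evaluated along \<open>V\<close>. Differentiating \<open>x \<mapsto> \<Gamma>(x, V(x))\<close> shows
  \<open>R\<^sup>V(Y, Z)W = R\<^sub>V(Y, Z)W + P\<^sub>V(Z, W, \<nabla>\<^sup>V\<^sub>Y V) - P\<^sub>V(Y, W, \<nabla>\<^sup>V\<^sub>Z V)\<close> near the base point, and in the
  covariant derivative of this identity only the derivatives of \<open>\<nabla>\<^sup>V V\<close> survive at the base point,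
  because \<open>\<nabla>\<^sup>V V\<close> vanishes there.
\<close>

subsection \<open>Smooth maps\<close>

text \<open>A vector at \<open>p\<close> is stored by its coordinates in the chart that
  \<open>chart_at\<close> prefers at \<open>p\<close>, and this choice jumps with \<open>p\<close>,
  so nothing can be differentiated in the stored form: \<open>tcoord c\<close> first moves
  everything near a point into one fixed chart. The definitions also evaluate tensors, forms and
  derivatives on extensions picked by \<open>SOME\<close>. Each such value has to be shown
  independent of the pick, either from a coordinate formula that sees only values and first
  derivatives at the point, or by a cutoff argument. The split behind (3) is
  \<open>(a, DV a) = (a, - \<Gamma>(a, V)) + (0, \<nabla>_a V)\<close>: the horizontal part of the
  derivative of \<open>\<Gamma>\<close> sees only the point of the tangent bundle, the vertical part
  carries \<open>P\<close>. The vertical part vanishes at the base point but not around it, so it is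
  invisible in (2) and contributes its derivative in (3). The anisotropic curvature must be known to
  be smooth before it can be differentiated; this comes from (2), applied at every point with an
  adapted field of its own, because the resulting coordinate expression no longer mentions that
  field.\<close>

lemma Ck_on_cong:
  assumes "open S" and "\<And>x. x \<in> S \<Longrightarrow> f x = g x" and "Ck_on k S f"
  shows "Ck_on k S g"
  using assms(2,3)
proof (induction k arbitrary: f g)
  case 0
  then show ?case by (simp cong: continuous_on_cong)
next
  case (Suc k)
  have d: "f differentiable (at x)" if "x \<in> S" for x
    using Suc.prems(2) that by simp
  have "g differentiable (at x)" if "x \<in> S" for x
    using has_derivative_transform_within_open[OF _ assms(1) that, of f _ UNIV g] d[OF that] Suc.prems(1)
    unfolding differentiable_def by blast
  moreover have "Ck_on k S (\<lambda>x. frechet_derivative g (at x) d)" for d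
    by (rule Suc.IH[of "\<lambda>x. frechet_derivative f (at x) d"])
      (use Suc.prems frechet_derivative_transform_within_open[OF d assms(1)] in auto)
  ultimately show ?case by simp
qed

lemma Ck_on_subset: "Ck_on k S f \<Longrightarrow> T \<subseteq> S \<Longrightarrow> Ck_on k T f"
  by (induction k arbitrary: f) (auto intro: continuous_on_subset)

lemma Ck_on_imp_continuous_on:
  assumes "Ck_on k S f"
  shows "continuous_on S f"
proof (cases k)
  case 0
  then show ?thesis using assms by simp
next
  case (Suc m)
  show ?thesis
    by (intro continuous_at_imp_continuous_on ballI differentiable_imp_continuous_within)
      (use assms Suc in auto)
qed

lemma Ck_on_SucD: "Ck_on (Suc k) S f \<Longrightarrow> Ck_on k S f"
proof (induction k arbitrary: f)
  case 0
  then show ?case using Ck_on_imp_continuous_on[OF 0] by simp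
next
  case (Suc k)
  then show ?case by (metis Ck_on.simps(2))
qed

text \<open>\<open>Ck_on\<close> speaks of \<open>frechet_derivative\<close>; this rule accepts any
  explicit derivative \<open>f'\<close> instead, the two agreeing on \<open>S\<close> by
  uniqueness.\<close>

lemma Ck_on_SucI:
  assumes "open S" and "\<And>x. x \<in> S \<Longrightarrow> (f has_derivative f' x) (at x)"
    and "\<And>d. Ck_on k S (\<lambda>x. f' x d)"
  shows "Ck_on (Suc k) S f"
proof -
  have "Ck_on k S (\<lambda>x. frechet_derivative f (at x) d)" for d
    by (rule Ck_on_cong[OF assms(1) _ assms(3)[of d]])
      (use frechet_derivative_at[OF assms(2)] in metis)
  then show ?thesis using assms(2) by (auto simp: differentiable_def)
qed

lemma Ck_on_has_derivative:
  assumes "Ck_on (Suc k) S f" "x \<in> S"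
  shows "(f has_derivative frechet_derivative f (at x)) (at x)"
  using assms frechet_derivative_works by auto

lemma Ck_on_const: "Ck_on k S (\<lambda>x. c)"
  by (induction k arbitrary: c) auto

lemma Ck_on_bounded_linear:
  assumes "bounded_linear L" and "open S" and "Ck_on k S f"
  shows "Ck_on k S (\<lambda>x. L (f x))"
  using assms(3)
proof (induction k arbitrary: f)
  case 0
  then show ?case by (simp add: bounded_linear.continuous_on[OF assms(1)])
next
  case (Suc k)
  show ?case
    by (rule Ck_on_SucI[OF assms(2) bounded_linear.has_derivative[OF assms(1) Ck_on_has_derivative[OF Suc.prems]]])
      (use Suc in auto)
qed

lemma Ck_on_add:
  assumes "open S" "Ck_on k S f" "Ck_on k S g"
  shows "Ck_on k S (\<lambda>x. f x + g x)"
  using assms(2,3)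
proof (induction k arbitrary: f g)
  case 0
  then show ?case by (simp add: continuous_on_add)
next
  case (Suc k)
  show ?case
    by (rule Ck_on_SucI[OF assms(1) has_derivative_add[OF Ck_on_has_derivative[OF Suc.prems(1)] Ck_on_has_derivative[OF Suc.prems(2)]]])
      (use Suc in auto)
qed

lemma Ck_on_bilinear:
  assumes "bounded_bilinear B" and "open S" and "Ck_on k S f" "Ck_on k S g"
  shows "Ck_on k S (\<lambda>x. B (f x) (g x))"
  using assms(3,4)
proof (induction k arbitrary: f g)
  case 0
  then show ?case by (simp add: bounded_bilinear.continuous_on[OF assms(1)])
next
  case (Suc k)
  show ?case
    by (rule Ck_on_SucI[OF assms(2) bounded_bilinear.FDERIV[OF assms(1) Ck_on_has_derivative[OF Suc.prems(1)] Ck_on_has_derivative[OF Suc.prems(2)]]])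
      (use Suc Ck_on_SucD[OF Suc.prems(1)] Ck_on_SucD[OF Suc.prems(2)] in \<open>auto intro!: Ck_on_add[OF assms(2)]\<close>)
qed

lemma Ck_on_sum:
  assumes "open S" "\<And>i. i \<in> I \<Longrightarrow> Ck_on k S (f i)"
  shows "Ck_on k S (\<lambda>x. \<Sum>i\<in>I. f i x)"
  using assms(2)
  by (induction I rule: infinite_finite_induct) (auto intro!: Ck_on_const Ck_on_add[OF assms(1)])

lemma linear_expand_Basis:
  fixes f :: "'a::euclidean_space \<Rightarrow> 'b::real_vector"
  assumes "linear f"
  shows "f u = (\<Sum>b\<in>Basis. (u \<bullet> b) *\<^sub>R f b)"
proof -
  have "f u = f (\<Sum>b\<in>Basis. (u \<bullet> b) *\<^sub>R b)" by (simp add: euclidean_representation)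
  also have "\<dots> = (\<Sum>b\<in>Basis. (u \<bullet> b) *\<^sub>R f b)"
    by (simp add: linear_sum[OF assms] linear_scale[OF assms])
  finally show ?thesis .
qed

text \<open>By the chain rule the derivative is \<open>Dg (f x)\<close> applied to the moving vector
  \<open>Df x d\<close>, whereas \<open>Ck_on\<close> controls only fixed directions. Expanding the
  moving vector in \<open>Basis\<close> leaves sums of products of C^k functions; this is why the
  middle space is Euclidean.\<close>

lemma Ck_on_compose:
  fixes f :: "'a::real_normed_vector \<Rightarrow> 'b::euclidean_space"
  assumes "open S" "open T" "f ` S \<subseteq> T" and "Ck_on k S f" "Ck_on k T g"
  shows "Ck_on k S (\<lambda>x. g (f x))"
  using assms(4,5)
proof (induction k arbitrary: g)
  case 0
  then show ?case using assms(3) by (auto intro: continuous_on_compose2)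
next
  case (Suc k)
  let ?D = "\<lambda>x d. frechet_derivative g (at (f x)) (frechet_derivative f (at x) d)"
  have fx: "f x \<in> T" if "x \<in> S" for x using assms(3) that by auto
  have D: "((\<lambda>x. g (f x)) has_derivative ?D x) (at x)" if "x \<in> S" for x
    using has_derivative_compose[OF Ck_on_has_derivative[OF Suc.prems(1) that]
      Ck_on_has_derivative[OF Suc.prems(2) fx[OF that]]] .
  have eq: "(\<Sum>b\<in>Basis. (frechet_derivative f (at x) d \<bullet> b) *\<^sub>R frechet_derivative g (at (f x)) b) = ?D x d"
    if "x \<in> S" for x d
    by (rule linear_expand_Basis[OF linear_frechet_derivative, symmetric]) (use Suc.prems(2) fx[OF that] in auto)
  have C: "Ck_on k S (\<lambda>x. ?D x d)" for d
  proof (rule Ck_on_cong[OF assms(1) eq])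
    show "Ck_on k S (\<lambda>x. \<Sum>b\<in>Basis. (frechet_derivative f (at x) d \<bullet> b) *\<^sub>R
          frechet_derivative g (at (f x)) b)"
      by (intro Ck_on_sum Ck_on_bilinear[OF bounded_bilinear_scaleR] assms(1)
          Ck_on_bounded_linear[OF bounded_linear_inner_left] Suc.IH Ck_on_SucD[OF Suc.prems(1)])
        (use Suc.prems in auto)
  qed
  show ?case by (rule Ck_on_SucI[OF assms(1) D C])
qed

text \<open>\<open>Ck_on\<close> uses derivatives in full neighbourhoods, so it is a local condition
  at every order.\<close>

lemma Ck_on_open_local:
  assumes "\<And>x. x \<in> S \<Longrightarrow> \<exists>T. open T \<and> x \<in> T \<and> Ck_on k T f"
  shows "Ck_on k S f"
  using assms
proof (induction k arbitrary: f)
  case 0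
  then show ?case
    by simp (metis continuous_at_imp_continuous_on continuous_on_eq_continuous_at)
next
  case (Suc k)
  have "f differentiable (at x)" if "x \<in> S" for x
    using Suc.prems[OF that] by auto
  moreover have "Ck_on k S (\<lambda>x. frechet_derivative f (at x) d)" for d
    by (rule Suc.IH) (use Suc.prems in fastforce)
  ultimately show ?case by simp
qed

lemma Ck_on_Pair:
  assumes "open S" "Ck_on k S f" "Ck_on k S g"
  shows "Ck_on k S (\<lambda>x. (f x, g x))"
proof -
  have "bounded_linear (\<lambda>a. (a, 0))" "bounded_linear (\<lambda>a. (0, a))"
    by (intro bounded_linear_Pair bounded_linear_ident bounded_linear_zero)+
  from Ck_on_add[OF assms(1) Ck_on_bounded_linear[OF this(1) assms(1,2)]
    Ck_on_bounded_linear[OF this(2) assms(1,3)]]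
  show ?thesis by simp
qed

lemma Ck_on_ident: "Ck_on k S (\<lambda>x. x)"
  by (cases k) (auto intro: Ck_on_const)

text \<open>The induction closes because the derivative of \<open>inverse\<close> is a product of
  copies of \<open>inverse\<close> and the constant direction.\<close>

lemma Ck_on_inverse: "Ck_on k (-{0::real}) inverse"
proof (induction k)
  case (Suc k)
  have o: "open (- {0::real})" by (intro open_Compl closed_singleton)
  show ?case
  proof (rule Ck_on_SucI[OF o, where f' = "\<lambda>x h. - (inverse x * h * inverse x)"])
    show "(inverse has_derivative (\<lambda>h. - (inverse x * h * inverse x))) (at x)" if "x \<in> - {0}" for x :: real
      using has_derivative_inverse'[of x UNIV] that by simp
    show "Ck_on k (- {0}) (\<lambda>x. - (inverse x * d * inverse x))" for d :: real
      by (intro Ck_on_bounded_linear[OF bounded_linear_minus[OF bounded_linear_ident] o]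
          Ck_on_bilinear[OF bounded_bilinear_mult o] Suc Ck_on_const)
  qed
qed (auto intro!: continuous_on_inverse)

section \<open>Closure properties of smooth maps\<close>

lemma smooth_on_cong: "open S \<Longrightarrow> (\<And>x. x \<in> S \<Longrightarrow> f x = g x) \<Longrightarrow> smooth_on S f \<Longrightarrow> smooth_on S g"
  unfolding smooth_on_def using Ck_on_cong by blast

lemma smooth_on_subset: "smooth_on S f \<Longrightarrow> T \<subseteq> S \<Longrightarrow> smooth_on T f"
  unfolding smooth_on_def using Ck_on_subset by blast

lemma smooth_on_const: "smooth_on S (\<lambda>x. c)"
  unfolding smooth_on_def using Ck_on_const by blast

lemma smooth_on_ident: "smooth_on S (\<lambda>x. x)"
  unfolding smooth_on_def using Ck_on_ident by blast

lemma smooth_on_bounded_linear: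
  "bounded_linear L \<Longrightarrow> open S \<Longrightarrow> smooth_on S f \<Longrightarrow> smooth_on S (\<lambda>x. L (f x))"
  unfolding smooth_on_def using Ck_on_bounded_linear by blast

lemma smooth_on_add:
  "open S \<Longrightarrow> smooth_on S f \<Longrightarrow> smooth_on S g \<Longrightarrow> smooth_on S (\<lambda>x. f x + g x)"
  unfolding smooth_on_def using Ck_on_add by blast

lemma smooth_on_minus: "open S \<Longrightarrow> smooth_on S f \<Longrightarrow> smooth_on S (\<lambda>x. - f x)"
  by (rule smooth_on_bounded_linear[OF bounded_linear_minus[OF bounded_linear_ident]])

lemma smooth_on_diff:
  "open S \<Longrightarrow> smooth_on S f \<Longrightarrow> smooth_on S g \<Longrightarrow> smooth_on S (\<lambda>x. f x - g x)"
  using smooth_on_add[OF _ _ smooth_on_minus, of S f g] by simp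

lemma smooth_on_bilinear:
  "bounded_bilinear B \<Longrightarrow> open S \<Longrightarrow> smooth_on S f \<Longrightarrow> smooth_on S g \<Longrightarrow> smooth_on S (\<lambda>x. B (f x) (g x))"
  unfolding smooth_on_def using Ck_on_bilinear by blast

lemmas smooth_on_scaleR = smooth_on_bilinear[OF bounded_bilinear_scaleR]
lemmas smooth_on_mult = smooth_on_bilinear[OF bounded_bilinear_mult]
lemmas smooth_on_inner = smooth_on_bilinear[OF bounded_bilinear_inner]
lemmas smooth_on_blinfun_apply = smooth_on_bilinear[OF bounded_bilinear_blinfun_apply]

lemma smooth_on_sum:
  "open S \<Longrightarrow> (\<And>i. i \<in> I \<Longrightarrow> smooth_on S (f i)) \<Longrightarrow> smooth_on S (\<lambda>x. \<Sum>i\<in>I. f i x)"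
  unfolding smooth_on_def by (simp add: Ck_on_sum)

lemma smooth_on_Pair:
  "open S \<Longrightarrow> smooth_on S f \<Longrightarrow> smooth_on S g \<Longrightarrow> smooth_on S (\<lambda>x. (f x, g x))"
  unfolding smooth_on_def using Ck_on_Pair by blast

lemma smooth_on_compose:
  fixes f :: "'a::real_normed_vector \<Rightarrow> 'b::euclidean_space"
  shows "open S \<Longrightarrow> open T \<Longrightarrow> f ` S \<subseteq> T \<Longrightarrow> smooth_on S f \<Longrightarrow> smooth_on T g \<Longrightarrow>
    smooth_on S (\<lambda>x. g (f x))"
  unfolding smooth_on_def using Ck_on_compose by blast

lemma smooth_on_open_local:
  "(\<And>x. x \<in> S \<Longrightarrow> \<exists>T. open T \<and> x \<in> T \<and> smooth_on T f) \<Longrightarrow> smooth_on S f"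
  unfolding smooth_on_def by (meson Ck_on_open_local)

lemma smooth_on_differentiable: "smooth_on S f \<Longrightarrow> x \<in> S \<Longrightarrow> f differentiable (at x)"
  unfolding smooth_on_def by (metis Ck_on.simps(2))

lemma smooth_on_has_derivative:
  "smooth_on S f \<Longrightarrow> x \<in> S \<Longrightarrow> (f has_derivative frechet_derivative f (at x)) (at x)"
  using smooth_on_differentiable frechet_derivative_works by blast

lemma smooth_on_continuous_on: "smooth_on S f \<Longrightarrow> continuous_on S f"
  unfolding smooth_on_def using Ck_on_imp_continuous_on by blast

lemma smooth_on_frechet_derivative: "smooth_on S f \<Longrightarrow> smooth_on S (\<lambda>x. frechet_derivative f (at x) d)"
  unfolding smooth_on_def by (metis Ck_on.simps(2))

text \<open>A basis expansion turns smoothness for each fixed argument into smoothness for a moving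
  one, without a topology on the space of linear maps. It serves derivatives in moving directions
  and forms evaluated on moving vectors.\<close>

lemma smooth_on_linear_apply:
  fixes Y :: "'a::real_normed_vector \<Rightarrow> 'b::euclidean_space"
  assumes "open S" and "\<And>x. x \<in> S \<Longrightarrow> linear (L x)" and "\<And>b. smooth_on S (\<lambda>x. L x b)"
    and "smooth_on S Y"
  shows "smooth_on S (\<lambda>x. L x (Y x))"
proof (rule smooth_on_cong[OF assms(1)])
  show "(\<Sum>b\<in>Basis. (Y x \<bullet> b) *\<^sub>R L x b) = L x (Y x)" if "x \<in> S" for x
    by (rule linear_expand_Basis[OF assms(2)[OF that], symmetric])
  show "smooth_on S (\<lambda>x. \<Sum>b\<in>Basis. (Y x \<bullet> b) *\<^sub>R L x b)"
    by (intro smooth_on_sum smooth_on_scaleR smooth_on_bounded_linear[OF bounded_linear_inner_left] assms)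
qed

lemma smooth_on_frechet_derivative_apply:
  fixes f :: "'b::euclidean_space \<Rightarrow> 'c::real_normed_vector"
  assumes "open S" "open T" "smooth_on T f" "g ` S \<subseteq> T" "smooth_on S g" "smooth_on S h"
  shows "smooth_on S (\<lambda>x. frechet_derivative f (at (g x)) (h x))"
proof (rule smooth_on_linear_apply[OF assms(1) _ _ assms(6)])
  show "linear (frechet_derivative f (at (g x)))" if "x \<in> S" for x
    using linear_frechet_derivative smooth_on_differentiable[OF assms(3)] assms(4) that by blast
  show "smooth_on S (\<lambda>x. frechet_derivative f (at (g x)) b)" for b
    by (rule smooth_on_compose[OF assms(1,2,4,5) smooth_on_frechet_derivative[OF assms(3)]])
qed

text \<open>The product rule for evaluating a family of linear maps. In finite dimension it suffices
  that each \<open>L y b\<close> is differentiable in \<open>y\<close>, so the family itself is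
  never differentiated as an operator-valued map.\<close>

lemma has_derivative_linear_apply:
  fixes Y :: "'a::real_normed_vector \<Rightarrow> 'b::euclidean_space"
  assumes "open S" "x \<in> S" and "\<And>y. y \<in> S \<Longrightarrow> linear (L y)"
    and "\<And>b. (\<lambda>y. L y b) differentiable (at x)" and "(Y has_derivative Y') (at x)"
  shows "((\<lambda>y. L y (Y y)) has_derivative
    (\<lambda>u. frechet_derivative (\<lambda>y. L y (Y x)) (at x) u + L x (Y' u))) (at x)"
proof -
  let ?D = "\<lambda>b. frechet_derivative (\<lambda>y. L y b) (at x)"
  have D: "((\<lambda>y. L y b) has_derivative ?D b) (at x)" for b
    using assms(4) frechet_derivative_works by blast
  have ex: "L y w = (\<Sum>b\<in>Basis. (w \<bullet> b) *\<^sub>R L y b)" if "y \<in> S" for y w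
    by (rule linear_expand_Basis[OF assms(3)[OF that]])
  have "((\<lambda>y. \<Sum>b\<in>Basis. (Y x \<bullet> b) *\<^sub>R L y b) has_derivative (\<lambda>u. \<Sum>b\<in>Basis. (Y x \<bullet> b) *\<^sub>R ?D b u)) (at x)"
    by (intro has_derivative_sum bounded_linear.has_derivative[OF bounded_linear_scaleR_right] D)
  then have "((\<lambda>y. L y (Y x)) has_derivative (\<lambda>u. \<Sum>b\<in>Basis. (Y x \<bullet> b) *\<^sub>R ?D b u)) (at x)"
    by (rule has_derivative_transform_within_open[OF _ assms(1,2)]) (simp add: ex[symmetric])
  then have 1: "?D (Y x) = (\<lambda>u. \<Sum>b\<in>Basis. (Y x \<bullet> b) *\<^sub>R ?D b u)"
    by (rule frechet_derivative_at[symmetric])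
  have "((\<lambda>y. \<Sum>b\<in>Basis. (Y y \<bullet> b) *\<^sub>R L y b) has_derivative
     (\<lambda>u. \<Sum>b\<in>Basis. (Y x \<bullet> b) *\<^sub>R ?D b u + (Y' u \<bullet> b) *\<^sub>R L x b)) (at x)"
    by (intro has_derivative_sum bounded_bilinear.FDERIV[OF bounded_bilinear_scaleR] D
        bounded_linear.has_derivative[OF bounded_linear_inner_left] assms(5))
  then have "((\<lambda>y. L y (Y y)) has_derivative
     (\<lambda>u. \<Sum>b\<in>Basis. (Y x \<bullet> b) *\<^sub>R ?D b u + (Y' u \<bullet> b) *\<^sub>R L x b)) (at x)"
    by (rule has_derivative_transform_within_open[OF _ assms(1,2)]) (simp add: ex[symmetric])
  then show ?thesis
    unfolding 1 sum.distrib ex[OF assms(2), symmetric] .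
qed

subsection \<open>Symmetry of second derivatives\<close>

text \<open>The mean value theorem is used twice: along \<open>u\<close> for the difference of
  \<open>f\<close> on two parallel edges of the box, then along \<open>v\<close> for the directional
  derivative of \<open>f\<close> in direction \<open>u\<close>.\<close>

lemma second_difference_mean_value:
  fixes f :: "'a::real_normed_vector \<Rightarrow> real"
  assumes S: "smooth_on S f" and h: "0 < h"
    and box: "\<And>s t. 0 \<le> s \<Longrightarrow> s \<le> h \<Longrightarrow> 0 \<le> t \<Longrightarrow> t \<le> h \<Longrightarrow> x + s *\<^sub>R u + t *\<^sub>R v \<in> S"
  shows "\<exists>s t. 0 \<le> s \<and> s \<le> h \<and> 0 \<le> t \<and> t \<le> h \<and>
    f (x + h *\<^sub>R u + h *\<^sub>R v) - f (x + h *\<^sub>R u) - f (x + h *\<^sub>R v) + f x =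
    h * (h * frechet_derivative (\<lambda>y. frechet_derivative f (at y) u) (at (x + s *\<^sub>R u + t *\<^sub>R v)) v)"
proof -
  have lin: "frechet_derivative g (at y) (r *\<^sub>R w) = r * frechet_derivative g (at y) w"
    if "smooth_on S g" "y \<in> S" for g :: "'a \<Rightarrow> real" and y r w
    using linear_scale[OF linear_frechet_derivative[OF smooth_on_differentiable[OF that]]] by simp
  let ?D = "\<lambda>y. frechet_derivative f (at y) u"
  have SD: "smooth_on S ?D" by (rule smooth_on_frechet_derivative[OF S])
  have d1: "((\<lambda>s. f (x + s *\<^sub>R u + t *\<^sub>R v)) has_real_derivative ?D (x + s *\<^sub>R u + t *\<^sub>R v)) (at s)"
    if "0 \<le> s" "s \<le> h" "0 \<le> t" "t \<le> h" for s t
    unfolding has_field_derivative_def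
    by (rule has_derivative_eq_rhs, rule has_derivative_compose[where f = "\<lambda>s. x + s *\<^sub>R u + t *\<^sub>R v"])
      (auto intro!: derivative_eq_intros smooth_on_has_derivative[OF S] box that ext simp: lin[OF S box] that)
  \<comment> \<open>The summand \<open>0 *\<^sub>R v\<close> keeps both edges in the form covered by
    \<open>d1\<close>.\<close>
  let ?\<phi> = "\<lambda>s. f (x + s *\<^sub>R u + h *\<^sub>R v) - f (x + s *\<^sub>R u + 0 *\<^sub>R v)"
  have "\<exists>s. s > 0 \<and> s < h \<and> ?\<phi> h - ?\<phi> 0 = (h - 0) * (?D (x + s *\<^sub>R u + h *\<^sub>R v) - ?D (x + s *\<^sub>R u + 0 *\<^sub>R v))"
    by (rule MVT2[OF h]) (intro DERIV_diff d1, use h in auto)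
  then obtain s where s: "0 < s" "s < h"
    and 1: "?\<phi> h - ?\<phi> 0 = h * (?D (x + s *\<^sub>R u + h *\<^sub>R v) - ?D (x + s *\<^sub>R u + 0 *\<^sub>R v))" by auto
  have d2: "((\<lambda>t. ?D (x + s *\<^sub>R u + t *\<^sub>R v)) has_real_derivative
     frechet_derivative ?D (at (x + s *\<^sub>R u + t *\<^sub>R v)) v) (at t)"
    if "0 \<le> t" "t \<le> h" for t
    unfolding has_field_derivative_def
    by (rule has_derivative_eq_rhs, rule has_derivative_compose[where f = "\<lambda>t. x + s *\<^sub>R u + t *\<^sub>R v"])
      (use s in \<open>auto intro!: derivative_eq_intros smooth_on_has_derivative[OF SD] box that ext simp: lin[OF SD box] that\<close>)
  have "\<exists>t. t > 0 \<and> t < h \<and> ?D (x + s *\<^sub>R u + h *\<^sub>R v) - ?D (x + s *\<^sub>R u + 0 *\<^sub>R v) =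
     (h - 0) * frechet_derivative ?D (at (x + s *\<^sub>R u + t *\<^sub>R v)) v"
    by (rule MVT2[OF h]) (use d2 in auto)
  then obtain t where "0 < t" "t < h" and 2: "?D (x + s *\<^sub>R u + h *\<^sub>R v) - ?D (x + s *\<^sub>R u + 0 *\<^sub>R v) =
     h * frechet_derivative ?D (at (x + s *\<^sub>R u + t *\<^sub>R v)) v" by auto
  with s 1 show ?thesis
    by (intro exI[of _ s] exI[of _ t]) (auto simp: algebra_simps)
qed

text \<open>The second difference over a small parallelogram is symmetric in \<open>u\<close> and
  \<open>v\<close>, so its two mean value expressions equate a value of one mixed derivative with a
  value of the other, both taken near \<open>x\<close>. Continuity at \<open>x\<close> forbids this
  if the two differ there.\<close>

lemma smooth_on_second_derivative_commute_real:
  fixes f :: "'a::real_normed_vector \<Rightarrow> real"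
  assumes "open S" "x \<in> S" and S: "smooth_on S f"
  shows "frechet_derivative (\<lambda>y. frechet_derivative f (at y) u) (at x) v =
    frechet_derivative (\<lambda>y. frechet_derivative f (at y) v) (at x) u" (is "?P x = ?Q x")
proof (rule ccontr)
  assume ne: "?P x \<noteq> ?Q x"
  let ?e = "\<bar>?P x - ?Q x\<bar> / 2"
  have e: "?e > 0" using ne by simp
  have "isCont ?P x" "isCont ?Q x"
    using smooth_on_continuous_on[OF smooth_on_frechet_derivative[OF smooth_on_frechet_derivative[OF S]]]
      assms(1,2) continuous_on_eq_continuous_at by blast+
  then obtain d1 d2 where d: "d1 > 0" "d2 > 0"
    and P: "\<And>y. dist y x < d1 \<Longrightarrow> \<bar>?P y - ?P x\<bar> < ?e" and Q: "\<And>y. dist y x < d2 \<Longrightarrow> \<bar>?Q y - ?Q x\<bar> < ?e"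
    using e unfolding continuous_at_eps_delta dist_real_def by metis
  obtain d3 where d3: "d3 > 0" "ball x d3 \<subseteq> S" using assms(1,2) open_contains_ball by blast
  define d where "d = min d1 (min d2 d3)"
  have dp: "d > 0" using d d3 by (simp add: d_def)
  \<comment> \<open>The summand 1 keeps the denominator positive if \<open>u\<close> and
    \<open>v\<close> are both zero; \<open>h\<close> is small enough for the parallelogram to stay
    within distance \<open>d\<close> of \<open>x\<close>.\<close>
  define h where "h = d / (norm u + norm v + 1)"
  have n: "norm u + norm v + 1 > 0" by (simp add: add_nonneg_pos)
  have h: "h > 0" using dp n by (simp add: h_def)
  have hb: "h * (norm u + norm v) < d"
  proof -
    have "h * (norm u + norm v) < h * (norm u + norm v + 1)" using h by simp
    also have "\<dots> = d" using n by (simp add: h_def)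
    finally show ?thesis .
  qed
  have near: "dist (x + s *\<^sub>R a + t *\<^sub>R b) x < d"
    if "0 \<le> s" "s \<le> h" "0 \<le> t" "t \<le> h" "(a, b) = (u, v) \<or> (a, b) = (v, u)" for s t a b
  proof -
    have "norm (s *\<^sub>R a + t *\<^sub>R b) \<le> s * norm a + t * norm b"
      using norm_triangle_ineq[of "s *\<^sub>R a" "t *\<^sub>R b"] that by simp
    also have "\<dots> \<le> h * norm a + h * norm b" using that by (intro add_mono mult_right_mono) auto
    also have "\<dots> < d" using hb that(5) by (auto simp: algebra_simps)
    finally show ?thesis by (simp add: dist_norm algebra_simps)
  qed
  have inS: "y \<in> S" if "dist y x < d" for y using d3 that by (auto simp: d_def dist_commute)
  obtain s t where st: "0 \<le> s" "s \<le> h" "0 \<le> t" "t \<le> h" and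
    1: "f (x + h *\<^sub>R u + h *\<^sub>R v) - f (x + h *\<^sub>R u) - f (x + h *\<^sub>R v) + f x = h * (h * ?P (x + s *\<^sub>R u + t *\<^sub>R v))"
    using second_difference_mean_value[OF S h, of x u v] near inS by blast
  obtain s' t' where st': "0 \<le> s'" "s' \<le> h" "0 \<le> t'" "t' \<le> h" and
    2: "f (x + h *\<^sub>R v + h *\<^sub>R u) - f (x + h *\<^sub>R v) - f (x + h *\<^sub>R u) + f x = h * (h * ?Q (x + s' *\<^sub>R v + t' *\<^sub>R u))"
    using second_difference_mean_value[OF S h, of x v u] near inS by blast
  have "h * (h * ?P (x + s *\<^sub>R u + t *\<^sub>R v)) = h * (h * ?Q (x + s' *\<^sub>R v + t' *\<^sub>R u))"
    unfolding 1[symmetric] 2[symmetric] by (simp add: algebra_simps)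
  then have eq: "?P (x + s *\<^sub>R u + t *\<^sub>R v) = ?Q (x + s' *\<^sub>R v + t' *\<^sub>R u)" using h by simp
  have "\<bar>?P (x + s *\<^sub>R u + t *\<^sub>R v) - ?P x\<bar> < ?e"
    by (rule P) (use near[OF st] in \<open>simp add: d_def\<close>)
  moreover have "\<bar>?Q (x + s' *\<^sub>R v + t' *\<^sub>R u) - ?Q x\<bar> < ?e"
    by (rule Q) (use near[OF st'] in \<open>simp add: d_def\<close>)
  ultimately show False unfolding eq by argo
qed

text \<open>Componentwise, since the mean value argument needs real values; the inner product with a
  basis vector commutes with both derivatives.\<close>

lemma smooth_on_second_derivative_commute:
  fixes f :: "'a::real_normed_vector \<Rightarrow> 'b::euclidean_space"
  assumes "open S" "x \<in> S" and S: "smooth_on S f"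
  shows "frechet_derivative (\<lambda>y. frechet_derivative f (at y) u) (at x) v =
    frechet_derivative (\<lambda>y. frechet_derivative f (at y) v) (at x) u"
proof (rule euclidean_eqI)
  fix b :: 'b
  assume "b \<in> Basis"
  have in1: "frechet_derivative (\<lambda>y. g y \<bullet> b) (at y) w = frechet_derivative g (at y) w \<bullet> b"
    if "smooth_on S g" "y \<in> S" for g :: "'a \<Rightarrow> 'b" and y w
    using frechet_derivative_at[OF bounded_linear.has_derivative[OF bounded_linear_inner_left smooth_on_has_derivative[OF that]]]
    by metis
  have in2: "frechet_derivative (\<lambda>y. frechet_derivative f (at y) u) (at x) v \<bullet> b =
     frechet_derivative (\<lambda>y. frechet_derivative (\<lambda>y. f y \<bullet> b) (at y) u) (at x) v" for u v
  proof -
    have s: "smooth_on S (\<lambda>y. frechet_derivative f (at y) u)" by (rule smooth_on_frechet_derivative[OF S])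
    have "frechet_derivative (\<lambda>y. frechet_derivative f (at y) u \<bullet> b) (at x) =
      frechet_derivative (\<lambda>y. frechet_derivative (\<lambda>y. f y \<bullet> b) (at y) u) (at x)"
      by (rule frechet_derivative_transform_within_open[OF _ assms(1,2)])
        (auto intro!: smooth_on_differentiable[OF smooth_on_bounded_linear[OF bounded_linear_inner_left assms(1) s] assms(2)] simp: in1[OF S])
    then show ?thesis using in1[OF s assms(2)] by metis
  qed
  show "frechet_derivative (\<lambda>y. frechet_derivative f (at y) u) (at x) v \<bullet> b =
    frechet_derivative (\<lambda>y. frechet_derivative f (at y) v) (at x) u \<bullet> b"
    unfolding in2
    by (rule smooth_on_second_derivative_commute_real[OF assms(1,2) smooth_on_bounded_linear[OF bounded_linear_inner_left assms(1) S]])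
qed

subsection \<open>Bump functions\<close>

text \<open>The classical flat function exp(-1/x) is the case \<open>n = 0\<close>. The factor
  x^(-n) makes the family closed under differentiation up to linear combinations, which is what an
  induction on the order of smoothness needs.\<close>

definition flat_fun :: "nat \<Rightarrow> real \<Rightarrow> real" where
  "flat_fun n x = (if x > 0 then inverse x ^ n * exp (- inverse x) else 0)"

lemma flat_fun_tendsto_0: "(flat_fun n \<longlongrightarrow> 0) (at 0)"
proof (rule filterlim_split_at)
  have "((\<lambda>x. inverse x ^ n / exp (inverse x)) \<longlongrightarrow> 0) (at_right (0::real))"
    by (rule filterlim_compose[OF tendsto_power_div_exp_0 filterlim_inverse_at_top_right])
  then show "(flat_fun n \<longlongrightarrow> 0) (at_right 0)"
    by (rule Lim_transform_eventually)
      (auto simp: flat_fun_def exp_minus divide_inverse eventually_at_right_less intro!: eventually_at_rightI[of 0 1])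
  show "(flat_fun n \<longlongrightarrow> 0) (at_left 0)"
    by (rule tendsto_eventually) (auto simp: flat_fun_def intro!: eventually_at_leftI[of "-1"])
qed

lemma flat_fun_has_derivative:
  "(flat_fun n has_real_derivative flat_fun (n + 2) x - real n * flat_fun (Suc n) x) (at x)"
proof -
  consider "x > 0" | "x < 0" | "x = 0" by linarith
  then show ?thesis
  proof cases
    case 1
    have "((\<lambda>x. inverse x ^ n * exp (- inverse x)) has_real_derivative
       flat_fun (n + 2) x - real n * flat_fun (Suc n) x) (at x)"
    \<comment> \<open>The power rule produces the exponent \<open>n - Suc 0\<close>, which must be
      read separately for \<open>n = 0\<close>.\<close>
    proof (cases n)
      case (Suc m)
      have "((\<lambda>x. inverse x ^ n * exp (- inverse x)) has_real_derivative
         (real n * (- (inverse x * inverse x) * inverse x ^ (n - Suc 0))) * exp (- inverse x) +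
         (inverse x * inverse x) * exp (- inverse x) * inverse x ^ n) (at x)"
        using 1 by (auto intro!: derivative_eq_intros simp: power2_eq_square)
      moreover have "(real n * (- (inverse x * inverse x) * inverse x ^ (n - Suc 0))) * exp (- inverse x) +
         (inverse x * inverse x) * exp (- inverse x) * inverse x ^ n =
         flat_fun (n + 2) x - real n * flat_fun (Suc n) x"
        using 1 unfolding Suc flat_fun_def by (simp add: algebra_simps)
      ultimately show ?thesis by simp
    qed (use 1 in \<open>auto intro!: derivative_eq_intros simp: flat_fun_def power2_eq_square\<close>)
    then show ?thesis
      by (rule has_field_derivative_transform_within_open[of _ _ _ "{0<..}"]) (use 1 in \<open>auto simp: flat_fun_def\<close>)
  next
    case 2
    have "((\<lambda>x. 0) has_real_derivative flat_fun (n + 2) x - real n * flat_fun (Suc n) x) (at x)"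
      using 2 by (simp add: flat_fun_def)
    then show ?thesis
      by (rule has_field_derivative_transform_within_open[of _ _ _ "{..<0}"]) (use 2 in \<open>auto simp: flat_fun_def\<close>)
  next
    case 3
    \<comment> \<open>Away from \<open>h = 0\<close> the difference quotient of
      \<open>flat_fun n\<close> at the origin is exactly \<open>flat_fun (Suc n)\<close>.\<close>
    have "((\<lambda>h. (flat_fun n (0 + h) - flat_fun n 0) / h) \<longlongrightarrow> 0) (at 0)"
      by (rule Lim_transform_eventually[OF flat_fun_tendsto_0[of "Suc n"]])
        (auto simp: flat_fun_def eventually_at_filter field_simps)
    then show ?thesis unfolding 3 DERIV_def by (simp add: flat_fun_def)
  qed
qed

lemma smooth_on_flat_fun: "smooth_on UNIV (flat_fun n)"
proof -
  have "Ck_on k UNIV (flat_fun n)" for k n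
  proof (induction k arbitrary: n)
    case 0
    then show ?case using DERIV_continuous_on[OF has_field_derivative_at_within[OF flat_fun_has_derivative]]
      by auto
  next
    case (Suc k)
    show ?case
    proof (rule Ck_on_SucI[OF open_UNIV])
      show "(flat_fun n has_derivative (*) (flat_fun (n + 2) x + - (real n * flat_fun (Suc n) x))) (at x)" for x
        using flat_fun_has_derivative[of n x] unfolding has_field_derivative_def by simp
      show "Ck_on k UNIV (\<lambda>x. (flat_fun (n + 2) x + - (real n * flat_fun (Suc n) x)) * d)" for d
        by (intro Ck_on_bilinear[OF bounded_bilinear_mult] Ck_on_add Ck_on_const open_UNIV Suc
            Ck_on_bounded_linear[OF bounded_linear_minus[OF bounded_linear_ident]])
    qed
  qed
  then show ?thesis by (simp add: smooth_on_def)
qed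

text \<open>The usual quotient \<open>p / (p + q)\<close>: \<open>p\<close> vanishes at distance at
  least \<open>2 * r\<close>, \<open>q\<close> within distance \<open>r\<close>, and the two never
  vanish together. Squared distances keep the arguments smooth at the centre.\<close>

lemma smooth_bump_exists:
  fixes a :: "'e::euclidean_space"
  assumes "r > 0"
  obtains \<phi> :: "'e \<Rightarrow> real" where "smooth_on UNIV \<phi>" "\<And>x. x \<in> ball a r \<Longrightarrow> \<phi> x = 1"
    "\<And>x. x \<notin> cball a (2 * r) \<Longrightarrow> \<phi> x = 0"
proof -
  define n :: "'e \<Rightarrow> real" where "n = (\<lambda>x. (x - a) \<bullet> (x - a))"
  define p :: "'e \<Rightarrow> real" where "p = (\<lambda>x. flat_fun 0 (4 * r\<^sup>2 - n x))"
  define q :: "'e \<Rightarrow> real" where "q = (\<lambda>x. flat_fun 0 (n x - r\<^sup>2))"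
  have sn: "smooth_on UNIV n" unfolding n_def
    by (intro smooth_on_inner smooth_on_diff smooth_on_ident smooth_on_const open_UNIV)
  have sp: "smooth_on UNIV p" and sq: "smooth_on UNIV q" unfolding p_def q_def
    by (intro smooth_on_compose[OF open_UNIV open_UNIV _ _ smooth_on_flat_fun]
        smooth_on_diff smooth_on_const sn open_UNIV subset_UNIV)+
  have pos: "p x + q x \<noteq> 0" for x
  proof (cases "n x < 4 * r\<^sup>2")
    case True
    then have "p x > 0" "q x \<ge> 0" by (simp_all add: p_def q_def flat_fun_def)
    then show ?thesis by simp
  next
    case False
    moreover have "r\<^sup>2 > 0" using assms by simp
    ultimately have "n x > r\<^sup>2" by linarith
    then have "q x > 0" "p x \<ge> 0" by (simp_all add: p_def q_def flat_fun_def)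
    then show ?thesis by simp
  qed
  have nn: "n x = (dist a x)\<^sup>2" for x
    by (simp add: n_def dot_square_norm dist_norm norm_minus_commute)
  show thesis
  proof (rule that[of "\<lambda>x. p x * inverse (p x + q x)"])
    show "smooth_on UNIV (\<lambda>x. p x * inverse (p x + q x))"
    proof (rule smooth_on_mult[OF open_UNIV sp])
      show "smooth_on UNIV (\<lambda>x. inverse (p x + q x))"
        by (rule smooth_on_compose[of _ "-{0}" "\<lambda>x. p x + q x"])
          (use pos smooth_on_add[OF open_UNIV sp sq] in \<open>auto simp: smooth_on_def Ck_on_inverse\<close>)
    qed
    show "p x * inverse (p x + q x) = 1" if "x \<in> ball a r" for x
    proof -
      have "(dist a x)\<^sup>2 \<le> r\<^sup>2" using that by (intro power_mono) auto
      then have "q x = 0" by (simp add: q_def flat_fun_def nn)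
      then show ?thesis using pos[of x] by simp
    qed
    show "p x * inverse (p x + q x) = 0" if "x \<notin> cball a (2 * r)" for x
    proof -
      have "(2 * r)\<^sup>2 \<le> (dist a x)\<^sup>2" using that assms by (intro power_mono) auto
      then have "p x = 0" by (simp add: p_def flat_fun_def nn power_mult_distrib)
      then show ?thesis by simp
    qed
  qed
qed

subsection \<open>Charts and tangent coordinates\<close>

lemma linear_blinfun_apply_comp: "linear f \<Longrightarrow> linear (\<lambda>x. blinfun_apply \<beta> (f x))"
  using linear_compose[OF _ bounded_linear.linear[OF blinfun.bounded_linear_right], of f \<beta>]
  by (simp add: o_def)

locale smooth_atlas =
  fixes \<A> :: "('m::{t2_space, second_countable_topology}, 'e::euclidean_space) chart set"
  assumes smooth_manifold: "smooth_manifold \<A>"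
begin

lemma chart_homeomorphism: "c \<in> \<A> \<Longrightarrow> homeomorphism (fst c) (snd c ` fst c) (snd c) (chart_inv c)"
  and chart_open_dom: "c \<in> \<A> \<Longrightarrow> open (fst c)"
  and chart_open_range: "c \<in> \<A> \<Longrightarrow> open (snd c ` fst c)"
  and smooth_on_transition:
    "c \<in> \<A> \<Longrightarrow> c' \<in> \<A> \<Longrightarrow> smooth_on (snd c ` (fst c \<inter> fst c')) (snd c' \<circ> chart_inv c)"
  using smooth_manifold unfolding smooth_manifold_def by blast+

lemma chart_inv_chart [simp]: "c \<in> \<A> \<Longrightarrow> q \<in> fst c \<Longrightarrow> chart_inv c (snd c q) = q"
  using chart_homeomorphism unfolding homeomorphism_def by blast

lemma chart_chart_inv: "c \<in> \<A> \<Longrightarrow> x \<in> snd c ` fst c \<Longrightarrow> snd c (chart_inv c x) = x"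
  by auto

lemma chart_at: "chart_at \<A> p \<in> \<A>" "p \<in> fst (chart_at \<A> p)"
proof -
  have "\<exists>c. c \<in> \<A> \<and> p \<in> fst c"
    using smooth_manifold unfolding smooth_manifold_def by blast
  from someI_ex[OF this] show "chart_at \<A> p \<in> \<A>" "p \<in> fst (chart_at \<A> p)"
    unfolding chart_at_def by auto
qed

lemma chart_image_open:
  assumes "c \<in> \<A>" "open \<Omega>"
  shows "open (snd c ` (fst c \<inter> \<Omega>))"
proof -
  have "openin (top_of_set (snd c ` fst c)) (snd c ` (fst c \<inter> \<Omega>))"
    using homeomorphism_imp_open_map[OF chart_homeomorphism[OF assms(1)]] assms(2) by (simp add: openin_open_Int)
  then show ?thesis using chart_open_range[OF assms(1)] openin_open_trans by blast
qed

lemma chart_preimage_open: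
  assumes "c \<in> \<A>" "open W"
  shows "open {q \<in> fst c. snd c q \<in> W}"
proof -
  have "continuous_on (fst c) (snd c)"
    using chart_homeomorphism[OF assms(1)] by (simp add: homeomorphism_def)
  from continuous_open_preimage[OF this chart_open_dom[OF assms(1)] assms(2)]
  show ?thesis by (simp add: vimage_def Int_def)
qed

text \<open>Both \<open>tcoord\<close> and \<open>tvec\<close> are instances, with the preferred
  chart on one side, so the single cocycle identity \<open>jac_jac\<close> yields all their
  conversion rules.\<close>

definition jac :: "('m, 'e) chart \<Rightarrow> ('m, 'e) chart \<Rightarrow> 'm \<Rightarrow> 'e \<Rightarrow> 'e" where
  "jac c c' q = frechet_derivative (snd c' \<circ> chart_inv c) (at (snd c q))"

lemma tcoord_jac: "tcoord \<A> c p = jac (chart_at \<A> p) c p"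
  and tvec_jac: "tvec \<A> c p = jac c (chart_at \<A> p) p"
  by (auto simp: tcoord_def tvec_def jac_def)

lemma transition_differentiable:
  assumes "c \<in> \<A>" "c' \<in> \<A>" "q \<in> fst c" "q \<in> fst c'"
  shows "(snd c' \<circ> chart_inv c) differentiable (at (snd c q))"
  by (rule smooth_on_differentiable[OF smooth_on_transition[OF assms(1,2)]]) (use assms in auto)

lemma linear_jac: "c \<in> \<A> \<Longrightarrow> c' \<in> \<A> \<Longrightarrow> q \<in> fst c \<Longrightarrow> q \<in> fst c' \<Longrightarrow> linear (jac c c' q)"
  unfolding jac_def by (rule linear_frechet_derivative[OF transition_differentiable])

lemma jac_self: "c \<in> \<A> \<Longrightarrow> q \<in> fst c \<Longrightarrow> jac c c q u = u"
proof -
  assume c: "c \<in> \<A>" "q \<in> fst c"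
  have "frechet_derivative (\<lambda>x. x) (at (snd c q)) = frechet_derivative (snd c \<circ> chart_inv c) (at (snd c q))"
    by (rule frechet_derivative_transform_within_open[OF _ chart_open_range[OF c(1)]]) (use c in auto)
  from fun_cong[OF this, of u] show ?thesis unfolding jac_def by simp
qed

text \<open>The chain rule for transition maps. The composite of two of them equals the third only
  on the overlap of the domains, hence the comparison of derivatives on an open set.\<close>

lemma jac_jac:
  assumes "c \<in> \<A>" "c' \<in> \<A>" "c'' \<in> \<A>" "q \<in> fst c" "q \<in> fst c'" "q \<in> fst c''"
  shows "jac c' c'' q (jac c c' q u) = jac c c'' q u"
proof -
  let ?f = "snd c' \<circ> chart_inv c" and ?g = "snd c'' \<circ> chart_inv c'"
  have f: "?f (snd c q) = snd c' q" using assms by simp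
  have d: "?f differentiable (at (snd c q))" "?g differentiable (at (?f (snd c q)))"
    unfolding f by (rule transition_differentiable[OF assms(1,2,4,5)] transition_differentiable[OF assms(2,3,5,6)])+
  have "frechet_derivative (?g \<circ> ?f) (at (snd c q)) = frechet_derivative (snd c'' \<circ> chart_inv c) (at (snd c q))"
    by (rule frechet_derivative_transform_within_open[OF differentiable_chain_at[OF d]
        chart_image_open[OF assms(1) chart_open_dom[OF assms(2)]]]) (use assms in auto)
  from fun_cong[OF this, of u] show ?thesis
    unfolding frechet_derivative_compose[OF d] f jac_def by (simp only: o_apply)
qed

lemma linear_tcoord: "c \<in> \<A> \<Longrightarrow> p \<in> fst c \<Longrightarrow> linear (tcoord \<A> c p)"
  and linear_tvec: "c \<in> \<A> \<Longrightarrow> p \<in> fst c \<Longrightarrow> linear (tvec \<A> c p)"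
  unfolding tcoord_jac tvec_jac by (auto intro: linear_jac chart_at)

lemma tcoord_tvec [simp]: "c \<in> \<A> \<Longrightarrow> p \<in> fst c \<Longrightarrow> tcoord \<A> c p (tvec \<A> c p e) = e"
  and tvec_tcoord [simp]: "c \<in> \<A> \<Longrightarrow> p \<in> fst c \<Longrightarrow> tvec \<A> c p (tcoord \<A> c p e) = e"
  unfolding tcoord_jac tvec_jac by (simp_all add: jac_jac jac_self chart_at)

lemma tcoord_change:
  "c \<in> \<A> \<Longrightarrow> c' \<in> \<A> \<Longrightarrow> p \<in> fst c \<Longrightarrow> p \<in> fst c' \<Longrightarrow> jac c c' p (tcoord \<A> c p u) = tcoord \<A> c' p u"
  and tvec_change:
  "c \<in> \<A> \<Longrightarrow> c' \<in> \<A> \<Longrightarrow> p \<in> fst c \<Longrightarrow> p \<in> fst c' \<Longrightarrow> tvec \<A> c' p (jac c c' p e) = tvec \<A> c p e"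
  and tcoord_tvec_jac:
  "c \<in> \<A> \<Longrightarrow> c' \<in> \<A> \<Longrightarrow> p \<in> fst c \<Longrightarrow> p \<in> fst c' \<Longrightarrow> tcoord \<A> c' p (tvec \<A> c p e) = jac c c' p e"
  unfolding tcoord_jac tvec_jac by (auto simp: jac_jac chart_at)

lemma tcoord_chart_at [simp]: "tcoord \<A> (chart_at \<A> p) p u = u"
  unfolding tcoord_jac by (simp add: jac_self chart_at)

lemma tvec_chart_at [simp]: "tvec \<A> (chart_at \<A> p) p u = u"
  unfolding tvec_jac by (simp add: jac_self chart_at)

lemma field_rep_chart [simp]: "c \<in> \<A> \<Longrightarrow> q \<in> fst c \<Longrightarrow> field_rep \<A> c X (snd c q) = tcoord \<A> c q (X q)"
  by (simp add: field_rep_def)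

lemma smooth_on_jac:
  assumes "c \<in> \<A>" "c' \<in> \<A>"
  shows "smooth_on (snd c' ` (fst c' \<inter> fst c)) (\<lambda>x. jac c c' (chart_inv c' x) e)"
proof -
  have "smooth_on (snd c' ` (fst c' \<inter> fst c))
    (\<lambda>x. frechet_derivative (snd c' \<circ> chart_inv c) (at ((snd c \<circ> chart_inv c') x)) e)"
    by (rule smooth_on_frechet_derivative_apply[OF _ _ smooth_on_transition[OF assms] _ smooth_on_transition[OF assms(2,1)] smooth_on_const])
      (use assms in \<open>auto intro!: chart_image_open chart_open_dom\<close>)
  then show ?thesis by (simp add: jac_def)
qed

lemma smooth_on_jac_apply:
  fixes g h :: "'z::real_normed_vector \<Rightarrow> 'e"
  assumes "c \<in> \<A>" "c' \<in> \<A>" and "open S" and "g ` S \<subseteq> snd c' ` (fst c' \<inter> fst c)"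
    and "smooth_on S g" "smooth_on S h"
  shows "smooth_on S (\<lambda>z. jac c' c (chart_inv c' (g z)) (h z))"
proof (rule smooth_on_cong[OF assms(3)])
  show "smooth_on S (\<lambda>x. frechet_derivative (snd c \<circ> chart_inv c') (at (g x)) (h x))"
    by (rule smooth_on_frechet_derivative_apply[OF assms(3) _ smooth_on_transition[OF assms(2,1)] assms(4-6)])
      (use assms in \<open>auto intro!: chart_image_open chart_open_dom\<close>)
  show "frechet_derivative (snd c \<circ> chart_inv c') (at (g x)) (h x) = jac c' c (chart_inv c' (g x)) (h x)"
    if "x \<in> S" for x
  proof -
    have "g x \<in> snd c' ` fst c'" using assms(4) that by auto
    then show ?thesis using chart_chart_inv[OF assms(2)] by (simp add: jac_def)
  qed
qed

subsection \<open>Smooth functions, fields and forms\<close>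

lemma chart_rep_local:
  assumes "c \<in> \<A>"
    and "\<And>q. q \<in> \<Omega> \<Longrightarrow> \<exists>U. open U \<and> q \<in> U \<and> smooth_on (snd c ` (fst c \<inter> U)) f"
  shows "smooth_on (snd c ` (fst c \<inter> \<Omega>)) f"
proof (rule smooth_on_open_local)
  fix x assume "x \<in> snd c ` (fst c \<inter> \<Omega>)"
  then obtain q where q: "q \<in> fst c" "q \<in> \<Omega>" "x = snd c q" by auto
  from assms(2)[OF q(2)] obtain U where "open U" "q \<in> U" "smooth_on (snd c ` (fst c \<inter> U)) f" by auto
  then show "\<exists>T. open T \<and> x \<in> T \<and> smooth_on T f"
    using chart_image_open[OF assms(1)] q by blast
qed

lemma smooth_fun_local:
  "(\<And>q. q \<in> \<Omega> \<Longrightarrow> \<exists>U. open U \<and> q \<in> U \<and> smooth_fun \<A> U f) \<Longrightarrow> smooth_fun \<A> \<Omega> f"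
  unfolding smooth_fun_def by (intro ballI chart_rep_local) blast+

lemma vector_field_local:
  "(\<And>q. q \<in> \<Omega> \<Longrightarrow> \<exists>U. open U \<and> q \<in> U \<and> vector_field \<A> U X) \<Longrightarrow> vector_field \<A> \<Omega> X"
  unfolding vector_field_def by (intro ballI chart_rep_local) blast+

lemma one_form_local:
  "(\<And>q. q \<in> \<Omega> \<Longrightarrow> \<exists>U. open U \<and> q \<in> U \<and> one_form \<A> U \<theta>) \<Longrightarrow> one_form \<A> \<Omega> \<theta>"
  unfolding one_form_def by (intro ballI allI chart_rep_local) blast+

lemma smooth_fun_subset: "smooth_fun \<A> \<Omega> f \<Longrightarrow> U \<subseteq> \<Omega> \<Longrightarrow> smooth_fun \<A> U f"
  unfolding smooth_fun_def by (blast intro: smooth_on_subset)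

lemma vector_field_subset: "vector_field \<A> \<Omega> X \<Longrightarrow> U \<subseteq> \<Omega> \<Longrightarrow> vector_field \<A> U X"
  unfolding vector_field_def by (blast intro: smooth_on_subset)

lemma chart_rep_cong:
  assumes "c \<in> \<A>" "open \<Omega>" "\<And>q. q \<in> fst c \<Longrightarrow> q \<in> \<Omega> \<Longrightarrow> f (snd c q) = g (snd c q)"
    and "smooth_on (snd c ` (fst c \<inter> \<Omega>)) f"
  shows "smooth_on (snd c ` (fst c \<inter> \<Omega>)) g"
  by (rule smooth_on_cong[OF chart_image_open[OF assms(1,2)] _ assms(4)]) (use assms(3) in auto)

lemma smooth_fun_cong:
  assumes "open \<Omega>" "\<And>q. q \<in> \<Omega> \<Longrightarrow> f q = g q" "smooth_fun \<A> \<Omega> f"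
  shows "smooth_fun \<A> \<Omega> g"
  unfolding smooth_fun_def
proof
  fix c assume c: "c \<in> \<A>"
  show "smooth_on (snd c ` (fst c \<inter> \<Omega>)) (g \<circ> chart_inv c)"
    by (rule chart_rep_cong[OF c assms(1), of "f \<circ> chart_inv c"])
      (use assms c in \<open>auto simp: smooth_fun_def\<close>)
qed

lemma vector_field_cong:
  assumes "open \<Omega>" "\<And>q. q \<in> \<Omega> \<Longrightarrow> X q = Y q" "vector_field \<A> \<Omega> X"
  shows "vector_field \<A> \<Omega> Y"
  unfolding vector_field_def
proof
  fix c assume c: "c \<in> \<A>"
  show "smooth_on (snd c ` (fst c \<inter> \<Omega>)) (field_rep \<A> c Y)"
    by (rule chart_rep_cong[OF c assms(1), of "field_rep \<A> c X"])
      (use assms c in \<open>auto simp: vector_field_def\<close>)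
qed

lemma one_form_cong:
  assumes "open \<Omega>" "\<And>q. q \<in> \<Omega> \<Longrightarrow> \<theta> q = \<eta> q" "one_form \<A> \<Omega> \<theta>"
  shows "one_form \<A> \<Omega> \<eta>"
  unfolding one_form_def
proof (intro ballI allI)
  fix c e assume c: "c \<in> \<A>"
  show "smooth_on (snd c ` (fst c \<inter> \<Omega>)) (\<lambda>x. blinfun_apply (\<eta> (chart_inv c x)) (tvec \<A> c (chart_inv c x) e))"
    by (rule chart_rep_cong[OF c assms(1), of "\<lambda>x. blinfun_apply (\<theta> (chart_inv c x)) (tvec \<A> c (chart_inv c x) e)"])
      (use assms c in \<open>auto simp: one_form_def\<close>)
qed

lemma smooth_fun_const: "smooth_fun \<A> \<Omega> (\<lambda>q. a)"
  unfolding smooth_fun_def by (simp add: o_def smooth_on_const)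

lemma smooth_fun_diff:
  "open \<Omega> \<Longrightarrow> smooth_fun \<A> \<Omega> f \<Longrightarrow> smooth_fun \<A> \<Omega> g \<Longrightarrow> smooth_fun \<A> \<Omega> (\<lambda>q. f q - g q)"
  unfolding smooth_fun_def by (auto simp: o_def intro!: smooth_on_diff chart_image_open)

lemma smooth_fun_mult:
  "open \<Omega> \<Longrightarrow> smooth_fun \<A> \<Omega> f \<Longrightarrow> smooth_fun \<A> \<Omega> g \<Longrightarrow> smooth_fun \<A> \<Omega> (\<lambda>q. f q * g q)"
  unfolding smooth_fun_def by (auto simp: o_def intro!: smooth_on_mult chart_image_open)

lemma field_rep_zero: "c \<in> \<A> \<Longrightarrow> x \<in> snd c ` fst c \<Longrightarrow> field_rep \<A> c (\<lambda>q. 0) x = 0"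
  by (auto simp: field_rep_def linear_0[OF linear_tcoord])

lemma vector_field_add:
  assumes "open \<Omega>" "vector_field \<A> \<Omega> X" "vector_field \<A> \<Omega> Y"
  shows "vector_field \<A> \<Omega> (\<lambda>q. X q + Y q)"
  unfolding vector_field_def
proof
  fix c assume c: "c \<in> \<A>"
  show "smooth_on (snd c ` (fst c \<inter> \<Omega>)) (field_rep \<A> c (\<lambda>q. X q + Y q))"
    by (rule smooth_on_cong[OF chart_image_open[OF c assms(1)], of "\<lambda>x. field_rep \<A> c X x + field_rep \<A> c Y x"])
      (use assms c in \<open>auto simp: vector_field_def linear_add[OF linear_tcoord] intro!: smooth_on_add chart_image_open\<close>)
qed

lemma vector_field_scaleR:
  assumes "open \<Omega>" "smooth_fun \<A> \<Omega> f" "vector_field \<A> \<Omega> X"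
  shows "vector_field \<A> \<Omega> (\<lambda>q. f q *\<^sub>R X q)"
  unfolding vector_field_def
proof
  fix c assume c: "c \<in> \<A>"
  show "smooth_on (snd c ` (fst c \<inter> \<Omega>)) (field_rep \<A> c (\<lambda>q. f q *\<^sub>R X q))"
    by (rule smooth_on_cong[OF chart_image_open[OF c assms(1)], of "\<lambda>x. f (chart_inv c x) *\<^sub>R field_rep \<A> c X x"])
      (use assms c in \<open>auto simp: vector_field_def smooth_fun_def o_def linear_scale[OF linear_tcoord]
        intro!: smooth_on_scaleR chart_image_open\<close>)
qed

lemma vector_field_zero: "open \<Omega> \<Longrightarrow> vector_field \<A> \<Omega> (\<lambda>q. 0)"
  unfolding vector_field_def
proof
  fix c assume "open \<Omega>" and c: "c \<in> \<A>"
  then show "smooth_on (snd c ` (fst c \<inter> \<Omega>)) (field_rep \<A> c (\<lambda>q. 0))"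
    by (rule_tac chart_rep_cong[OF c _ _ smooth_on_const[of _ 0]]) (use c in \<open>auto simp: field_rep_zero\<close>)
qed

lemma vector_field_sum:
  assumes "open \<Omega>" "\<And>i. i \<in> I \<Longrightarrow> vector_field \<A> \<Omega> (X i)"
  shows "vector_field \<A> \<Omega> (\<lambda>q. \<Sum>i\<in>I. X i q)"
  using assms(2)
  by (induction I rule: infinite_finite_induct) (auto intro!: vector_field_zero vector_field_add assms(1))

lemma one_form_scaleR:
  "open \<Omega> \<Longrightarrow> smooth_fun \<A> \<Omega> f \<Longrightarrow> one_form \<A> \<Omega> \<theta> \<Longrightarrow> one_form \<A> \<Omega> (\<lambda>q. f q *\<^sub>R \<theta> q)"
  unfolding one_form_def smooth_fun_def
  by (auto simp: o_def scaleR_blinfun.rep_eq intro!: smooth_on_mult chart_image_open)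

lemma one_form_zero: "one_form \<A> \<Omega> (\<lambda>q. 0)"
  unfolding one_form_def by (simp add: zero_blinfun.rep_eq smooth_on_const)

lemma vector_field_tvec:
  assumes "c \<in> \<A>"
  shows "vector_field \<A> (fst c) (\<lambda>q. tvec \<A> c q e)"
  unfolding vector_field_def
proof
  fix c' assume c': "c' \<in> \<A>"
  show "smooth_on (snd c' ` (fst c' \<inter> fst c)) (field_rep \<A> c' (\<lambda>q. tvec \<A> c q e))"
    by (rule smooth_on_cong[OF _ _ smooth_on_jac[OF assms c', of e]])
      (use assms c' in \<open>auto simp: tcoord_tvec_jac intro!: chart_image_open chart_open_dom\<close>)
qed

text \<open>The one-form with constant coefficients \<open>\<beta>\<close> in the chart
  \<open>c\<close>. The conversion \<open>Blinfun\<close> is meaningful over \<open>fst c\<close>,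
  where \<open>tcoord\<close> is known to be linear.\<close>

definition chart_form :: "('m, 'e) chart \<Rightarrow> ('e \<Rightarrow>\<^sub>L real) \<Rightarrow> 'm \<Rightarrow> 'e \<Rightarrow>\<^sub>L real" where
  "chart_form c \<beta> q = Blinfun (\<lambda>u. blinfun_apply \<beta> (tcoord \<A> c q u))"

lemma chart_form_apply:
  "c \<in> \<A> \<Longrightarrow> q \<in> fst c \<Longrightarrow> blinfun_apply (chart_form c \<beta> q) u = blinfun_apply \<beta> (tcoord \<A> c q u)"
  unfolding chart_form_def
  by (rule fun_cong[OF bounded_linear_Blinfun_apply])
    (intro linear_conv_bounded_linear[THEN iffD1] linear_blinfun_apply_comp linear_tcoord)

lemma one_form_chart_form:
  assumes "c \<in> \<A>"
  shows "one_form \<A> (fst c) (chart_form c \<beta>)"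
  unfolding one_form_def
proof (intro ballI allI)
  fix c' e assume c': "c' \<in> \<A>"
  let ?S = "snd c' ` (fst c' \<inter> fst c)"
  have o: "open ?S" using assms c' by (intro chart_image_open chart_open_dom)
  have s: "smooth_on ?S (\<lambda>x. blinfun_apply \<beta> (jac c' c (chart_inv c' x) e))"
    by (rule smooth_on_bounded_linear[OF blinfun.bounded_linear_right o
        smooth_on_jac_apply[OF assms c' o _ smooth_on_ident smooth_on_const]]) auto
  show "smooth_on ?S (\<lambda>x. blinfun_apply (chart_form c \<beta> (chart_inv c' x)) (tvec \<A> c' (chart_inv c' x) e))"
    by (rule smooth_on_cong[OF o _ s]) (use assms c' in \<open>auto simp: chart_form_apply tcoord_tvec_jac\<close>)
qed

lemma smooth_fun_chart_fun:
  assumes "c \<in> \<A>" "open W" "smooth_on W g"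
  shows "smooth_fun \<A> {q \<in> fst c. snd c q \<in> W} (\<lambda>q. g (snd c q))"
  unfolding smooth_fun_def
proof
  fix c' assume c': "c' \<in> \<A>"
  let ?\<Omega> = "{q \<in> fst c. snd c q \<in> W}"
  have "smooth_on (snd c' ` (fst c' \<inter> ?\<Omega>)) (\<lambda>x. g ((snd c \<circ> chart_inv c') x))"
  proof (rule smooth_on_compose[OF chart_image_open[OF c' chart_preimage_open[OF assms(1,2)]] assms(2) _ _ assms(3)])
    show "smooth_on (snd c' ` (fst c' \<inter> ?\<Omega>)) (snd c \<circ> chart_inv c')"
      by (rule smooth_on_subset[OF smooth_on_transition[OF c' assms(1)]]) auto
  qed (use c' in auto)
  then show "smooth_on (snd c' ` (fst c' \<inter> ?\<Omega>)) ((\<lambda>q. g (snd c q)) \<circ> chart_inv c')"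
    by (simp add: o_def)
qed

lemma smooth_fun_tcoord:
  assumes c: "c \<in> \<A>" and \<Omega>: "open \<Omega>" "vector_field \<A> \<Omega> X"
  shows "smooth_fun \<A> (fst c \<inter> \<Omega>) (\<lambda>q. tcoord \<A> c q (X q) \<bullet> b)"
  unfolding smooth_fun_def
proof
  fix c' assume c': "c' \<in> \<A>"
  let ?S = "snd c' ` (fst c' \<inter> (fst c \<inter> \<Omega>))"
  have o: "open ?S" using assms c' by (intro chart_image_open open_Int chart_open_dom)
  have X: "smooth_on ?S (field_rep \<A> c' X)"
    using \<Omega>(2) c' by (auto simp: vector_field_def intro: smooth_on_subset)
  have "smooth_on ?S (\<lambda>x. jac c' c (chart_inv c' x) (field_rep \<A> c' X x))"
    by (rule smooth_on_jac_apply[OF c c' o _ smooth_on_ident X]) auto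
  then have s: "smooth_on ?S (\<lambda>x. jac c' c (chart_inv c' x) (field_rep \<A> c' X x) \<bullet> b)"
    by (rule smooth_on_bounded_linear[OF bounded_linear_inner_left o])
  show "smooth_on ?S ((\<lambda>q. tcoord \<A> c q (X q) \<bullet> b) \<circ> chart_inv c')"
    by (rule smooth_on_cong[OF o _ s]) (use c c' in \<open>auto simp: tcoord_change\<close>)
qed

text \<open>Smoothness in one chart is enough: expanding in the coordinate frame of \<open>c\<close>
  writes the field as a combination of fields already known to be smooth in every chart.\<close>

lemma vector_field_from_chart:
  assumes c: "c \<in> \<A>" and W: "open W" "smooth_on W g"
    and X: "\<And>q. q \<in> fst c \<Longrightarrow> snd c q \<in> W \<Longrightarrow> tcoord \<A> c q (X q) = g (snd c q)"
  shows "vector_field \<A> {q \<in> fst c. snd c q \<in> W} X"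
proof (rule vector_field_cong[OF chart_preimage_open[OF c W(1)]])
  let ?\<Omega> = "{q \<in> fst c. snd c q \<in> W}"
  show "vector_field \<A> ?\<Omega> (\<lambda>q. \<Sum>b\<in>Basis. (g (snd c q) \<bullet> b) *\<^sub>R tvec \<A> c q b)"
    by (intro vector_field_sum vector_field_scaleR chart_preimage_open[OF c W(1)]
        smooth_fun_chart_fun[OF c W(1), of "\<lambda>x. g x \<bullet> _"] vector_field_subset[OF vector_field_tvec[OF c]]
        smooth_on_bounded_linear[OF bounded_linear_inner_left] W) auto
  show "(\<Sum>b\<in>Basis. (g (snd c q) \<bullet> b) *\<^sub>R tvec \<A> c q b) = X q" if "q \<in> ?\<Omega>" for q
    using that X[of q] linear_expand_Basis[OF linear_tvec[OF c], of q "g (snd c q)"] tvec_tcoord[OF c, of q "X q"] by simp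
qed

subsection \<open>Cutting off\<close>

text \<open>The closed set \<open>K\<close> inside \<open>\<Omega>\<close> is what makes extension
  by zero smooth: an open \<open>\<Omega>\<close> and the complement of \<open>K\<close> form an
  open cover of the manifold. On \<open>U\<close> multiplication by \<open>\<psi>\<close> changes
  nothing.\<close>

definition cutoff :: "'m set \<Rightarrow> 'm set \<Rightarrow> ('m \<Rightarrow> real) \<Rightarrow> bool" where
  "cutoff U \<Omega> \<psi> \<longleftrightarrow> open U \<and> smooth_fun \<A> UNIV \<psi> \<and> (\<forall>q\<in>U. \<psi> q = 1) \<and>
     (\<exists>K. closed K \<and> K \<subseteq> \<Omega> \<and> (\<forall>q. q \<notin> K \<longrightarrow> \<psi> q = 0))"

lemma cutoff_exists:
  assumes "open \<Omega>" "p \<in> \<Omega>"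
  obtains U \<psi> where "cutoff U \<Omega> \<psi>" "p \<in> U"
proof -
  let ?c = "chart_at \<A> p"
  let ?x = "snd ?c p"
  have c: "?c \<in> \<A>" "p \<in> fst ?c" by (rule chart_at)+
  have "open (snd ?c ` (fst ?c \<inter> \<Omega>))" by (rule chart_image_open[OF c(1) assms(1)])
  moreover have "?x \<in> snd ?c ` (fst ?c \<inter> \<Omega>)" using c assms by blast
  ultimately obtain e where e: "e > 0" "cball ?x e \<subseteq> snd ?c ` (fst ?c \<inter> \<Omega>)"
    using open_contains_cball by blast
  \<comment> \<open>With inner radius \<open>e / 2\<close> the bump vanishes off the closed ball of
    radius \<open>e\<close>, which lies in the chart image of \<open>\<Omega>\<close>.\<close>
  obtain \<phi> where \<phi>: "smooth_on UNIV \<phi>" "\<And>x. x \<in> ball ?x (e / 2) \<Longrightarrow> \<phi> x = 1"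
    "\<And>x. x \<notin> cball ?x (2 * (e / 2)) \<Longrightarrow> \<phi> x = (0::real)"
    using smooth_bump_exists[of "e / 2" ?x] e(1) by auto
  define K where "K = chart_inv ?c ` cball ?x e"
  define U where "U = {q \<in> fst ?c. snd ?c q \<in> ball ?x (e / 2)}"
  define \<psi> where "\<psi> = (\<lambda>q. if q \<in> fst ?c then \<phi> (snd ?c q) else 0)"
  have "continuous_on (cball ?x e) (chart_inv ?c)"
    by (rule continuous_on_subset[of "snd ?c ` fst ?c"])
      (use chart_homeomorphism[OF c(1)] e(2) in \<open>auto simp: homeomorphism_def\<close>)
  \<comment> \<open>A compact set is closed because the manifold is Hausdorff; this makes the
    complement of \<open>K\<close> an open set on which \<open>\<psi>\<close> is zero.\<close>
  then have K: "closed K" unfolding K_def by (intro compact_imp_closed compact_continuous_image compact_cball)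
  have K\<Omega>: "K \<subseteq> \<Omega>" using e(2) c by (force simp: K_def)
  have off: "\<psi> q = 0" if "q \<notin> K" for q
  proof (cases "q \<in> fst ?c")
    case True
    then have "snd ?c q \<notin> cball ?x e" using that c(1) unfolding K_def by (metis chart_inv_chart imageI)
    then show ?thesis using \<phi>(3) by (simp add: \<psi>_def)
  qed (simp add: \<psi>_def)
  have "smooth_fun \<A> UNIV \<psi>"
  proof (rule smooth_fun_local)
    fix q :: 'm
    show "\<exists>U. open U \<and> q \<in> U \<and> smooth_fun \<A> U \<psi>"
    proof (cases "q \<in> K")
      case True
      have "K \<subseteq> fst ?c" using e(2) c by (force simp: K_def)
      moreover have "smooth_fun \<A> (fst ?c) \<psi>"
        by (rule smooth_fun_cong[OF chart_open_dom[OF c(1)] _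
          smooth_fun_chart_fun[OF c(1) open_UNIV \<phi>(1), simplified]]) (simp add: \<psi>_def)
      ultimately show ?thesis using True chart_open_dom[OF c(1)] by blast
    next
      case False
      have "smooth_fun \<A> (- K) \<psi>"
        by (rule smooth_fun_cong[OF _ _ smooth_fun_const[of _ 0]]) (use K off in auto)
      then show ?thesis using False K by (intro exI[of _ "- K"]) auto
    qed
  qed
  moreover have "open U" unfolding U_def by (rule chart_preimage_open[OF c(1) open_ball])
  moreover have "\<forall>q\<in>U. \<psi> q = 1" using \<phi>(2) by (auto simp: U_def \<psi>_def)
  ultimately have "cutoff U \<Omega> \<psi>" unfolding cutoff_def using K K\<Omega> off by blast
  moreover have "p \<in> U" using c e by (simp add: U_def)
  ultimately show thesis by (rule that)
qed

text \<open>Two cases cover every point: inside \<open>\<Omega>\<close> the property holds by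
  assumption, outside it the complement of \<open>K\<close> is a neighbourhood on which
  \<open>\<psi>\<close> vanishes. \<open>P\<close> is left abstract so that functions, fields, forms
  and anisotropic functions share the argument.\<close>

lemma cutoff_local:
  assumes "cutoff U \<Omega> \<psi>" "open \<Omega>" and "P \<Omega>" and "\<And>V. open V \<Longrightarrow> (\<And>q. q \<in> V \<Longrightarrow> \<psi> q = 0) \<Longrightarrow> P V"
  shows "\<exists>V. open V \<and> q \<in> V \<and> P V"
proof -
  obtain K where K: "closed K" "K \<subseteq> \<Omega>" "\<And>q. q \<notin> K \<Longrightarrow> \<psi> q = 0"
    using assms(1) unfolding cutoff_def by blast
  show ?thesis
  proof (cases "q \<in> \<Omega>")
    case False
    then show ?thesis using K assms(4)[of "- K"] by (intro exI[of _ "- K"]) auto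
  qed (use assms in blast)
qed

lemma cutoffD: "cutoff U \<Omega> \<psi> \<Longrightarrow> smooth_fun \<A> UNIV \<psi>" "cutoff U \<Omega> \<psi> \<Longrightarrow> q \<in> U \<Longrightarrow> \<psi> q = 1"
  "cutoff U \<Omega> \<psi> \<Longrightarrow> open U" "cutoff U \<Omega> \<psi> \<Longrightarrow> q \<notin> \<Omega> \<Longrightarrow> \<psi> q = 0"
  unfolding cutoff_def by auto

lemma cutoff_subset: "cutoff U \<Omega> \<psi> \<Longrightarrow> U \<subseteq> \<Omega>"
  using cutoffD(2,4) by force

lemma cutoff_smooth_fun:
  assumes "cutoff U \<Omega> \<psi>" "open \<Omega>" "smooth_fun \<A> \<Omega> f"
  shows "smooth_fun \<A> UNIV (\<lambda>q. \<psi> q * f q)"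
proof (rule smooth_fun_local, rule cutoff_local[OF assms(1,2)])
  show "smooth_fun \<A> \<Omega> (\<lambda>q. \<psi> q * f q)"
    by (rule smooth_fun_mult[OF assms(2) smooth_fun_subset[OF cutoffD(1)[OF assms(1)]] assms(3)]) simp
  show "smooth_fun \<A> V (\<lambda>q. \<psi> q * f q)" if "open V" "\<And>q. q \<in> V \<Longrightarrow> \<psi> q = 0" for V
    by (rule smooth_fun_cong[OF that(1) _ smooth_fun_const[of _ 0]]) (use that in auto)
qed

lemma cutoff_vector_field:
  assumes "cutoff U \<Omega> \<psi>" "open \<Omega>" "vector_field \<A> \<Omega> X"
  shows "vector_field \<A> UNIV (\<lambda>q. \<psi> q *\<^sub>R X q)"
proof (rule vector_field_local, rule cutoff_local[OF assms(1,2)])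
  show "vector_field \<A> \<Omega> (\<lambda>q. \<psi> q *\<^sub>R X q)"
    by (rule vector_field_scaleR[OF assms(2) smooth_fun_subset[OF cutoffD(1)[OF assms(1)]] assms(3)]) simp
  show "vector_field \<A> V (\<lambda>q. \<psi> q *\<^sub>R X q)" if "open V" "\<And>q. q \<in> V \<Longrightarrow> \<psi> q = 0" for V
    by (rule vector_field_cong[OF that(1) _ vector_field_zero]) (use that in auto)
qed

lemma cutoff_one_form:
  assumes "cutoff U \<Omega> \<psi>" "open \<Omega>" "one_form \<A> \<Omega> \<theta>"
  shows "one_form \<A> UNIV (\<lambda>q. \<psi> q *\<^sub>R \<theta> q)"
proof (rule one_form_local, rule cutoff_local[OF assms(1,2)])
  show "one_form \<A> \<Omega> (\<lambda>q. \<psi> q *\<^sub>R \<theta> q)"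
    by (rule one_form_scaleR[OF assms(2) smooth_fun_subset[OF cutoffD(1)[OF assms(1)]] assms(3)]) simp
  show "one_form \<A> V (\<lambda>q. \<psi> q *\<^sub>R \<theta> q)" if "open V" "\<And>q. q \<in> V \<Longrightarrow> \<psi> q = 0" for V
    by (rule one_form_cong[OF that(1) _ one_form_zero]) (use that in auto)
qed

text \<open>A coordinate frame field multiplied by a cutoff is a witness, so the \<open>SOME\<close>
  in the definition does pick a global field with the given value.\<close>

lemma ext_vec: "vector_field \<A> UNIV (ext_vec \<A> p u)" "ext_vec \<A> p u p = u"
proof -
  let ?c = "chart_at \<A> p"
  have c: "?c \<in> \<A>" "p \<in> fst ?c" by (rule chart_at)+
  obtain U \<psi> where \<psi>: "cutoff U (fst ?c) \<psi>" "p \<in> U" using cutoff_exists[OF chart_open_dom[OF c(1)] c(2)] .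
  have "\<exists>X. vector_field \<A> UNIV X \<and> X p = u"
    by (rule exI[of _ "\<lambda>q. \<psi> q *\<^sub>R tvec \<A> ?c q (tcoord \<A> ?c p u)"])
      (use cutoff_vector_field[OF \<psi>(1) chart_open_dom[OF c(1)] vector_field_tvec[OF c(1)]] c \<psi> in
        \<open>auto simp: cutoffD(2)[OF \<psi>]\<close>)
  from someI_ex[OF this] show "vector_field \<A> UNIV (ext_vec \<A> p u)" "ext_vec \<A> p u p = u"
    unfolding ext_vec_def by auto
qed

lemma ext_covec: "one_form \<A> UNIV (ext_covec \<A> p \<alpha>)" "ext_covec \<A> p \<alpha> p = \<alpha>"
proof -
  let ?c = "chart_at \<A> p"
  have c: "?c \<in> \<A>" "p \<in> fst ?c" by (rule chart_at)+
  obtain U \<psi> where \<psi>: "cutoff U (fst ?c) \<psi>" "p \<in> U" using cutoff_exists[OF chart_open_dom[OF c(1)] c(2)] .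
  have "chart_form ?c \<alpha> p = \<alpha>"
    by (rule blinfun_eqI) (simp add: chart_form_apply c)
  then have "\<exists>\<theta>. one_form \<A> UNIV \<theta> \<and> \<theta> p = \<alpha>"
    by (intro exI[of _ "\<lambda>q. \<psi> q *\<^sub>R chart_form ?c \<alpha> q"])
      (use cutoff_one_form[OF \<psi>(1) chart_open_dom[OF c(1)] one_form_chart_form[OF c(1)]] c \<psi> in
        \<open>auto simp: cutoffD(2)[OF \<psi>]\<close>)
  from someI_ex[OF this] show "one_form \<A> UNIV (ext_covec \<A> p \<alpha>)" "ext_covec \<A> p \<alpha> p = \<alpha>"
    unfolding ext_covec_def by auto
qed

lemma ext_germ:
  assumes "open \<Omega>" "p \<in> \<Omega>" "vector_field \<A> \<Omega> Y"
  shows "vector_field \<A> UNIV (ext_germ \<A> p Y)"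
    and "\<exists>U. open U \<and> p \<in> U \<and> U \<subseteq> \<Omega> \<and> (\<forall>q\<in>U. ext_germ \<A> p Y q = Y q)"
proof -
  obtain U \<psi> where \<psi>: "cutoff U \<Omega> \<psi>" "p \<in> U" using cutoff_exists[OF assms(1,2)] .
  have "\<exists>Y'. vector_field \<A> UNIV Y' \<and> (\<exists>U. open U \<and> p \<in> U \<and> (\<forall>q\<in>U. Y' q = Y q))"
    by (rule exI[of _ "\<lambda>q. \<psi> q *\<^sub>R Y q"])
      (use cutoff_vector_field[OF \<psi>(1) assms(1,3)] cutoffD[OF \<psi>(1)] \<psi>(2) in auto)
  from someI_ex[OF this]
  have *: "vector_field \<A> UNIV (ext_germ \<A> p Y) \<and> (\<exists>U. open U \<and> p \<in> U \<and> (\<forall>q\<in>U. ext_germ \<A> p Y q = Y q))"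
    unfolding ext_germ_def .
  then show "vector_field \<A> UNIV (ext_germ \<A> p Y)" by simp
  from * obtain U where "open U" "p \<in> U" "\<forall>q\<in>U. ext_germ \<A> p Y q = Y q" by auto
  then show "\<exists>U. open U \<and> p \<in> U \<and> U \<subseteq> \<Omega> \<and> (\<forall>q\<in>U. ext_germ \<A> p Y q = Y q)"
    using assms by (intro exI[of _ "U \<inter> \<Omega>"]) auto
qed


subsection \<open>Directional derivatives and Lie brackets\<close>

lemma smooth_fun_rep:
  "smooth_fun \<A> \<Omega> f \<Longrightarrow> c \<in> \<A> \<Longrightarrow> smooth_on (snd c ` (fst c \<inter> \<Omega>)) (f \<circ> chart_inv c)"
  unfolding smooth_fun_def by blast

lemma vector_field_rep:
  "vector_field \<A> \<Omega> X \<Longrightarrow> c \<in> \<A> \<Longrightarrow> smooth_on (snd c ` (fst c \<inter> \<Omega>)) (field_rep \<A> c X)"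
  unfolding vector_field_def by blast

lemma vector_field_rep_has_derivative:
  "vector_field \<A> \<Omega> X \<Longrightarrow> c \<in> \<A> \<Longrightarrow> q \<in> fst c \<Longrightarrow> q \<in> \<Omega> \<Longrightarrow>
   (field_rep \<A> c X has_derivative frechet_derivative (field_rep \<A> c X) (at (snd c q))) (at (snd c q))"
  using smooth_on_has_derivative[OF vector_field_rep] by blast

lemma dir_deriv_chart:
  assumes c: "c \<in> \<A>" "p \<in> fst c" and f: "open \<Omega>" "p \<in> \<Omega>" "smooth_fun \<A> \<Omega> f"
  shows "dir_deriv \<A> p u f = frechet_derivative (f \<circ> chart_inv c) (at (snd c p)) (tcoord \<A> c p u)"
proof -
  let ?c = "chart_at \<A> p"
  have c0: "?c \<in> \<A>" "p \<in> fst ?c" by (rule chart_at)+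
  let ?t = "snd c \<circ> chart_inv ?c" and ?f = "f \<circ> chart_inv c"
  have t: "?t (snd ?c p) = snd c p" using c0 by simp
  have d: "?t differentiable (at (snd ?c p))" "?f differentiable (at (?t (snd ?c p)))"
    unfolding t
    by (rule transition_differentiable[OF c0(1) c(1) c0(2) c(2)])
      (rule smooth_on_differentiable[OF smooth_fun_rep[OF f(3) c(1)]], use c f in auto)
  have "frechet_derivative (?f \<circ> ?t) (at (snd ?c p)) = frechet_derivative (f \<circ> chart_inv ?c) (at (snd ?c p))"
    by (rule frechet_derivative_transform_within_open[OF differentiable_chain_at[OF d]
        chart_image_open[OF c0(1) chart_open_dom[OF c(1)]]]) (use c c0 in auto)
  from fun_cong[OF this, of u] show ?thesis
    unfolding frechet_derivative_compose[OF d] t tcoord_jac jac_def dir_deriv_def by (simp only: o_apply)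
qed

lemma dir_deriv_cong:
  assumes "open \<Omega>" "p \<in> \<Omega>" "smooth_fun \<A> \<Omega> f" "\<And>q. q \<in> \<Omega> \<Longrightarrow> f q = g q"
  shows "dir_deriv \<A> p u f = dir_deriv \<A> p u g"
proof -
  let ?c = "chart_at \<A> p"
  have c: "?c \<in> \<A>" "p \<in> fst ?c" by (rule chart_at)+
  have "frechet_derivative (f \<circ> chart_inv ?c) (at (snd ?c p)) = frechet_derivative (g \<circ> chart_inv ?c) (at (snd ?c p))"
    by (rule frechet_derivative_transform_within_open[OF _ chart_image_open[OF c(1) assms(1)]])
      (use assms c smooth_on_differentiable[OF smooth_fun_rep[OF assms(3) c(1)]] in auto)
  then show ?thesis by (simp add: dir_deriv_def)
qed

text \<open>The components in the two charts are related by the Jacobian of the transition, which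
  itself varies; differentiating this relation gives the inhomogeneous term with the second
  derivative of the transition map.\<close>

lemma field_rep_change_derivative:
  assumes c: "c \<in> \<A>" "c' \<in> \<A>" "q \<in> fst c" "q \<in> fst c'" and X: "open \<Omega>" "q \<in> \<Omega>" "vector_field \<A> \<Omega> X"
  shows "frechet_derivative (field_rep \<A> c' X) (at (snd c' q)) (jac c c' q w) =
    frechet_derivative (\<lambda>y. frechet_derivative (snd c' \<circ> chart_inv c) (at y) (field_rep \<A> c X (snd c q))) (at (snd c q)) w +
    jac c c' q (frechet_derivative (field_rep \<A> c X) (at (snd c q)) w)"
proof -
  let ?t = "snd c' \<circ> chart_inv c"
  let ?x = "snd c q"
  let ?S = "snd c ` (fst c \<inter> (fst c' \<inter> \<Omega>))"
  have S: "open ?S" "?x \<in> ?S"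
    using c X by (auto intro!: chart_image_open chart_open_dom)
  have t: "?t ?x = snd c' q" using c by simp
  have st: "smooth_on ?S ?t" by (rule smooth_on_subset[OF smooth_on_transition[OF c(1,2)]]) auto
  have d1: "((\<lambda>y. field_rep \<A> c' X (?t y)) has_derivative
     (\<lambda>w. frechet_derivative (field_rep \<A> c' X) (at (snd c' q)) (frechet_derivative ?t (at ?x) w))) (at ?x)"
    by (rule has_derivative_compose[OF smooth_on_has_derivative[OF st S(2)]])
      (use vector_field_rep_has_derivative[OF X(3) c(2,4) X(2)] t in simp)
  have "((\<lambda>y. frechet_derivative ?t (at y) (field_rep \<A> c X y)) has_derivative
     (\<lambda>w. frechet_derivative (\<lambda>y. frechet_derivative ?t (at y) (field_rep \<A> c X ?x)) (at ?x) w +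
       frechet_derivative ?t (at ?x) (frechet_derivative (field_rep \<A> c X) (at ?x) w))) (at ?x)"
  proof (rule has_derivative_linear_apply[OF S _ _ vector_field_rep_has_derivative[OF X(3) c(1,3) X(2)]])
    show "linear (frechet_derivative ?t (at y))" if "y \<in> ?S" for y
      by (rule linear_frechet_derivative[OF smooth_on_differentiable[OF st that]])
    show "(\<lambda>y. frechet_derivative ?t (at y) b) differentiable (at ?x)" for b
      by (rule smooth_on_differentiable[OF smooth_on_frechet_derivative[OF st] S(2)])
  qed
  then have d2: "((\<lambda>y. field_rep \<A> c' X (?t y)) has_derivative
     (\<lambda>w. frechet_derivative (\<lambda>y. frechet_derivative ?t (at y) (field_rep \<A> c X ?x)) (at ?x) w +
       frechet_derivative ?t (at ?x) (frechet_derivative (field_rep \<A> c X) (at ?x) w))) (at ?x)"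
  proof (rule has_derivative_transform_within_open[OF _ S])
    fix y assume "y \<in> ?S"
    then obtain r where r: "r \<in> fst c" "r \<in> fst c'" "y = snd c r" by auto
    show "frechet_derivative ?t (at y) (field_rep \<A> c X y) = field_rep \<A> c' X (?t y)"
      using tcoord_change[OF c(1,2) r(1,2), of "X r"] r c by (simp add: jac_def)
  qed
  show ?thesis using fun_cong[OF has_derivative_unique[OF d1 d2], of w] by (simp add: jac_def)
qed

text \<open>\<open>lie_bracket\<close> is computed in the preferred chart, which varies with the
  point, so its smoothness becomes visible only in a fixed chart. In the change of chart the
  second-derivative terms cancel by symmetry.\<close>

lemma lie_bracket_chart:
  assumes c: "c \<in> \<A>" "q \<in> fst c" and \<Omega>: "open \<Omega>" "q \<in> \<Omega>" and X: "vector_field \<A> \<Omega> X" and Y: "vector_field \<A> \<Omega> Y"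
  shows "tcoord \<A> c q (lie_bracket \<A> X Y q) =
    frechet_derivative (field_rep \<A> c Y) (at (snd c q)) (tcoord \<A> c q (X q)) -
    frechet_derivative (field_rep \<A> c X) (at (snd c q)) (tcoord \<A> c q (Y q))"
proof -
  let ?c = "chart_at \<A> q"
  have c0: "?c \<in> \<A>" "q \<in> fst ?c" by (rule chart_at)+
  let ?t = "snd c \<circ> chart_inv ?c"
  have sym: "frechet_derivative (\<lambda>y. frechet_derivative ?t (at y) a) (at (snd ?c q)) b =
     frechet_derivative (\<lambda>y. frechet_derivative ?t (at y) b) (at (snd ?c q)) a" for a b
    by (rule smooth_on_second_derivative_commute[OF chart_image_open[OF c0(1) chart_open_dom[OF c(1)]] _
        smooth_on_transition[OF c0(1) c(1)]]) (use c c0 in auto)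
  have lin: "linear (jac ?c c q)" by (rule linear_jac[OF c0(1) c(1) c0(2) c(2)])
  show ?thesis
    using field_rep_change_derivative[OF c0(1) c(1) c0(2) c(2) \<Omega> X, of "Y q"]
      field_rep_change_derivative[OF c0(1) c(1) c0(2) c(2) \<Omega> Y, of "X q"]
      sym[of "X q" "Y q"] c0
    by (simp add: lie_bracket_def Let_def tcoord_jac[symmetric] linear_diff[OF lin[unfolded tcoord_jac[symmetric]]])
qed

lemma vector_field_lie_bracket:
  assumes \<Omega>: "open \<Omega>" and X: "vector_field \<A> \<Omega> X" and Y: "vector_field \<A> \<Omega> Y"
  shows "vector_field \<A> \<Omega> (lie_bracket \<A> X Y)"
  unfolding vector_field_def
proof
  fix c assume c: "c \<in> \<A>"
  let ?S = "snd c ` (fst c \<inter> \<Omega>)"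
  have o: "open ?S" by (rule chart_image_open[OF c \<Omega>])
  have "smooth_on ?S (\<lambda>x. frechet_derivative (field_rep \<A> c Y) (at x) (field_rep \<A> c X x) -
    frechet_derivative (field_rep \<A> c X) (at x) (field_rep \<A> c Y x))"
    by (intro smooth_on_diff smooth_on_frechet_derivative_apply[OF o o _ _ smooth_on_ident]
        vector_field_rep X Y c o) auto
  then show "smooth_on ?S (field_rep \<A> c (lie_bracket \<A> X Y))"
    by (rule chart_rep_cong[OF c \<Omega>, rotated]) (use c \<Omega> X Y in \<open>auto simp: lie_bracket_chart\<close>)
qed

section \<open>Coordinates on the tangent bundle\<close>

lemma tm_param_coord [simp]:
  "c \<in> \<A> \<Longrightarrow> q \<in> fst c \<Longrightarrow> tm_param \<A> c (snd c q, tcoord \<A> c q e) = (q, e)"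
  by (simp add: tm_param_def)

lemma mem_tm_dom_coord [simp]:
  "c \<in> \<A> \<Longrightarrow> q \<in> fst c \<Longrightarrow> (snd c q, tcoord \<A> c q e) \<in> tm_dom \<A> c A \<longleftrightarrow> (q, e) \<in> A"
  by (simp add: tm_dom_def)

lemma tm_domE:
  assumes "c \<in> \<A>" "z \<in> tm_dom \<A> c A"
  obtains q e where "q \<in> fst c" "(q, e) \<in> A" "z = (snd c q, tcoord \<A> c q e)"
proof -
  obtain q where q: "q \<in> fst c" "fst z = snd c q" using assms by (auto simp: tm_dom_def)
  show thesis
    by (rule that[of q "tvec \<A> c q (snd z)"]) (use assms q in \<open>auto simp: tm_dom_def tm_param_def prod_eq_iff\<close>)
qed

end

subsection \<open>Anisotropic fields along admissible fields\<close>

locale aniso_space = smooth_atlas \<A> for \<A> :: "('m::{t2_space, second_countable_topology}, 'e::euclidean_space) chart set" +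
  fixes A :: "('m \<times> 'e) set"
  assumes tm_open: "tm_open \<A> A"
begin

lemma open_tm_dom: "c \<in> \<A> \<Longrightarrow> open (tm_dom \<A> c A)"
  using tm_open unfolding tm_open_def by blast

text \<open>The domain of the bundle chart is restricted to the part over \<open>U\<close>, since
  Christoffel symbols will be valid only over a region where a cutoff is 1.\<close>

definition tm_over :: "('m, 'e) chart \<Rightarrow> 'm set \<Rightarrow> ('e \<times> 'e) set" where
  "tm_over c U = {z \<in> tm_dom \<A> c A. fst z \<in> snd c ` (fst c \<inter> U)}"

lemma open_tm_over: 
  assumes "c \<in> \<A>" "open U" 
  shows "open (tm_over c U)"
proof -
  have "tm_over c U = tm_dom \<A> c A \<inter> (snd c ` (fst c \<inter> U)) \<times> UNIV"
    by (auto simp: tm_over_def)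
  then show ?thesis using assms by (auto intro!: open_Times chart_image_open open_tm_dom)
qed

lemma mem_tm_over_coord [simp]:
  "c \<in> \<A> \<Longrightarrow> q \<in> fst c \<Longrightarrow> (snd c q, tcoord \<A> c q e) \<in> tm_over c U \<longleftrightarrow> (q, e) \<in> A \<and> q \<in> U"
  by (auto simp: tm_over_def) (metis chart_inv_chart)

lemma tm_overE:
  assumes "c \<in> \<A>" "z \<in> tm_over c U"
  obtains q e where "q \<in> fst c" "q \<in> U" "(q, e) \<in> A" "z = (snd c q, tcoord \<A> c q e)"
  using assms tm_domE[OF assms(1), of z A] unfolding tm_over_def
  by (smt (verit) mem_Collect_eq mem_tm_over_coord tm_over_def)

definition aniso_rep :: "('m, 'e) chart \<Rightarrow> ('m \<times> 'e \<Rightarrow> 'e) \<Rightarrow> 'e \<times> 'e \<Rightarrow> 'e" where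
  "aniso_rep c X z = tcoord \<A> c (fst (tm_param \<A> c z)) (X (tm_param \<A> c z))"

lemma aniso_rep_coord [simp]:
  "c \<in> \<A> \<Longrightarrow> q \<in> fst c \<Longrightarrow> aniso_rep c X (snd c q, tcoord \<A> c q e) = tcoord \<A> c q (X (q, e))"
  by (simp add: aniso_rep_def)

lemma aniso_field_iff: "aniso_field \<A> A X \<longleftrightarrow> (\<forall>c\<in>\<A>. smooth_on (tm_dom \<A> c A) (aniso_rep c X))"
  unfolding aniso_field_def aniso_rep_def by simp

lemma admissible_rep:
  assumes "admissible \<A> A \<Omega> V" "c \<in> \<A>"
  shows "smooth_on (snd c ` (fst c \<inter> \<Omega>)) (\<lambda>x. (x, field_rep \<A> c V x))"
    and "x \<in> snd c ` (fst c \<inter> \<Omega>) \<Longrightarrow> (x, field_rep \<A> c V x) \<in> tm_dom \<A> c A"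
    and "x \<in> snd c ` (fst c \<inter> (U \<inter> \<Omega>)) \<Longrightarrow> (x, field_rep \<A> c V x) \<in> tm_over c U"
  using assms unfolding admissible_def
  by (auto intro!: smooth_on_Pair smooth_on_ident vector_field_rep chart_image_open simp: mem_tm_over_coord)

lemma vector_field_along:
  assumes F: "aniso_field \<A> A F" and V: "admissible \<A> A \<Omega> V"
  shows "vector_field \<A> \<Omega> (\<lambda>q. F (q, V q))"
  unfolding vector_field_def
proof
  fix c assume c: "c \<in> \<A>"
  have \<Omega>: "open \<Omega>" using V by (simp add: admissible_def)
  have "smooth_on (snd c ` (fst c \<inter> \<Omega>)) (\<lambda>x. aniso_rep c F (x, field_rep \<A> c V x))"
    by (rule smooth_on_compose[OF chart_image_open[OF c \<Omega>] open_tm_dom[OF c] _ admissible_rep(1)[OF V c]])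
      (use F c admissible_rep(2)[OF V c] in \<open>auto simp: aniso_field_iff\<close>)
  then show "smooth_on (snd c ` (fst c \<inter> \<Omega>)) (field_rep \<A> c (\<lambda>q. F (q, V q)))"
    by (rule chart_rep_cong[OF c \<Omega>, rotated]) (use c in auto)
qed

lemma smooth_fun_along:
  assumes h: "aniso_fun \<A> A h" and V: "admissible \<A> A \<Omega> V"
  shows "smooth_fun \<A> \<Omega> (\<lambda>q. h (q, V q))"
  unfolding smooth_fun_def
proof
  fix c assume c: "c \<in> \<A>"
  have \<Omega>: "open \<Omega>" using V by (simp add: admissible_def)
  have "smooth_on (snd c ` (fst c \<inter> \<Omega>)) (\<lambda>x. (h \<circ> tm_param \<A> c) (x, field_rep \<A> c V x))"
    by (rule smooth_on_compose[OF chart_image_open[OF c \<Omega>] open_tm_dom[OF c] _ admissible_rep(1)[OF V c]])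
      (use h c admissible_rep(2)[OF V c] in \<open>auto simp: aniso_fun_def o_def\<close>)
  then show "smooth_on (snd c ` (fst c \<inter> \<Omega>)) ((\<lambda>q. h (q, V q)) \<circ> chart_inv c)"
    by (rule chart_rep_cong[OF c \<Omega>, rotated]) (use c in auto)
qed

text \<open>A field that is affine in the coordinates of \<open>c\<close> realises any prescribed
  value and first derivative at \<open>p\<close>; it is restricted to the open set over which it
  stays in \<open>A\<close>.\<close>

lemma admissible_affine_exists:
  assumes c: "c \<in> \<A>" "p \<in> fst c" and v: "(p, e) \<in> A" and L: "linear L"
  obtains \<Omega> V where "admissible \<A> A \<Omega> V" "p \<in> \<Omega>" "V p = e"
    "(field_rep \<A> c V has_derivative L) (at (snd c p))"
proof -
  let ?x = "snd c p"
  define g where "g = (\<lambda>x. tcoord \<A> c p e + L (x - ?x))"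
  define V where "V = (\<lambda>q. tvec \<A> c q (g (snd c q)))"
  have bl: "bounded_linear L" using L by (simp add: linear_conv_bounded_linear)
  have sg: "smooth_on UNIV g" unfolding g_def
    by (intro smooth_on_add smooth_on_const smooth_on_bounded_linear[OF bl] smooth_on_diff smooth_on_ident open_UNIV)
  have sG: "smooth_on UNIV (\<lambda>x. (x, g x))" by (intro smooth_on_Pair smooth_on_ident sg open_UNIV)
  define W where "W = (\<lambda>x. (x, g x)) -` tm_dom \<A> c A"
  have W: "open W" unfolding W_def
    by (rule open_vimage[OF open_tm_dom[OF c(1)] smooth_on_continuous_on[OF sG]])
  define \<Omega> where "\<Omega> = {q \<in> fst c. snd c q \<in> W}"
  have V: "tcoord \<A> c q (V q) = g (snd c q)" if "q \<in> fst c" for q using that c by (simp add: V_def)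
  have Vp: "V p = e" using c by (simp add: V_def g_def linear_0[OF L])
  have vf: "vector_field \<A> \<Omega> V" unfolding \<Omega>_def
    by (rule vector_field_from_chart[OF c(1) W smooth_on_subset[OF sg] V]) auto
  have "(q, V q) \<in> A" if "q \<in> \<Omega>" for q
  proof -
    have "(snd c q, tcoord \<A> c q (V q)) \<in> tm_dom \<A> c A"
      using that V[of q] by (simp add: \<Omega>_def W_def)
    then show ?thesis using that c by (simp add: \<Omega>_def)
  qed
  moreover have "open \<Omega>" unfolding \<Omega>_def by (rule chart_preimage_open[OF c(1) W])
  ultimately have "admissible \<A> A \<Omega> V" using vf by (simp add: admissible_def)
  moreover have "p \<in> \<Omega>" using c v by (simp add: \<Omega>_def W_def g_def linear_0[OF L])
  moreover note Vp
  moreover have "(field_rep \<A> c V has_derivative L) (at ?x)"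
  proof (rule has_derivative_transform_within_open[OF _ chart_open_range[OF c(1)]])
    show "(g has_derivative L) (at ?x)" unfolding g_def
      by (rule has_derivative_eq_rhs, (rule derivative_intros bounded_linear.has_derivative[OF bl])+) auto
  qed (use c V in auto)
  ultimately show thesis by (rule that)
qed

lemma local_ext:
  assumes "(p, e) \<in> A"
  obtains \<Omega> where "admissible \<A> A \<Omega> (local_ext \<A> A (p, e))" "p \<in> \<Omega>" "local_ext \<A> A (p, e) p = e"
proof -
  have "linear (\<lambda>x::'e. 0::'e)" by (simp add: linear_iff)
  then obtain \<Omega> V where "admissible \<A> A \<Omega> V" "p \<in> \<Omega>" "V p = e"
    using admissible_affine_exists[OF chart_at assms] by blast
  then have "\<exists>V \<Omega>. admissible \<A> A \<Omega> V \<and> fst (p, e) \<in> \<Omega> \<and> V (fst (p, e)) = snd (p, e)" by auto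
  from someI_ex[OF this] show thesis using that unfolding local_ext_def by auto
qed

lemma has_vector_derivative_line:
  assumes "(f has_derivative f') (at (x, y))"
  shows "((\<lambda>t. f (x, y + t *\<^sub>R k)) has_vector_derivative f' (0, k)) (at 0)"
  unfolding has_vector_derivative_def
proof (rule has_derivative_eq_rhs)
  show "((\<lambda>t. f (x, y + t *\<^sub>R k)) has_derivative (\<lambda>t. f' (0, t *\<^sub>R k))) (at 0)"
    by (rule has_derivative_compose[of "\<lambda>t. (x, y + t *\<^sub>R k)"]) (use assms in \<open>auto intro!: derivative_eq_intros\<close>)
  show "(\<lambda>t. f' (0, t *\<^sub>R k)) = (\<lambda>t. t *\<^sub>R f' (0, k))"
    using linear_scale[OF has_derivative_linear[OF assms], of _ "(0, k)"] by simp
qed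

text \<open>Fibre coordinates are linear, so the line through \<open>e\<close> in direction
  \<open>w\<close> becomes a vertical line in the chart. Agreement of \<open>F\<close> with
  \<open>f\<close> is asked only on \<open>S\<close>, because the coordinate formula for a
  connection holds only over part of \<open>A\<close>.\<close>

lemma vert_deriv_field_chart:
  assumes c: "c \<in> \<A>" "p \<in> fst c" 
    and f: "(f has_derivative f') (at (snd c p, tcoord \<A> c p e))"
    and S: "open S" "(snd c p, tcoord \<A> c p e) \<in> S"
    and F: "\<And>e'. (snd c p, tcoord \<A> c p e') \<in> S \<Longrightarrow> tcoord \<A> c p (F (p, e')) = f (snd c p, tcoord \<A> c p e')"
  shows "tcoord \<A> c p (vert_deriv F (p, e) w) = f' (0, tcoord \<A> c p w)"
proof -
  let ?x = "snd c p" and ?k = "tcoord \<A> c p"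
  have bl: "bounded_linear (tvec \<A> c p)" using linear_tvec[OF c] by (simp add: linear_conv_bounded_linear)
  let ?l = "\<lambda>t. (?x, ?k e + t *\<^sub>R ?k w)"
  have k: "?k (e + t *\<^sub>R w) = ?k e + t *\<^sub>R ?k w" for t
    by (simp add: linear_add[OF linear_tcoord[OF c]] linear_scale[OF linear_tcoord[OF c]])
  have T: "open (?l -` S)" by (rule open_vimage[OF S(1)]) (auto intro!: continuous_intros)
  have "((\<lambda>t. tvec \<A> c p (f (?l t))) has_vector_derivative tvec \<A> c p (f' (0, ?k w))) (at 0)"
    by (rule bounded_linear.has_vector_derivative[OF bl has_vector_derivative_line[OF f]])
  then have "((\<lambda>t. F (p, e + t *\<^sub>R w)) has_vector_derivative tvec \<A> c p (f' (0, ?k w))) (at 0)"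
  proof (rule has_vector_derivative_transform_within_open[OF _ T])
    show "tvec \<A> c p (f (?l t)) = F (p, e + t *\<^sub>R w)" if "t \<in> ?l -` S" for t
      using F[of "e + t *\<^sub>R w"] that c k tvec_tcoord[OF c, of "F (p, e + t *\<^sub>R w)"] by simp
  qed (use S in auto)
  then show ?thesis using c by (simp add: vert_deriv_def vector_derivative_at)
qed

lemma vert_deriv_fun_chart:
  assumes c: "c \<in> \<A>" "p \<in> fst c" 
    and f: "(h \<circ> tm_param \<A> c has_derivative f') (at (snd c p, tcoord \<A> c p e))"
  shows "vert_deriv h (p, e) w = f' (0, tcoord \<A> c p w)"
proof -
  have "(h \<circ> tm_param \<A> c) (snd c p, tcoord \<A> c p e + t *\<^sub>R tcoord \<A> c p w) = h (p, e + t *\<^sub>R w)" for t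
    using tm_param_coord[OF c, of "e + t *\<^sub>R w"]
    by (simp add: linear_add[OF linear_tcoord[OF c]] linear_scale[OF linear_tcoord[OF c]])
  then show ?thesis
    using has_vector_derivative_line[OF f, of "tcoord \<A> c p w"] by (simp add: vert_deriv_def vector_derivative_at)
qed

end

subsection \<open>Christoffel symbols\<close>

text \<open>The elementary bilinear map with value \<open>g\<close> on the pair of basis directions
  \<open>a\<close>, \<open>b\<close>. Packing it into nested \<open>blinfun\<close> types makes the
  Christoffel symbols one smooth map into a normed space.\<close>

definition bilinear_coeff :: "'e::euclidean_space \<Rightarrow> 'e \<Rightarrow> 'e \<Rightarrow> 'e \<Rightarrow>\<^sub>L 'e \<Rightarrow>\<^sub>L 'e" where
  "bilinear_coeff a b g =
     (blinfun_scaleR_left (blinfun_scaleR_left g o\<^sub>L blinfun_inner_left b)) o\<^sub>L blinfun_inner_left a"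

lemma bilinear_coeff_apply:
  "blinfun_apply (blinfun_apply (bilinear_coeff a b g) u) w = (u \<bullet> a) *\<^sub>R (w \<bullet> b) *\<^sub>R g"
  by (simp add: bilinear_coeff_def scaleR_blinfun.rep_eq)

lemma bounded_linear_bilinear_coeff: "bounded_linear (bilinear_coeff a b)"
  unfolding bilinear_coeff_def
  by (intro bounded_linear_compose[OF bounded_bilinear.bounded_linear_left[OF bounded_bilinear_blinfun_compose]]
      bounded_linear_compose[OF bounded_linear_blinfun_scaleR_left] bounded_linear_blinfun_scaleR_left)

locale aniso_conn = aniso_space \<A> A
  for \<A> :: "('m::{t2_space, second_countable_topology}, 'e::euclidean_space) chart set"
    and A :: "('m \<times> 'e) set" +
  fixes nabla :: "'m \<times> 'e \<Rightarrow> ('m \<Rightarrow> 'e) \<Rightarrow> ('m \<Rightarrow> 'e) \<Rightarrow> 'e"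
  assumes connection: "aniso_connection \<A> A nabla"
begin

lemma aniso_field_nabla:
  "vector_field \<A> UNIV X \<Longrightarrow> vector_field \<A> UNIV Y \<Longrightarrow> aniso_field \<A> A (\<lambda>v. nabla v X Y)"
  using connection unfolding aniso_connection_def by blast

lemma
  assumes "v \<in> A" "vector_field \<A> UNIV X" "vector_field \<A> UNIV Y" "vector_field \<A> UNIV Z"
    "smooth_fun \<A> UNIV f" "smooth_fun \<A> UNIV h"
  shows nabla_add: "nabla v X (\<lambda>q. Y q + Z q) = nabla v X Y + nabla v X Z"
    and nabla_Leibniz: "nabla v X (\<lambda>q. f q *\<^sub>R Y q) =
      dir_deriv \<A> (fst v) (X (fst v)) f *\<^sub>R Y (fst v) + f (fst v) *\<^sub>R nabla v X Y"
    and nabla_linear: "nabla v (\<lambda>q. f q *\<^sub>R X q + h q *\<^sub>R Y q) Z =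
      f (fst v) *\<^sub>R nabla v X Z + h (fst v) *\<^sub>R nabla v Y Z"
  using connection assms unfolding aniso_connection_def by blast+

lemma nabla_zero_right:
  assumes "v \<in> A" "vector_field \<A> UNIV X"
  shows "nabla v X (\<lambda>q. 0) = 0"
  using nabla_add[OF assms vector_field_zero vector_field_zero smooth_fun_const smooth_fun_const] by simp

lemma nabla_zero_left:
  assumes "v \<in> A" "vector_field \<A> UNIV X"
  shows "nabla v (\<lambda>q. 0) X = 0"
  using nabla_linear[OF assms(1) vector_field_zero vector_field_zero assms(2) smooth_fun_const[of _ 0] smooth_fun_const[of _ 0]]
  by simp

lemma nabla_sum_left:
  assumes v: "v \<in> A" and Z: "vector_field \<A> UNIV Z" and "finite I"
    and "\<And>i. i \<in> I \<Longrightarrow> smooth_fun \<A> UNIV (f i)" "\<And>i. i \<in> I \<Longrightarrow> vector_field \<A> UNIV (X i)"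
  shows "nabla v (\<lambda>q. \<Sum>i\<in>I. f i q *\<^sub>R X i q) Z = (\<Sum>i\<in>I. f i (fst v) *\<^sub>R nabla v (X i) Z)"
  using assms(3-5)
proof (induction I)
  case empty
  then show ?case by (simp add: nabla_zero_left v Z)
next
  case (insert i I)
  have "vector_field \<A> UNIV (\<lambda>q. \<Sum>i\<in>I. f i q *\<^sub>R X i q)"
    using insert by (intro vector_field_sum vector_field_scaleR open_UNIV) auto
  from nabla_linear[OF v _ this Z, of "X i" "f i" "\<lambda>q. 1"] show ?case
    using insert by (simp add: smooth_fun_const)
qed

lemma nabla_sum_right:
  assumes v: "v \<in> A" and X: "vector_field \<A> UNIV X" and "finite I"
    and "\<And>i. i \<in> I \<Longrightarrow> smooth_fun \<A> UNIV (f i)" "\<And>i. i \<in> I \<Longrightarrow> vector_field \<A> UNIV (Y i)"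
  shows "nabla v X (\<lambda>q. \<Sum>i\<in>I. f i q *\<^sub>R Y i q) =
    (\<Sum>i\<in>I. dir_deriv \<A> (fst v) (X (fst v)) (f i) *\<^sub>R Y i (fst v) + f i (fst v) *\<^sub>R nabla v X (Y i))"
  using assms(3-5)
proof (induction I)
  case empty
  then show ?case by (simp add: nabla_zero_right v X)
next
  case (insert i I)
  have s: "vector_field \<A> UNIV (\<lambda>q. \<Sum>i\<in>I. f i q *\<^sub>R Y i q)" "vector_field \<A> UNIV (\<lambda>q. f i q *\<^sub>R Y i q)"
    using insert by (auto intro!: vector_field_sum vector_field_scaleR)
  show ?case
    using insert nabla_add[OF v X s(2,1) smooth_fun_const smooth_fun_const]
      nabla_Leibniz[OF v X _ X _ smooth_fun_const, of "Y i" "f i"] by simp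
qed

text \<open>Locality from the Leibniz rule: the difference of the fields vanishes near the base
  point, hence equals itself times \<open>1 - \<psi>\<close>. At the base point both this factor and
  the difference are 0, so both terms of the rule disappear.\<close>

lemma nabla_cong_right:
  assumes v: "v \<in> A" and X: "vector_field \<A> UNIV X" and Y: "vector_field \<A> UNIV Y" "vector_field \<A> UNIV Y'"
    and U: "open U" "fst v \<in> U" "\<And>q. q \<in> U \<Longrightarrow> Y q = Y' q"
  shows "nabla v X Y = nabla v X Y'"
proof -
  obtain W \<psi> where \<psi>: "cutoff W U \<psi>" "fst v \<in> W" using cutoff_exists[OF U(1,2)] .
  define Z where "Z = (\<lambda>q. Y q + (-1) *\<^sub>R Y' q)"
  have Z: "vector_field \<A> UNIV Z" unfolding Z_def
    by (intro vector_field_add vector_field_scaleR smooth_fun_const Y open_UNIV)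
  have "Z q = (1 - \<psi> q) *\<^sub>R Z q" for q
    by (cases "q \<in> U") (simp_all add: Z_def U(3) cutoffD(4)[OF \<psi>(1)])
  then have "Z = (\<lambda>q. (1 - \<psi> q) *\<^sub>R Z q)" by (rule ext)
  moreover have "nabla v X (\<lambda>q. (1 - \<psi> q) *\<^sub>R Z q) =
     dir_deriv \<A> (fst v) (X (fst v)) (\<lambda>q. 1 - \<psi> q) *\<^sub>R Z (fst v) + (1 - \<psi> (fst v)) *\<^sub>R nabla v X Z"
    by (rule nabla_Leibniz[OF v X Z Z _ smooth_fun_const])
      (intro smooth_fun_diff smooth_fun_const cutoffD(1)[OF \<psi>(1)] open_UNIV)
  moreover have "Z (fst v) = 0" using U by (simp add: Z_def)
  ultimately have "nabla v X Z = 0" using cutoffD(2)[OF \<psi>] by simp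
  moreover have "nabla v X (\<lambda>q. Y' q + Z q) = nabla v X Y' + nabla v X Z"
    by (rule nabla_add[OF v X Y(2) Z smooth_fun_const smooth_fun_const])
  ultimately show ?thesis by (simp add: Z_def)
qed

text \<open>A predicate and not a function, since \<open>\<Gamma>\<close> is built from a cut-off
  frame and describes the connection only over \<open>U\<close>. Global fields occur because
  \<open>nabla\<close> is specified on those only.\<close>

definition christoffel :: "('m, 'e) chart \<Rightarrow> 'm set \<Rightarrow> ('e \<times> 'e \<Rightarrow> 'e \<Rightarrow>\<^sub>L 'e \<Rightarrow>\<^sub>L 'e) \<Rightarrow> bool" where
  "christoffel c U \<Gamma> \<longleftrightarrow> c \<in> \<A> \<and> open U \<and> U \<subseteq> fst c \<and> smooth_on (tm_over c U) \<Gamma> \<and>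
     (\<forall>q e X Y. q \<in> U \<and> (q, e) \<in> A \<and> vector_field \<A> UNIV X \<and> vector_field \<A> UNIV Y \<longrightarrow>
        tcoord \<A> c q (nabla (q, e) X Y) =
          frechet_derivative (field_rep \<A> c Y) (at (snd c q)) (tcoord \<A> c q (X q)) +
          \<Gamma> (snd c q, tcoord \<A> c q e) (tcoord \<A> c q (X q)) (tcoord \<A> c q (Y q)))"

text \<open>The coordinate frame is cut off to global fields \<open>E b\<close>; the components of
  \<open>nabla\<close> on pairs of them are the symbols. Over \<open>U\<close>, where the cutoff is
  1, an arbitrary field expands in this frame, and the Leibniz and linearity rules reduce
  \<open>nabla\<close> to those pairs.\<close>

lemma christoffel_exists:
  assumes c: "c \<in> \<A>" "p \<in> fst c"
  obtains U \<Gamma> where "christoffel c U \<Gamma>" "p \<in> U"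
proof -
  obtain U \<psi> where \<psi>: "cutoff U (fst c) \<psi>" and pU: "p \<in> U"
    using cutoff_exists[OF chart_open_dom[OF c(1)] c(2)] .
  have U: "open U" "U \<subseteq> fst c" using cutoffD(3)[OF \<psi>] cutoff_subset[OF \<psi>] by auto
  define E where "E = (\<lambda>b q. \<psi> q *\<^sub>R tvec \<A> c q b)"
  define k where "k = (\<lambda>X b q. \<psi> q * (tcoord \<A> c q (X q) \<bullet> b))"
  have E: "vector_field \<A> UNIV (E b)" for b unfolding E_def
    by (rule cutoff_vector_field[OF \<psi> chart_open_dom[OF c(1)] vector_field_tvec[OF c(1)]])
  have k: "smooth_fun \<A> UNIV (k X b)" if "vector_field \<A> UNIV X" for X b unfolding k_def
    by (rule cutoff_smooth_fun[OF \<psi> chart_open_dom[OF c(1)]])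
      (use smooth_fun_tcoord[OF c(1) open_UNIV that] in simp)
  \<comment> \<open>The square appears because coefficients and frame fields each carry one factor
    \<open>\<psi>\<close>.\<close>
  have expand: "(\<Sum>b\<in>Basis. k X b q *\<^sub>R E b q) = (\<psi> q)\<^sup>2 *\<^sub>R X q" for X q
  proof (cases "q \<in> fst c")
    case True
    have "(\<Sum>b\<in>Basis. k X b q *\<^sub>R E b q) = (\<psi> q)\<^sup>2 *\<^sub>R (\<Sum>b\<in>Basis. (tcoord \<A> c q (X q) \<bullet> b) *\<^sub>R tvec \<A> c q b)"
      by (simp add: k_def E_def scaleR_sum_right power2_eq_square algebra_simps)
    also have "(\<Sum>b\<in>Basis. (tcoord \<A> c q (X q) \<bullet> b) *\<^sub>R tvec \<A> c q b) = X q"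
      using linear_expand_Basis[OF linear_tvec[OF c(1) True], of "tcoord \<A> c q (X q)"] tvec_tcoord[OF c(1) True, of "X q"]
      by simp
    finally show ?thesis .
  next
    case False
    then show ?thesis using cutoffD(4)[OF \<psi>] by (simp add: k_def)
  qed
  have kU: "k X b q = tcoord \<A> c q (X q) \<bullet> b" if "q \<in> U" for X b q
    using cutoffD(2)[OF \<psi> that] by (simp add: k_def)
  define \<Gamma> where "\<Gamma> = (\<lambda>z. \<Sum>a\<in>Basis. \<Sum>b\<in>Basis. bilinear_coeff a b (aniso_rep c (\<lambda>v. nabla v (E a) (E b)) z))"
  have \<Gamma>: "\<Gamma> z u w = (\<Sum>a\<in>Basis. \<Sum>b\<in>Basis. (u \<bullet> a) *\<^sub>R (w \<bullet> b) *\<^sub>R aniso_rep c (\<lambda>v. nabla v (E a) (E b)) z)" for z u w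
    by (simp add: \<Gamma>_def blinfun.sum_left bilinear_coeff_apply)
  have "smooth_on (tm_dom \<A> c A) \<Gamma>" unfolding \<Gamma>_def
    by (intro smooth_on_sum smooth_on_bounded_linear[OF bounded_linear_bilinear_coeff] open_tm_dom c)
      (use aniso_field_nabla[OF E E] c in \<open>auto simp: aniso_field_iff\<close>)
  then have smooth: "smooth_on (tm_over c U) \<Gamma>" by (rule smooth_on_subset) (auto simp: tm_over_def)
  have formula: "tcoord \<A> c q (nabla (q, e) X Y) =
          frechet_derivative (field_rep \<A> c Y) (at (snd c q)) (tcoord \<A> c q (X q)) +
          \<Gamma> (snd c q, tcoord \<A> c q e) (tcoord \<A> c q (X q)) (tcoord \<A> c q (Y q))"
    if q: "q \<in> U" and v: "(q, e) \<in> A" and X: "vector_field \<A> UNIV X" and Y: "vector_field \<A> UNIV Y" for q e X Y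
  proof -
    let ?t = "tcoord \<A> c q"
    have qc: "q \<in> fst c" using q U by auto
    have lin: "linear ?t" by (rule linear_tcoord[OF c(1) qc])
    have E_q: "?t (E b q) = b" for b using cutoffD(2)[OF \<psi> q] c qc by (simp add: E_def)
    have nE: "nabla (q, e) X Z = (\<Sum>a\<in>Basis. (?t (X q) \<bullet> a) *\<^sub>R nabla (q, e) (E a) Z)"
      if Z: "vector_field \<A> UNIV Z" for Z
    proof -
      have g: "smooth_fun \<A> UNIV (\<lambda>q. 1 - \<psi> q * \<psi> q)"
        by (intro smooth_fun_diff smooth_fun_const smooth_fun_mult cutoffD(1)[OF \<psi>] open_UNIV)
      have vs: "vector_field \<A> UNIV (\<lambda>q. \<Sum>b\<in>Basis. k X b q *\<^sub>R E b q)"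
        by (intro vector_field_sum vector_field_scaleR E k X open_UNIV)
      \<comment> \<open>The first coefficient is 0 at the point of evaluation, so
        \<open>nabla\<close> sees only the frame part of its direction argument.\<close>
      have "X = (\<lambda>q. (1 - \<psi> q * \<psi> q) *\<^sub>R X q + 1 *\<^sub>R (\<Sum>b\<in>Basis. k X b q *\<^sub>R E b q))"
        by (simp add: expand fun_eq_iff power2_eq_square algebra_simps)
      then have "nabla (q, e) X Z = (1 - \<psi> q * \<psi> q) *\<^sub>R nabla (q, e) X Z +
          1 *\<^sub>R nabla (q, e) (\<lambda>q. \<Sum>b\<in>Basis. k X b q *\<^sub>R E b q) Z"
        using nabla_linear[OF v X vs Z g smooth_fun_const[of _ 1]] by simp
      then show ?thesis
        using cutoffD(2)[OF \<psi> q] nabla_sum_left[OF v Z finite_Basis, of "k X" E] k[OF X] E kU[OF q] by simp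
    qed
    have d: "dir_deriv \<A> q (X q) (k Y b) = frechet_derivative (field_rep \<A> c Y) (at (snd c q)) (?t (X q)) \<bullet> b" for b
    proof -
      have "((\<lambda>x. field_rep \<A> c Y x \<bullet> b) has_derivative
         (\<lambda>w. frechet_derivative (field_rep \<A> c Y) (at (snd c q)) w \<bullet> b)) (at (snd c q))"
        by (rule bounded_linear.has_derivative[OF bounded_linear_inner_left
              vector_field_rep_has_derivative[OF Y c(1) qc UNIV_I]])
      then have "(k Y b \<circ> chart_inv c has_derivative
         (\<lambda>w. frechet_derivative (field_rep \<A> c Y) (at (snd c q)) w \<bullet> b)) (at (snd c q))"
        by (rule has_derivative_transform_within_open[OF _ chart_image_open[OF c(1) U(1)]])
          (use U q qc c kU in auto)
      from frechet_derivative_at[OF this] show ?thesis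
        unfolding dir_deriv_chart[OF c(1) qc open_UNIV UNIV_I k[OF Y]] by metis
    qed
    have vs: "vector_field \<A> UNIV (\<lambda>q. \<Sum>b\<in>Basis. k Y b q *\<^sub>R E b q)"
      by (intro vector_field_sum vector_field_scaleR E k Y open_UNIV)
    have "nabla (q, e) X Y = nabla (q, e) X (\<lambda>q. \<Sum>b\<in>Basis. k Y b q *\<^sub>R E b q)"
      by (rule nabla_cong_right[OF v X Y vs U(1)]) (use q cutoffD(2)[OF \<psi>] in \<open>auto simp: expand\<close>)
    also have "\<dots> = (\<Sum>b\<in>Basis. dir_deriv \<A> q (X q) (k Y b) *\<^sub>R E b q + k Y b q *\<^sub>R nabla (q, e) X (E b))"
      using nabla_sum_right[OF v X finite_Basis, of "k Y" E] k[OF Y] E by simp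
    finally have "?t (nabla (q, e) X Y) = (\<Sum>b\<in>Basis. (frechet_derivative (field_rep \<A> c Y) (at (snd c q)) (?t (X q)) \<bullet> b) *\<^sub>R b)
       + (\<Sum>b\<in>Basis. (?t (Y q) \<bullet> b) *\<^sub>R (\<Sum>a\<in>Basis. (?t (X q) \<bullet> a) *\<^sub>R ?t (nabla (q, e) (E a) (E b))))"
      by (simp add: linear_sum[OF lin] linear_add[OF lin] linear_scale[OF lin] E_q d kU[OF q] nE[OF E] sum.distrib)
    also have "(\<Sum>b\<in>Basis. (?t (Y q) \<bullet> b) *\<^sub>R (\<Sum>a\<in>Basis. (?t (X q) \<bullet> a) *\<^sub>R ?t (nabla (q, e) (E a) (E b)))) =
       \<Gamma> (snd c q, ?t e) (?t (X q)) (?t (Y q))"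
      unfolding \<Gamma> using c qc
      by (subst sum.swap) (simp add: scaleR_sum_right mult.commute)
    finally show ?thesis by (simp add: euclidean_representation)
  qed
  show thesis by (rule that[OF _ pU]) (use c U smooth formula in \<open>auto simp: christoffel_def\<close>)
qed

lemma christoffelD:
  assumes "christoffel c U \<Gamma>"
  shows "c \<in> \<A>" "open U" "U \<subseteq> fst c" "smooth_on (tm_over c U) \<Gamma>" "open (tm_over c U)"
  using assms open_tm_over unfolding christoffel_def by auto

lemma christoffel_nabla:
  assumes "christoffel c U \<Gamma>" "q \<in> U" "(q, e) \<in> A" "vector_field \<A> UNIV X" "vector_field \<A> UNIV Y"
  shows "tcoord \<A> c q (nabla (q, e) X Y) =
    frechet_derivative (field_rep \<A> c Y) (at (snd c q)) (tcoord \<A> c q (X q)) +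
    \<Gamma> (snd c q, tcoord \<A> c q e) (tcoord \<A> c q (X q)) (tcoord \<A> c q (Y q))"
  using assms unfolding christoffel_def by blast

text \<open>The passage from global to local fields. The germ chosen in \<open>cov\<close> agrees
  with \<open>Y\<close> near \<open>q\<close>, so the formula, which uses only the value and first
  derivative there, does not see the choice.\<close>

lemma cov_chart:
  assumes \<Gamma>: "christoffel c U \<Gamma>" and q: "q \<in> U" and v: "(q, e) \<in> A"
    and Y: "open \<Omega>" "q \<in> \<Omega>" "vector_field \<A> \<Omega> Y"
  shows "tcoord \<A> c q (cov \<A> nabla (q, e) u Y) =
    frechet_derivative (field_rep \<A> c Y) (at (snd c q)) (tcoord \<A> c q u) +
    \<Gamma> (snd c q, tcoord \<A> c q e) (tcoord \<A> c q u) (tcoord \<A> c q (Y q))"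
proof -
  have c: "c \<in> \<A>" "q \<in> fst c" using christoffelD[OF \<Gamma>] q by auto
  obtain W where W: "open W" "q \<in> W" "W \<subseteq> \<Omega>" and eq: "\<forall>r\<in>W. ext_germ \<A> q Y r = Y r"
    using ext_germ(2)[OF Y] by blast
  have "frechet_derivative (field_rep \<A> c Y) (at (snd c q)) =
     frechet_derivative (field_rep \<A> c (ext_germ \<A> q Y)) (at (snd c q))"
    by (rule frechet_derivative_transform_within_open[OF _ chart_image_open[OF c(1) W(1)]])
      (use W eq c Y smooth_on_differentiable[OF vector_field_rep[OF Y(3) c(1)]] in auto)
  then show ?thesis
    unfolding cov_def fst_conv christoffel_nabla[OF \<Gamma> q v ext_vec(1) ext_germ(1)[OF Y]]
    using eq W by (simp add: ext_vec)
qed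

section \<open>Derivatives of anisotropic objects along extensions\<close>

lemma nabla_eq_cov:
  assumes v: "(p, e) \<in> A" and X: "vector_field \<A> UNIV X" and Y: "vector_field \<A> UNIV Y"
  shows "nabla (p, e) X Y = cov \<A> nabla (p, e) (X p) Y"
proof -
  let ?c = "chart_at \<A> p"
  obtain U \<Gamma> where \<Gamma>: "christoffel ?c U \<Gamma>" "p \<in> U" using christoffel_exists[OF chart_at] .
  have "tcoord \<A> ?c p (nabla (p, e) X Y) = tcoord \<A> ?c p (cov \<A> nabla (p, e) (X p) Y)"
    by (simp only: cov_chart[OF \<Gamma> v open_UNIV UNIV_I Y] christoffel_nabla[OF \<Gamma> v X Y])
  then show ?thesis by simp
qed

text \<open>The correction by the vertical derivative cancels the dependence on the first derivative
  of the extension.\<close>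

lemma field_deriv_extension:
  assumes \<Gamma>: "christoffel c U \<Gamma>" "p \<in> U" and v: "(p, e) \<in> A" and F: "aniso_field \<A> A F"
    and V: "admissible \<A> A \<Omega> V" "p \<in> \<Omega>" "V p = e"
  shows "tcoord \<A> c p (cov \<A> nabla (p, e) u (\<lambda>q. F (q, V q)) - vert_deriv F (p, e) (cov \<A> nabla (p, e) u V)) =
    (let x = snd c p; y = tcoord \<A> c p e; w = tcoord \<A> c p u in
      frechet_derivative (aniso_rep c F) (at (x, y)) (w, - \<Gamma> (x, y) w y) + \<Gamma> (x, y) w (aniso_rep c F (x, y)))"
proof -
  have c: "c \<in> \<A>" "p \<in> fst c" using christoffelD[OF \<Gamma>(1)] \<Gamma>(2) by auto
  have \<Omega>: "open \<Omega>" "vector_field \<A> \<Omega> V" using V by (auto simp: admissible_def)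
  let ?x = "snd c p" and ?y = "tcoord \<A> c p e" and ?w = "tcoord \<A> c p u" and ?t = "tcoord \<A> c p"
  let ?F = "aniso_rep c F"
  let ?DF = "frechet_derivative ?F (at (?x, ?y))" and ?DV = "frechet_derivative (field_rep \<A> c V) (at ?x)"
  have F': "smooth_on (tm_dom \<A> c A) ?F" using F c by (simp add: aniso_field_iff)
  have DF: "(?F has_derivative ?DF) (at (?x, ?y))"
    by (rule smooth_on_has_derivative[OF F']) (use c v in simp)
  have lin: "linear ?t" by (rule linear_tcoord[OF c])
  have FV: "vector_field \<A> \<Omega> (\<lambda>q. F (q, V q))" by (rule vector_field_along[OF F V(1)])
  have VD: "((\<lambda>x. (x, field_rep \<A> c V x)) has_derivative (\<lambda>w. (w, ?DV w))) (at ?x)"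
    by (intro has_derivative_Pair has_derivative_ident vector_field_rep_has_derivative[OF \<Omega>(2) c V(2)])
  have "((\<lambda>x. ?F (x, field_rep \<A> c V x)) has_derivative (\<lambda>w. ?DF (w, ?DV w))) (at ?x)"
    by (rule has_derivative_compose[OF VD]) (use DF V c in simp)
  then have "(field_rep \<A> c (\<lambda>q. F (q, V q)) has_derivative (\<lambda>w. ?DF (w, ?DV w))) (at ?x)"
    by (rule has_derivative_transform_within_open[OF _ chart_image_open[OF c(1) \<Omega>(1)]]) (use c V in auto)
  note fr = frechet_derivative_at[OF this, symmetric]
  have 1: "?t (cov \<A> nabla (p, e) u (\<lambda>q. F (q, V q))) = ?DF (?w, ?DV ?w) + \<Gamma> (?x, ?y) ?w (?F (?x, ?y))"
    unfolding cov_chart[OF \<Gamma> v \<Omega>(1) V(2) FV, of u] fr using c V(3) by simp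
  have 2: "?t (cov \<A> nabla (p, e) u V) = ?DV ?w + \<Gamma> (?x, ?y) ?w ?y"
    using cov_chart[OF \<Gamma> v \<Omega>(1) V(2) \<Omega>(2), of u] V(3) by simp
  have "?t (vert_deriv F (p, e) (cov \<A> nabla (p, e) u V)) = ?DF (0, ?DV ?w + \<Gamma> (?x, ?y) ?w ?y)"
    unfolding 2[symmetric]
    by (rule vert_deriv_field_chart[OF c DF open_UNIV UNIV_I]) (use c in simp)
  \<comment> \<open>Subtracting the vertical correction replaces the slope of \<open>V\<close> in
    the pair by \<open>- \<Gamma> w y\<close>: the result is the horizontal lift of the direction,
    from which \<open>V\<close> has disappeared.\<close>
  then have "?t (cov \<A> nabla (p, e) u (\<lambda>q. F (q, V q)) - vert_deriv F (p, e) (cov \<A> nabla (p, e) u V)) =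
     ?DF ((?w, ?DV ?w) - (0, ?DV ?w + \<Gamma> (?x, ?y) ?w ?y)) + \<Gamma> (?x, ?y) ?w (?F (?x, ?y))"
    unfolding linear_diff[OF lin] linear_diff[OF has_derivative_linear[OF DF]] 1 by simp
  then show ?thesis by (simp add: Let_def)
qed

text \<open>The same cancellation as for fields; a real-valued \<open>h\<close> has no Christoffel
  term of its own.\<close>

lemma fun_deriv_extension:
  assumes \<Gamma>: "christoffel c U \<Gamma>" "p \<in> U" and v: "(p, e) \<in> A" and h: "aniso_fun \<A> A h"
    and V: "admissible \<A> A \<Omega> V" "p \<in> \<Omega>" "V p = e"
  shows "dir_deriv \<A> p u (\<lambda>q. h (q, V q)) - vert_deriv h (p, e) (cov \<A> nabla (p, e) u V) =
    (let x = snd c p; y = tcoord \<A> c p e; w = tcoord \<A> c p u in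
      frechet_derivative (h \<circ> tm_param \<A> c) (at (x, y)) (w, - \<Gamma> (x, y) w y))"
proof -
  have c: "c \<in> \<A>" "p \<in> fst c" using christoffelD[OF \<Gamma>(1)] \<Gamma>(2) by auto
  have \<Omega>: "open \<Omega>" "vector_field \<A> \<Omega> V" using V by (auto simp: admissible_def)
  let ?x = "snd c p" and ?y = "tcoord \<A> c p e" and ?w = "tcoord \<A> c p u" and ?t = "tcoord \<A> c p"
  let ?F = "h \<circ> tm_param \<A> c"
  let ?DF = "frechet_derivative ?F (at (?x, ?y))" and ?DV = "frechet_derivative (field_rep \<A> c V) (at ?x)"
  have F': "smooth_on (tm_dom \<A> c A) ?F" using h c unfolding aniso_fun_def by blast
  have DF: "(?F has_derivative ?DF) (at (?x, ?y))"
    by (rule smooth_on_has_derivative[OF F']) (use c v in simp)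
  have VD: "((\<lambda>x. (x, field_rep \<A> c V x)) has_derivative (\<lambda>w. (w, ?DV w))) (at ?x)"
    by (intro has_derivative_Pair has_derivative_ident vector_field_rep_has_derivative[OF \<Omega>(2) c V(2)])
  have "((\<lambda>x. ?F (x, field_rep \<A> c V x)) has_derivative (\<lambda>w. ?DF (w, ?DV w))) (at ?x)"
    by (rule has_derivative_compose[OF VD]) (use DF V c in \<open>simp del: o_apply\<close>)
  then have "((\<lambda>q. h (q, V q)) \<circ> chart_inv c has_derivative (\<lambda>w. ?DF (w, ?DV w))) (at ?x)"
    by (rule has_derivative_transform_within_open[OF _ chart_image_open[OF c(1) \<Omega>(1)]]) (use c V in auto)
  note fr = frechet_derivative_at[OF this, symmetric]
  have 1: "dir_deriv \<A> p u (\<lambda>q. h (q, V q)) = ?DF (?w, ?DV ?w)"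
    unfolding dir_deriv_chart[OF c \<Omega>(1) V(2) smooth_fun_along[OF h V(1)], of u] fr ..
  have 2: "?t (cov \<A> nabla (p, e) u V) = ?DV ?w + \<Gamma> (?x, ?y) ?w ?y"
    using cov_chart[OF \<Gamma> v \<Omega>(1) V(2) \<Omega>(2), of u] V(3) by simp
  have "vert_deriv h (p, e) (cov \<A> nabla (p, e) u V) = ?DF (0, ?DV ?w + \<Gamma> (?x, ?y) ?w ?y)"
    unfolding 2[symmetric] by (rule vert_deriv_fun_chart[OF c DF])
  then have "dir_deriv \<A> p u (\<lambda>q. h (q, V q)) - vert_deriv h (p, e) (cov \<A> nabla (p, e) u V) =
     ?DF ((?w, ?DV ?w) - (0, ?DV ?w + \<Gamma> (?x, ?y) ?w ?y))"
    unfolding linear_diff[OF has_derivative_linear[OF DF]] 1 by simp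
  then show ?thesis by (simp add: Let_def)
qed

lemma vert_deriv_0: "vert_deriv h v 0 = 0"
  by (simp add: vert_deriv_def)

text \<open>The corrected derivative has the same value for the extension chosen in the definition
  and for \<open>V\<close>, and for \<open>V\<close> the correction is a vertical derivative in
  direction 0.\<close>

lemma
  assumes v: "(p, e) \<in> A"
    and V: "admissible \<A> A \<Omega> V" "p \<in> \<Omega>" "V p = e" and flat: "cov \<A> nabla (p, e) u V = 0"
  shows field_deriv_adapted: "aniso_field \<A> A F \<Longrightarrow>
      field_deriv \<A> nabla A F (p, e) u = cov \<A> nabla (p, e) u (\<lambda>q. F (q, V q))"
    and fun_deriv_adapted: "aniso_fun \<A> A h \<Longrightarrow>
      fun_deriv \<A> nabla A h (p, e) u = dir_deriv \<A> p u (\<lambda>q. h (q, V q))"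
proof -
  let ?c = "chart_at \<A> p"
  obtain U \<Gamma> where \<Gamma>: "christoffel ?c U \<Gamma>" "p \<in> U" using christoffel_exists[OF chart_at] .
  obtain \<Omega>' where L: "admissible \<A> A \<Omega>' (local_ext \<A> A (p, e))" "p \<in> \<Omega>'" "local_ext \<A> A (p, e) p = e"
    using local_ext[OF v] .
  show "field_deriv \<A> nabla A F (p, e) u = cov \<A> nabla (p, e) u (\<lambda>q. F (q, V q))" if F: "aniso_field \<A> A F"
    using field_deriv_extension[OF \<Gamma> v F V, of u] field_deriv_extension[OF \<Gamma> v F L, of u]
    by (simp add: field_deriv_def flat vert_deriv_0 Let_def)
  show "fun_deriv \<A> nabla A h (p, e) u = dir_deriv \<A> p u (\<lambda>q. h (q, V q))" if h: "aniso_fun \<A> A h"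
    using fun_deriv_extension[OF \<Gamma> v h V, of u] fun_deriv_extension[OF \<Gamma> v h L, of u]
    by (simp add: fun_deriv_def flat vert_deriv_0 Let_def)
qed

text \<open>Every tangent vector at \<open>p\<close> is the value of some field on
  \<open>\<Omega>\<close>, namely of the restriction of \<open>ext_vec\<close>, so quantifying over
  fields and over vectors comes to the same.\<close>

lemma adapted_ext_iff:
  "adapted_ext \<A> nabla A (p, e) \<Omega> V \<longleftrightarrow>
     admissible \<A> A \<Omega> V \<and> p \<in> \<Omega> \<and> V p = e \<and> (\<forall>u. cov \<A> nabla (p, e) u V = 0)"
  using vector_field_subset[OF ext_vec(1)] ext_vec(2) unfolding adapted_ext_def fst_conv snd_conv
  by (metis subset_UNIV)

lemma adapted_ext_exists:
  assumes v: "(p, e) \<in> A"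
  obtains \<Omega> V where "adapted_ext \<A> nabla A (p, e) \<Omega> V"
proof -
  let ?c = "chart_at \<A> p"
  obtain U \<Gamma> where \<Gamma>: "christoffel ?c U \<Gamma>" "p \<in> U" using christoffel_exists[OF chart_at] .
  \<comment> \<open>In the preferred chart the coordinates of \<open>e\<close> at \<open>p\<close>
    are \<open>e\<close> itself, so no \<open>tcoord\<close> is applied.\<close>
  let ?L = "\<lambda>u. - \<Gamma> (snd ?c p, e) u e"
  have "linear ?L" by (simp add: linear_iff blinfun.add_right blinfun.add_left blinfun.scaleR_right blinfun.scaleR_left)
  then obtain \<Omega> V where V: "admissible \<A> A \<Omega> V" "p \<in> \<Omega>" "V p = e" "(field_rep \<A> ?c V has_derivative ?L) (at (snd ?c p))"
    using admissible_affine_exists[OF chart_at v] by metis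
  have "cov \<A> nabla (p, e) u V = 0" for u
    using cov_chart[OF \<Gamma> v _ V(2), of V u] V(1,3) fun_cong[OF frechet_derivative_at[OF V(4)], of u, symmetric]
    by (simp add: admissible_def)
  with V show thesis using that by (auto simp: adapted_ext_iff)
qed

end

subsection \<open>Curvature\<close>

text \<open>One slot at a time: at each step the remaining slots are frozen, and the previous step
  supplies the differentiability that the next one asks for.\<close>

lemma has_derivative_trilinear_apply:
  fixes Q :: "'a::real_normed_vector \<Rightarrow> 'b::euclidean_space \<Rightarrow> 'c::euclidean_space \<Rightarrow> 'd::euclidean_space \<Rightarrow> 'f::real_normed_vector"
  assumes S: "open S" "x \<in> S"
    and lin: "\<And>y b c. y \<in> S \<Longrightarrow> linear (\<lambda>a. Q y a b c)" "\<And>y a c. y \<in> S \<Longrightarrow> linear (\<lambda>b. Q y a b c)"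
      "\<And>y a b. y \<in> S \<Longrightarrow> linear (Q y a b)"
    and diff: "\<And>a b c. (\<lambda>y. Q y a b c) differentiable (at x)"
    and D: "(X has_derivative X') (at x)" "(Y has_derivative Y') (at x)" "(Z has_derivative Z') (at x)"
  shows "((\<lambda>y. Q y (X y) (Y y) (Z y)) has_derivative
    (\<lambda>u. frechet_derivative (\<lambda>y. Q y (X x) (Y x) (Z x)) (at x) u +
      Q x (X' u) (Y x) (Z x) + Q x (X x) (Y' u) (Z x) + Q x (X x) (Y x) (Z' u))) (at x)"
proof -
  have 1: "((\<lambda>y. Q y (X y) b c) has_derivative
      (\<lambda>u. frechet_derivative (\<lambda>y. Q y (X x) b c) (at x) u + Q x (X' u) b c)) (at x)" for b c
    by (rule has_derivative_linear_apply[OF S lin(1) diff D(1)])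
  have 2: "((\<lambda>y. Q y (X y) (Y y) c) has_derivative
      (\<lambda>u. frechet_derivative (\<lambda>y. Q y (X y) (Y x) c) (at x) u + Q x (X x) (Y' u) c)) (at x)" for c
    by (rule has_derivative_linear_apply[OF S lin(2) differentiableI[OF 1] D(2)])
  have 3: "((\<lambda>y. Q y (X y) (Y y) (Z y)) has_derivative
      (\<lambda>u. frechet_derivative (\<lambda>y. Q y (X y) (Y y) (Z x)) (at x) u + Q x (X x) (Y x) (Z' u))) (at x)"
    by (rule has_derivative_linear_apply[OF S lin(3) differentiableI[OF 2] D(3)])
  show ?thesis
    using 3 unfolding frechet_derivative_at[OF 2, symmetric] frechet_derivative_at[OF 1, symmetric] .
qed

lemma has_derivative_bilinear_blinfun:
  assumes "(G has_derivative G') (at x)" "(X has_derivative X') (at x)" "(Y has_derivative Y') (at x)"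
  shows "((\<lambda>y. blinfun_apply (blinfun_apply (G y) (X y)) (Y y)) has_derivative
    (\<lambda>u. G' u (X x) (Y x) + G x (X' u) (Y x) + G x (X x) (Y' u))) (at x)"
  by (rule has_derivative_eq_rhs[OF bounded_bilinear.FDERIV[OF bounded_bilinear_blinfun_apply
      bounded_bilinear.FDERIV[OF bounded_bilinear_blinfun_apply assms(1,2)] assms(3)]])
    (simp add: blinfun.add_left fun_eq_iff add_ac)

text \<open>The curvature, in coordinates, of the affine connection with Christoffel symbols
  \<open>G\<close>: the antisymmetrised derivative of \<open>G\<close> plus the commutator of its
  values.\<close>

definition curv_form :: "('e \<Rightarrow> 'e \<Rightarrow>\<^sub>L 'e \<Rightarrow>\<^sub>L 'e) \<Rightarrow> 'e \<Rightarrow> 'e \<Rightarrow> 'e \<Rightarrow> 'e::real_normed_vector \<Rightarrow> 'e" where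
  "curv_form G x a b w = frechet_derivative G (at x) a b w - frechet_derivative G (at x) b a w
     + G x a (G x b w) - G x b (G x a w)"

lemma covariant_derivative_has_derivative:
  fixes Y Z :: "'e::euclidean_space \<Rightarrow> 'e"
  assumes S: "open S" "x \<in> S" and G: "smooth_on S G" and Y: "smooth_on S Y" and Z: "smooth_on S Z"
  shows "((\<lambda>x. frechet_derivative Z (at x) (Y x) + blinfun_apply (blinfun_apply (G x) (Y x)) (Z x)) has_derivative
    (\<lambda>u. (frechet_derivative (\<lambda>y. frechet_derivative Z (at y) (Y x)) (at x) u +
        frechet_derivative Z (at x) (frechet_derivative Y (at x) u)) +
      (frechet_derivative G (at x) u (Y x) (Z x) + G x (frechet_derivative Y (at x) u) (Z x) +
        G x (Y x) (frechet_derivative Z (at x) u)))) (at x)"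
proof (intro has_derivative_add has_derivative_bilinear_blinfun smooth_on_has_derivative[OF _ S(2)] G Y Z)
  show "((\<lambda>x. frechet_derivative Z (at x) (Y x)) has_derivative
     (\<lambda>u. frechet_derivative (\<lambda>y. frechet_derivative Z (at y) (Y x)) (at x) u +
          frechet_derivative Z (at x) (frechet_derivative Y (at x) u))) (at x)"
    by (rule has_derivative_linear_apply[OF S _ _ smooth_on_has_derivative[OF Y S(2)]])
      (auto intro: linear_frechet_derivative smooth_on_differentiable[OF Z]
        smooth_on_differentiable[OF smooth_on_frechet_derivative[OF Z] S(2)])
qed

text \<open>Second derivatives of \<open>Z\<close> cancel by symmetry, the products of
  \<open>G\<close> with first derivatives of \<open>Z\<close> cancel in pairs, and the derivatives
  of \<open>X\<close> and \<open>Y\<close> are absorbed by the bracket \<open>B\<close>.\<close>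

lemma covariant_derivative_commutator:
  fixes X Y Z :: "'e::euclidean_space \<Rightarrow> 'e"
  assumes S: "open S" "x \<in> S" and G: "smooth_on S G"
    and X: "smooth_on S X" and Y: "smooth_on S Y" and Z: "smooth_on S Z"
  defines "nb \<equiv> \<lambda>X Y x. frechet_derivative Y (at x) (X x) + blinfun_apply (blinfun_apply (G x) (X x)) (Y x)"
    and "B \<equiv> frechet_derivative Y (at x) (X x) - frechet_derivative X (at x) (Y x)"
  shows "nb X (nb Y Z) x - nb Y (nb X Z) x - (frechet_derivative Z (at x) B + G x B (Z x)) =
    curv_form G x (X x) (Y x) (Z x)"
proof -
  have lin: "linear (frechet_derivative Z (at x))"
    by (rule linear_frechet_derivative[OF smooth_on_differentiable[OF Z S(2)]])
  show ?thesis
    unfolding nb_def B_def curv_form_def linear_diff[OF lin]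
      frechet_derivative_at[OF covariant_derivative_has_derivative[OF S G X Z], symmetric]
      frechet_derivative_at[OF covariant_derivative_has_derivative[OF S G Y Z], symmetric]
    using smooth_on_second_derivative_commute[OF S Z, of "X x" "Y x"]
    by (simp add: blinfun.add_right blinfun.diff_right blinfun.diff_left)
qed

context aniso_conn begin

lemma cov_cong:
  assumes v: "(p, e) \<in> A" and Y: "open \<Omega>" "p \<in> \<Omega>" "vector_field \<A> \<Omega> Y" and eq: "\<And>q. q \<in> \<Omega> \<Longrightarrow> Y q = Y' q"
  shows "cov \<A> nabla (p, e) u Y = cov \<A> nabla (p, e) u Y'"
proof -
  let ?c = "chart_at \<A> p"
  have c: "?c \<in> \<A>" "p \<in> fst ?c" by (rule chart_at)+
  obtain U \<Gamma> where \<Gamma>: "christoffel ?c U \<Gamma>" "p \<in> U" using christoffel_exists[OF chart_at] .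
  have Y': "vector_field \<A> \<Omega> Y'" by (rule vector_field_cong[OF Y(1) eq Y(3)])
  have "frechet_derivative (field_rep \<A> ?c Y) (at (snd ?c p)) = frechet_derivative (field_rep \<A> ?c Y') (at (snd ?c p))"
    by (rule frechet_derivative_transform_within_open[OF _ chart_image_open[OF c(1) Y(1)]])
      (use Y eq c smooth_on_differentiable[OF vector_field_rep[OF Y(3) c(1)]] in auto)
  then have "tcoord \<A> ?c p (cov \<A> nabla (p, e) u Y) = tcoord \<A> ?c p (cov \<A> nabla (p, e) u Y')"
    using cov_chart[OF \<Gamma> v Y] cov_chart[OF \<Gamma> v Y(1,2) Y'] eq[OF Y(2)] by simp
  then show ?thesis by simp
qed

section \<open>The affine connection induced by an admissible field, in a chart\<close>

definition gamma_along :: "('m, 'e) chart \<Rightarrow> ('e \<times> 'e \<Rightarrow> 'e \<Rightarrow>\<^sub>L 'e \<Rightarrow>\<^sub>L 'e) \<Rightarrow> ('m \<Rightarrow> 'e) \<Rightarrow> 'e \<Rightarrow> 'e \<Rightarrow>\<^sub>L 'e \<Rightarrow>\<^sub>L 'e" where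
  "gamma_along c \<Gamma> V x = \<Gamma> (x, field_rep \<A> c V x)"

lemma smooth_on_along:
  assumes V: "admissible \<A> A \<Omega> V" and c: "c \<in> \<A>" "open U" and f: "smooth_on (tm_over c U) f"
  shows "smooth_on (snd c ` (fst c \<inter> (U \<inter> \<Omega>))) (\<lambda>x. f (x, field_rep \<A> c V x))"
proof -
  have \<Omega>: "open \<Omega>" using V by (simp add: admissible_def)
  show ?thesis
    by (rule smooth_on_compose[OF chart_image_open[OF c(1) open_Int[OF c(2) \<Omega>]] open_tm_over[OF c] _
      smooth_on_subset[OF admissible_rep(1)[OF V c(1)]] f])
      (use admissible_rep(3)[OF V c(1), of _ U] in auto)
qed

lemma smooth_on_gamma_along:
  assumes V: "admissible \<A> A \<Omega> V" and \<Gamma>: "christoffel c U \<Gamma>"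
  shows "smooth_on (snd c ` (fst c \<inter> (U \<inter> \<Omega>))) (gamma_along c \<Gamma> V)"
  unfolding gamma_along_def using smooth_on_along[OF V] christoffelD[OF \<Gamma>] by blast

lemma cov_field_chart:
  assumes V: "admissible \<A> A \<Omega> V" and \<Gamma>: "christoffel c U \<Gamma>" and q: "q \<in> U" "q \<in> \<Omega>"
    and Y: "vector_field \<A> \<Omega> Y"
  shows "tcoord \<A> c q (cov_field (induced_connection \<A> nabla V) X Y q) =
    frechet_derivative (field_rep \<A> c Y) (at (snd c q)) (tcoord \<A> c q (X q)) +
    gamma_along c \<Gamma> V (snd c q) (tcoord \<A> c q (X q)) (tcoord \<A> c q (Y q))"
proof -
  have c: "c \<in> \<A>" "q \<in> fst c" using christoffelD[OF \<Gamma>] q by auto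
  have v: "(q, V q) \<in> A" "open \<Omega>" using V q by (auto simp: admissible_def)
  show ?thesis
    unfolding cov_field_def induced_connection_def gamma_along_def
    using cov_chart[OF \<Gamma> q(1) v(1,2) q(2) Y] c by simp
qed

lemma cov_field_rep:
  assumes V: "admissible \<A> A \<Omega> V" and \<Gamma>: "christoffel c U \<Gamma>" and Y: "vector_field \<A> \<Omega> Y"
    and x: "x \<in> snd c ` (fst c \<inter> (U \<inter> \<Omega>))"
  shows "field_rep \<A> c (cov_field (induced_connection \<A> nabla V) X Y) x =
    frechet_derivative (field_rep \<A> c Y) (at x) (field_rep \<A> c X x) +
    gamma_along c \<Gamma> V x (field_rep \<A> c X x) (field_rep \<A> c Y x)"
  using x cov_field_chart[OF V \<Gamma> _ _ Y] christoffelD(1)[OF \<Gamma>] by auto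

lemma vector_field_cov_field:
  assumes V: "admissible \<A> A \<Omega> V" and X: "vector_field \<A> \<Omega> X" and Y: "vector_field \<A> \<Omega> Y"
  shows "vector_field \<A> \<Omega> (cov_field (induced_connection \<A> nabla V) X Y)"
  unfolding vector_field_def
proof (intro ballI, rule smooth_on_open_local)
  fix c x assume c: "c \<in> \<A>" and "x \<in> snd c ` (fst c \<inter> \<Omega>)"
  then obtain q where q: "q \<in> fst c" "q \<in> \<Omega>" "x = snd c q" by auto
  obtain U \<Gamma> where \<Gamma>: "christoffel c U \<Gamma>" "q \<in> U" using christoffel_exists[OF c q(1)] .
  let ?S = "snd c ` (fst c \<inter> (U \<inter> \<Omega>))"
  have o: "open ?S" using V christoffelD[OF \<Gamma>(1)] by (intro chart_image_open) (auto simp: admissible_def)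
  have XY: "smooth_on ?S (field_rep \<A> c X)" "smooth_on ?S (field_rep \<A> c Y)"
    using vector_field_rep[OF X c] vector_field_rep[OF Y c] by (auto intro: smooth_on_subset)
  have nb: "smooth_on ?S (\<lambda>x. frechet_derivative (field_rep \<A> c Y) (at x) (field_rep \<A> c X x) +
      gamma_along c \<Gamma> V x (field_rep \<A> c X x) (field_rep \<A> c Y x))"
    by (intro smooth_on_add smooth_on_blinfun_apply smooth_on_gamma_along[OF V \<Gamma>(1)] XY o
        smooth_on_frechet_derivative_apply[OF o o XY(2) _ smooth_on_ident]) auto
  have "smooth_on ?S (field_rep \<A> c (cov_field (induced_connection \<A> nabla V) X Y))"
    by (rule smooth_on_cong[OF o _ nb]) (rule cov_field_rep[OF V \<Gamma>(1) Y, symmetric])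
  then show "\<exists>T. open T \<and> x \<in> T \<and> smooth_on T (field_rep \<A> c (cov_field (induced_connection \<A> nabla V) X Y))"
    using o q \<Gamma>(2) by blast
qed

lemma vector_field_classical_curv:
  assumes V: "admissible \<A> A \<Omega> V" and "vector_field \<A> \<Omega> X" "vector_field \<A> \<Omega> Y" "vector_field \<A> \<Omega> Z"
  shows "vector_field \<A> \<Omega> (classical_curv \<A> (induced_connection \<A> nabla V) X Y Z)"
proof -
  have \<Omega>: "open \<Omega>" using V by (simp add: admissible_def)
  let ?C = "cov_field (induced_connection \<A> nabla V)"
  have "vector_field \<A> \<Omega> (\<lambda>q. (?C X (?C Y Z) q + (-1) *\<^sub>R ?C Y (?C X Z) q) + (-1) *\<^sub>R ?C (lie_bracket \<A> X Y) Z q)"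
    by (intro vector_field_add vector_field_scaleR vector_field_cov_field[OF V] vector_field_lie_bracket
        smooth_fun_const \<Omega> assms)
  then show ?thesis by (simp add: classical_curv_def[abs_def])
qed

text \<open>The second covariant derivative differentiates the components of the first, so the chart
  formula for the first must hold on the open set \<open>?S\<close> and not only at
  \<open>q\<close>; after that the claim is the commutator computation in coordinates.\<close>

lemma classical_curv_chart:
  assumes V: "admissible \<A> A \<Omega> V" and \<Gamma>: "christoffel c U \<Gamma>" and q: "q \<in> U" "q \<in> \<Omega>"
    and X: "vector_field \<A> \<Omega> X" and Y: "vector_field \<A> \<Omega> Y" and Z: "vector_field \<A> \<Omega> Z"
  shows "tcoord \<A> c q (classical_curv \<A> (induced_connection \<A> nabla V) X Y Z q) =
    curv_form (gamma_along c \<Gamma> V) (snd c q) (tcoord \<A> c q (X q)) (tcoord \<A> c q (Y q)) (tcoord \<A> c q (Z q))"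
proof -
  have c: "c \<in> \<A>" "q \<in> fst c" using christoffelD[OF \<Gamma>] q by auto
  have \<Omega>: "open \<Omega>" using V by (auto simp: admissible_def)
  let ?S = "snd c ` (fst c \<inter> (U \<inter> \<Omega>))"
  have S: "open ?S" "snd c q \<in> ?S" using \<Omega> c q christoffelD[OF \<Gamma>] by (auto intro!: chart_image_open)
  have sm: "smooth_on ?S (field_rep \<A> c F)" if "vector_field \<A> \<Omega> F" for F
    using vector_field_rep[OF that c(1)] by (rule smooth_on_subset) auto
  let ?C = "cov_field (induced_connection \<A> nabla V)"
  let ?nb = "\<lambda>X Y x. frechet_derivative Y (at x) (X x) + blinfun_apply (blinfun_apply (gamma_along c \<Gamma> V x) (X x)) (Y x)"
  have C: "tcoord \<A> c q (?C X (?C Y Z) q) = ?nb (field_rep \<A> c X) (?nb (field_rep \<A> c Y) (field_rep \<A> c Z)) (snd c q)"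
    if X: "vector_field \<A> \<Omega> X" and Y: "vector_field \<A> \<Omega> Y" for X Y
  proof -
    have vf: "vector_field \<A> \<Omega> (?C Y Z)" by (rule vector_field_cov_field[OF V Y Z])
    have "frechet_derivative (field_rep \<A> c (?C Y Z)) (at (snd c q)) =
      frechet_derivative (?nb (field_rep \<A> c Y) (field_rep \<A> c Z)) (at (snd c q))"
      by (rule frechet_derivative_transform_within_open[OF smooth_on_differentiable[OF sm[OF vf] S(2)] S])
        (rule cov_field_rep[OF V \<Gamma> Z])
    moreover have "tcoord \<A> c q (?C Y Z q) = ?nb (field_rep \<A> c Y) (field_rep \<A> c Z) (snd c q)"
      using cov_field_chart[OF V \<Gamma> q Z] c by simp
    ultimately show ?thesis using cov_field_chart[OF V \<Gamma> q vf, of X] c by simp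
  qed
  have lin: "linear (tcoord \<A> c q)" by (rule linear_tcoord[OF c])
  show ?thesis
    using covariant_derivative_commutator[OF S smooth_on_gamma_along[OF V \<Gamma>] sm[OF X] sm[OF Y] sm[OF Z]]
      lie_bracket_chart[OF c \<Omega> q(2) X Y] c
    unfolding classical_curv_def linear_diff[OF lin] C[OF X Y] C[OF Y X] cov_field_chart[OF V \<Gamma> q Z]
    by simp
qed

text \<open>Along an adapted field the vertical correction in \<open>field_deriv\<close> is 0, and
  the anisotropic field given by \<open>nabla\<close>, evaluated along \<open>V\<close>, is the
  derivative for the induced connection. So the two definitions agree term by term.\<close>

lemma curv_eq_classical_curv:
  assumes v: "(p, e) \<in> A" and ad: "adapted_ext \<A> nabla A (p, e) \<Omega> V"
    and X: "vector_field \<A> UNIV X" and Y: "vector_field \<A> UNIV Y" and Z: "vector_field \<A> UNIV Z"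
  shows "curv \<A> nabla A (p, e) X Y Z = classical_curv \<A> (induced_connection \<A> nabla V) X Y Z p"
proof -
  have V: "admissible \<A> A \<Omega> V" "p \<in> \<Omega>" "V p = e" and flat: "\<And>u. cov \<A> nabla (p, e) u V = 0"
    using ad by (auto simp: adapted_ext_iff)
  have \<Omega>: "open \<Omega>" using V by (simp add: admissible_def)
  let ?D = "induced_connection \<A> nabla V"
  have 1: "field_deriv \<A> nabla A (\<lambda>w. nabla w Y Z) (p, e) u = cov \<A> nabla (p, e) u (cov_field ?D Y Z)"
    if Y: "vector_field \<A> UNIV Y" for Y u
  proof -
    have F: "aniso_field \<A> A (\<lambda>w. nabla w Y Z)" by (rule aniso_field_nabla[OF Y Z])
    show ?thesis
      unfolding field_deriv_adapted[OF v V flat F]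
      by (rule cov_cong[OF v \<Omega> V(2) vector_field_along[OF F V(1)]])
        (use V in \<open>auto simp: cov_field_def induced_connection_def admissible_def intro!: nabla_eq_cov Y Z\<close>)
  qed
  have "nabla (p, e) (lie_bracket \<A> X Y) Z = cov \<A> nabla (p, e) (lie_bracket \<A> X Y p) Z"
    by (rule nabla_eq_cov[OF v vector_field_lie_bracket[OF open_UNIV X Y] Z])
  then show ?thesis
    by (simp add: curv_def classical_curv_def 1[OF X] 1[OF Y] cov_field_def induced_connection_def V(3))
qed

text \<open>The derivative of \<open>\<Gamma>\<close> along the horizontal lift of \<open>a\<close>: for adapted \<open>V\<close> it is the derivative
  of \<open>x \<mapsto> \<Gamma> (x, V x)\<close> at the base point.\<close>

definition horizontal :: "('e \<times> 'e \<Rightarrow> 'e \<Rightarrow>\<^sub>L 'e \<Rightarrow>\<^sub>L 'e) \<Rightarrow> 'e \<times> 'e \<Rightarrow> 'e \<Rightarrow> 'e \<Rightarrow>\<^sub>L 'e \<Rightarrow>\<^sub>L 'e" where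
  "horizontal \<Gamma> z a = frechet_derivative \<Gamma> (at z) (a, - \<Gamma> z a (snd z))"

text \<open>\<open>curv_form\<close> with the derivatives of the symbols replaced by horizontal
  ones. It depends on the point \<open>z\<close> of the tangent bundle and not on an
  extension.\<close>

definition aniso_curv_form :: "('e \<times> 'e \<Rightarrow> 'e \<Rightarrow>\<^sub>L 'e \<Rightarrow>\<^sub>L 'e) \<Rightarrow> 'e \<times> 'e \<Rightarrow> 'e \<Rightarrow> 'e \<Rightarrow> 'e \<Rightarrow> 'e" where
  "aniso_curv_form \<Gamma> z a b w =
     horizontal \<Gamma> z a b w - horizontal \<Gamma> z b a w + \<Gamma> z a (\<Gamma> z b w) - \<Gamma> z b (\<Gamma> z a w)"

text \<open>The coordinate expression of \<open>\<nabla>\<^sup>V\<^sub>a V\<close>, which vanishes at the base point of an adapted \<open>V\<close>.\<close>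

definition deriv_along :: "('m, 'e) chart \<Rightarrow> ('e \<times> 'e \<Rightarrow> 'e \<Rightarrow>\<^sub>L 'e \<Rightarrow>\<^sub>L 'e) \<Rightarrow> ('m \<Rightarrow> 'e) \<Rightarrow> 'e \<Rightarrow> 'e \<Rightarrow> 'e" where
  "deriv_along c \<Gamma> V x a =
     frechet_derivative (field_rep \<A> c V) (at x) a + gamma_along c \<Gamma> V x a (field_rep \<A> c V x)"

text \<open>Splitting the derivative of the graph map of \<open>V\<close> into a horizontal and a
  vertical vector isolates the terms in \<open>deriv_along\<close>; these become the
  \<open>P\<close> terms of the final formula.\<close>

lemma curv_form_along:
  assumes V: "admissible \<A> A \<Omega> V" and \<Gamma>: "christoffel c U \<Gamma>" and x: "x \<in> snd c ` (fst c \<inter> (U \<inter> \<Omega>))"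
  shows "curv_form (gamma_along c \<Gamma> V) x a b w = aniso_curv_form \<Gamma> (x, field_rep \<A> c V x) a b w
    + frechet_derivative \<Gamma> (at (x, field_rep \<A> c V x)) (0, deriv_along c \<Gamma> V x a) b w
    - frechet_derivative \<Gamma> (at (x, field_rep \<A> c V x)) (0, deriv_along c \<Gamma> V x b) a w"
proof -
  have c: "c \<in> \<A>" by (rule christoffelD[OF \<Gamma>])
  let ?z = "(x, field_rep \<A> c V x)"
  let ?DV = "frechet_derivative (field_rep \<A> c V) (at x)" and ?DG = "frechet_derivative \<Gamma> (at ?z)"
  have G: "(\<Gamma> has_derivative ?DG) (at ?z)"
    by (rule smooth_on_has_derivative[OF christoffelD(4)[OF \<Gamma>] admissible_rep(3)[OF V c x]])
  have "vector_field \<A> \<Omega> V" using V by (simp add: admissible_def)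
  from smooth_on_has_derivative[OF vector_field_rep[OF this c], of x]
  have dV: "(field_rep \<A> c V has_derivative ?DV) (at x)" using x by blast
  have "(gamma_along c \<Gamma> V has_derivative (\<lambda>a. ?DG (a, ?DV a))) (at x)"
    unfolding gamma_along_def[abs_def]
    by (rule has_derivative_compose[OF has_derivative_Pair[OF has_derivative_ident dV] G])
  from frechet_derivative_at[OF this, symmetric]
  have 1: "frechet_derivative (gamma_along c \<Gamma> V) (at x) a = ?DG (a, ?DV a)" for a by simp
  have "?DG (a, ?DV a) = horizontal \<Gamma> ?z a + ?DG (0, deriv_along c \<Gamma> V x a)" for a
    unfolding horizontal_def linear_add[OF has_derivative_linear[OF G], symmetric]
    by (simp add: deriv_along_def gamma_along_def)
  then show ?thesis
    unfolding curv_form_def aniso_curv_form_def 1 by (simp add: blinfun.add_left gamma_along_def)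
qed

lemma linear_horizontal:
  assumes "christoffel c U \<Gamma>" "z \<in> tm_over c U"
  shows "linear (horizontal \<Gamma> z)"
proof -
  have "linear (\<lambda>a. (a, - \<Gamma> z a (snd z)))"
    by (simp add: linear_iff blinfun.add_left blinfun.scaleR_left blinfun.add_right blinfun.scaleR_right)
  from linear_compose[OF this linear_frechet_derivative[OF smooth_on_differentiable[OF christoffelD(4)[OF assms(1)] assms(2)]]]
  show ?thesis by (simp add: horizontal_def[abs_def] o_def)
qed

lemma linear_aniso_curv_form:
  assumes "christoffel c U \<Gamma>" "z \<in> tm_over c U"
  shows "linear (\<lambda>a. aniso_curv_form \<Gamma> z a b w)" "linear (\<lambda>b. aniso_curv_form \<Gamma> z a b w)"
    "linear (aniso_curv_form \<Gamma> z a b)"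
  using linear_horizontal[OF assms]
  by (simp_all add: linear_iff aniso_curv_form_def blinfun.add_left blinfun.scaleR_left blinfun.add_right
      blinfun.scaleR_right algebra_simps)

lemma smooth_on_aniso_curv_form:
  assumes \<Gamma>: "christoffel c U \<Gamma>"
    and f: "smooth_on (tm_over c U) f" and g: "smooth_on (tm_over c U) g" and h: "smooth_on (tm_over c U) h"
  shows "smooth_on (tm_over c U) (\<lambda>z. aniso_curv_form \<Gamma> z (f z) (g z) (h z))"
proof -
  note G = christoffelD(4)[OF \<Gamma>] and o = christoffelD(5)[OF \<Gamma>]
  have snd: "smooth_on (tm_over c U) snd"
    using smooth_on_bounded_linear[OF bounded_linear_snd o smooth_on_ident] .
  have H: "smooth_on (tm_over c U) (\<lambda>z. horizontal \<Gamma> z (k z))" if k: "smooth_on (tm_over c U) k" for k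
    unfolding horizontal_def
    by (rule smooth_on_frechet_derivative_apply[OF o o G _ smooth_on_ident])
      (auto intro!: smooth_on_Pair smooth_on_minus smooth_on_blinfun_apply k snd G o)
  show ?thesis unfolding aniso_curv_form_def
    by (intro smooth_on_add smooth_on_diff smooth_on_blinfun_apply H f g h G o)
qed

lemma deriv_along_zero:
  assumes \<Gamma>: "christoffel c U \<Gamma>" "p \<in> U" and v: "(p, e) \<in> A" and ad: "adapted_ext \<A> nabla A (p, e) \<Omega> V"
  shows "deriv_along c \<Gamma> V (snd c p) a = 0"
proof -
  have c: "c \<in> \<A>" "p \<in> fst c" using christoffelD[OF \<Gamma>(1)] \<Gamma>(2) by auto
  have V: "open \<Omega>" "p \<in> \<Omega>" "V p = e" "vector_field \<A> \<Omega> V" and flat: "\<And>u. cov \<A> nabla (p, e) u V = 0"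
    using ad by (auto simp: adapted_ext_iff admissible_def)
  show ?thesis
    using cov_chart[OF \<Gamma> v V(1,2,4), of "tvec \<A> c p a"] c V(3)
    by (simp add: flat deriv_along_def gamma_along_def linear_0[OF linear_tcoord[OF c]])
qed

lemma curv_form_adapted:
  assumes \<Gamma>: "christoffel c U \<Gamma>" "p \<in> U" and v: "(p, e) \<in> A" and ad: "adapted_ext \<A> nabla A (p, e) \<Omega> V"
  shows "curv_form (gamma_along c \<Gamma> V) (snd c p) a b w = aniso_curv_form \<Gamma> (snd c p, tcoord \<A> c p e) a b w"
proof -
  have c: "c \<in> \<A>" "p \<in> fst c" using christoffelD[OF \<Gamma>(1)] \<Gamma>(2) by auto
  have V: "admissible \<A> A \<Omega> V" "p \<in> \<Omega>" "V p = e" using ad by (auto simp: adapted_ext_iff)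
  have "(snd c p, tcoord \<A> c p e) \<in> tm_over c U" using c v \<Gamma>(2) by simp
  then have "linear (frechet_derivative \<Gamma> (at (snd c p, tcoord \<A> c p e)))"
    by (intro linear_frechet_derivative smooth_on_differentiable[OF christoffelD(4)[OF \<Gamma>(1)]])
  from linear_0[OF this] have "frechet_derivative \<Gamma> (at (snd c p, tcoord \<A> c p e)) (0, 0) = 0"
    by (simp add: zero_prod_def)
  then show ?thesis
    using curv_form_along[OF V(1) \<Gamma>(1), of "snd c p" a b w] c V \<Gamma>(2)
    by (simp add: deriv_along_zero[OF \<Gamma> v ad])
qed

text \<open>A field adapted to the very point of evaluation turns the anisotropic curvature into a
  classical one. The outcome mentions only \<open>\<Gamma>\<close> and the coordinates, so it is one
  formula for all points over \<open>U\<close>.\<close>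

lemma curv_chart:
  assumes \<Gamma>: "christoffel c U \<Gamma>" "p \<in> U" and v: "(p, e) \<in> A"
    and X: "vector_field \<A> UNIV X" and Y: "vector_field \<A> UNIV Y" and Z: "vector_field \<A> UNIV Z"
  shows "tcoord \<A> c p (curv \<A> nabla A (p, e) X Y Z) =
    aniso_curv_form \<Gamma> (snd c p, tcoord \<A> c p e) (tcoord \<A> c p (X p)) (tcoord \<A> c p (Y p)) (tcoord \<A> c p (Z p))"
proof -
  obtain \<Omega> V where ad: "adapted_ext \<A> nabla A (p, e) \<Omega> V" using adapted_ext_exists[OF v] .
  have V: "admissible \<A> A \<Omega> V" "p \<in> \<Omega>" using ad by (auto simp: adapted_ext_iff)
  show ?thesis
    unfolding curv_eq_classical_curv[OF v ad X Y Z]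
      classical_curv_chart[OF V(1) \<Gamma> V(2) vector_field_subset[OF X subset_UNIV]
        vector_field_subset[OF Y subset_UNIV] vector_field_subset[OF Z subset_UNIV]]
    by (rule curv_form_adapted[OF \<Gamma> v ad])
qed

text \<open>\<open>curv_deriv\<close> applies \<open>field_deriv\<close> to the curvature, and the
  rule for adapted extensions concerns smooth anisotropic fields.\<close>

lemma aniso_field_curv:
  assumes X: "vector_field \<A> UNIV X" and Y: "vector_field \<A> UNIV Y" and Z: "vector_field \<A> UNIV Z"
  shows "aniso_field \<A> A (\<lambda>v. curv \<A> nabla A v X Y Z)"
  unfolding aniso_field_iff
proof (intro ballI, rule smooth_on_open_local)
  fix c z assume c: "c \<in> \<A>" and "z \<in> tm_dom \<A> c A"
  then obtain p e where p: "p \<in> fst c" "(p, e) \<in> A" "z = (snd c p, tcoord \<A> c p e)" by (rule tm_domE)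
  obtain U \<Gamma> where \<Gamma>: "christoffel c U \<Gamma>" "p \<in> U" using christoffel_exists[OF c p(1)] .
  have o: "open (tm_over c U)" by (rule christoffelD[OF \<Gamma>(1)])
  have F: "smooth_on (tm_over c U) (\<lambda>z. field_rep \<A> c F (fst z))" if "vector_field \<A> UNIV F" for F
    by (rule smooth_on_compose[OF o chart_open_range[OF c] _
        smooth_on_bounded_linear[OF bounded_linear_fst o smooth_on_ident]])
      (use vector_field_rep[OF that c] in \<open>auto simp: tm_over_def tm_dom_def\<close>)
  have "smooth_on (tm_over c U) (aniso_rep c (\<lambda>v. curv \<A> nabla A v X Y Z))"
  proof (rule smooth_on_cong[OF o _ smooth_on_aniso_curv_form[OF \<Gamma>(1) F[OF X] F[OF Y] F[OF Z]]])
    fix z assume "z \<in> tm_over c U"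
    then obtain q e where q: "q \<in> fst c" "q \<in> U" "(q, e) \<in> A" "z = (snd c q, tcoord \<A> c q e)"
      by (rule tm_overE[OF c])
    show "aniso_curv_form \<Gamma> z (field_rep \<A> c X (fst z)) (field_rep \<A> c Y (fst z)) (field_rep \<A> c Z (fst z)) =
      aniso_rep c (\<lambda>v. curv \<A> nabla A v X Y Z) z"
      using curv_chart[OF \<Gamma>(1) q(2,3) X Y Z] q c by simp
  qed
  then show "\<exists>T. open T \<and> z \<in> T \<and> smooth_on T (aniso_rep c (\<lambda>v. curv \<A> nabla A v X Y Z))"
    using o p \<Gamma>(2) c by (intro exI[of _ "tm_over c U"]) simp
qed

lemma curv_at_chart:
  assumes \<Gamma>: "christoffel c U \<Gamma>" "p \<in> U" and v: "(p, e) \<in> A"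
  shows "tcoord \<A> c p (curv_at \<A> nabla A (p, e) x y z) =
    aniso_curv_form \<Gamma> (snd c p, tcoord \<A> c p e) (tcoord \<A> c p x) (tcoord \<A> c p y) (tcoord \<A> c p z)"
  unfolding curv_at_def fst_conv curv_chart[OF assms ext_vec(1) ext_vec(1) ext_vec(1)] ext_vec(2) ..

text \<open>\<open>curv_at\<close> extends the vectors globally, whereas the given fields live on
  \<open>\<Omega>\<close>. In the chart both curvatures are the same expression in the values at
  \<open>p\<close>, so the extensions do not matter.\<close>

lemma curv_at_eq_classical_curv:
  assumes v: "(p, e) \<in> A" and ad: "adapted_ext \<A> nabla A (p, e) \<Omega> V"
    and X: "vector_field \<A> \<Omega> X" and Y: "vector_field \<A> \<Omega> Y" and Z: "vector_field \<A> \<Omega> Z"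
  shows "curv_at \<A> nabla A (p, e) (X p) (Y p) (Z p) = classical_curv \<A> (induced_connection \<A> nabla V) X Y Z p"
proof -
  let ?c = "chart_at \<A> p"
  obtain U \<Gamma> where \<Gamma>: "christoffel ?c U \<Gamma>" "p \<in> U" using christoffel_exists[OF chart_at] .
  have V: "admissible \<A> A \<Omega> V" "p \<in> \<Omega>" using ad by (auto simp: adapted_ext_iff)
  have "tcoord \<A> ?c p (curv_at \<A> nabla A (p, e) (X p) (Y p) (Z p)) =
     tcoord \<A> ?c p (classical_curv \<A> (induced_connection \<A> nabla V) X Y Z p)"
    unfolding curv_at_chart[OF \<Gamma> v] classical_curv_chart[OF V(1) \<Gamma> V(2) X Y Z] curv_form_adapted[OF \<Gamma> v ad] ..
  then show ?thesis by simp
qed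

end

subsection \<open>Anisotropic tensors\<close>

context aniso_space begin

section \<open>Anisotropic objects in charts and under cutoffs\<close>

lemma aniso_rep_local:
  assumes "\<And>q. \<exists>V. open V \<and> q \<in> V \<and> smooth_on (tm_over c V) f" and c: "c \<in> \<A>"
  shows "smooth_on (tm_dom \<A> c A) f"
proof (rule smooth_on_open_local)
  fix z assume "z \<in> tm_dom \<A> c A"
  then obtain q e where q: "q \<in> fst c" "(q, e) \<in> A" "z = (snd c q, tcoord \<A> c q e)" by (rule tm_domE[OF c])
  from assms(1) obtain V where "open V" "q \<in> V" "smooth_on (tm_over c V) f" by blast
  then show "\<exists>T. open T \<and> z \<in> T \<and> smooth_on T f"
    using q c open_tm_over[OF c] by (intro exI[of _ "tm_over c V"]) simp
qed

lemma tm_over_subset: "tm_over c U \<subseteq> tm_dom \<A> c A"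
  by (auto simp: tm_over_def)

lemma fst_tm_param [simp]: "fst (tm_param \<A> c z) = chart_inv c (fst z)"
  by (simp add: tm_param_def)

lemma smooth_on_base:
  assumes c: "c \<in> \<A>" and U: "open U" and f: "smooth_on (snd c ` (fst c \<inter> U)) f"
  shows "smooth_on (tm_over c U) (\<lambda>z. f (fst z))"
  by (rule smooth_on_compose[OF open_tm_over[OF c U] chart_image_open[OF c U] _
      smooth_on_bounded_linear[OF bounded_linear_fst open_tm_over[OF c U] smooth_on_ident] f])
    (auto simp: tm_over_def)

lemma tm_dom_eq_tm_over: "tm_dom \<A> c A = tm_over c UNIV"
  by (auto simp: tm_over_def tm_dom_def)

lemma aniso_fun_base:
  assumes "smooth_fun \<A> UNIV f"
  shows "aniso_fun \<A> A (\<lambda>w. f (fst w))"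
  unfolding aniso_fun_def tm_dom_eq_tm_over
  using smooth_on_base[OF _ open_UNIV smooth_fun_rep[OF assms]] by (simp add: o_def)

lemma aniso_field_base:
  assumes "vector_field \<A> UNIV X"
  shows "aniso_field \<A> A (\<lambda>w. X (fst w))"
  unfolding aniso_field_def tm_dom_eq_tm_over
  using smooth_on_base[OF _ open_UNIV vector_field_rep[OF assms]] by (simp add: field_rep_def)

lemma aniso_form_base:
  assumes "one_form \<A> UNIV \<theta>"
  shows "aniso_form \<A> A (\<lambda>w. \<theta> (fst w))"
  unfolding aniso_form_def tm_dom_eq_tm_over fst_tm_param
proof (intro ballI allI)
  fix c e assume c: "c \<in> \<A>"
  then have "smooth_on (snd c ` (fst c \<inter> UNIV)) (\<lambda>x. blinfun_apply (\<theta> (chart_inv c x)) (tvec \<A> c (chart_inv c x) e))"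
    using assms unfolding one_form_def by blast
  from smooth_on_base[OF c open_UNIV this]
  show "smooth_on (tm_over c UNIV) (\<lambda>z. blinfun_apply (\<theta> (chart_inv c (fst z))) (tvec \<A> c (chart_inv c (fst z)) e))" .
qed

lemma aniso_fun_const: "aniso_fun \<A> A (\<lambda>w. a)"
  using aniso_fun_base[OF smooth_fun_const] .

lemma aniso_field_lincomb:
  assumes "aniso_fun \<A> A f" "aniso_fun \<A> A g" "aniso_field \<A> A X" "aniso_field \<A> A Y"
  shows "aniso_field \<A> A (\<lambda>w. f w *\<^sub>R X w + g w *\<^sub>R Y w)"
  unfolding aniso_field_iff
proof
  fix c assume c: "c \<in> \<A>"
  show "smooth_on (tm_dom \<A> c A) (aniso_rep c (\<lambda>w. f w *\<^sub>R X w + g w *\<^sub>R Y w))"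
  proof (rule smooth_on_cong[OF open_tm_dom[OF c]])
    show "smooth_on (tm_dom \<A> c A) (\<lambda>z. f (tm_param \<A> c z) *\<^sub>R aniso_rep c X z + g (tm_param \<A> c z) *\<^sub>R aniso_rep c Y z)"
      by (intro smooth_on_add smooth_on_scaleR open_tm_dom c)
        (use assms c in \<open>auto simp: aniso_fun_def aniso_field_iff o_def\<close>)
    show "f (tm_param \<A> c z) *\<^sub>R aniso_rep c X z + g (tm_param \<A> c z) *\<^sub>R aniso_rep c Y z =
      aniso_rep c (\<lambda>w. f w *\<^sub>R X w + g w *\<^sub>R Y w) z" if "z \<in> tm_dom \<A> c A" for z
    proof -
      have "chart_inv c (fst z) \<in> fst c" using that c by (auto simp: tm_dom_def)
      note lin = linear_tcoord[OF c this]
      show ?thesis by (simp add: aniso_rep_def linear_add[OF lin] linear_scale[OF lin])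
    qed
  qed
qed

lemma aniso_form_lincomb:
  assumes "aniso_fun \<A> A f" "aniso_fun \<A> A g" "aniso_form \<A> A \<theta>" "aniso_form \<A> A \<eta>"
  shows "aniso_form \<A> A (\<lambda>w. f w *\<^sub>R \<theta> w + g w *\<^sub>R \<eta> w)"
  using assms unfolding aniso_form_def aniso_fun_def
  by (auto simp: o_def plus_blinfun.rep_eq scaleR_blinfun.rep_eq intro!: smooth_on_add smooth_on_mult open_tm_dom)

lemma aniso_fun_cutoff:
  assumes \<psi>: "cutoff U \<Omega> \<psi>" "open \<Omega>" and h: "\<And>c. c \<in> \<A> \<Longrightarrow> smooth_on (tm_over c \<Omega>) (h \<circ> tm_param \<A> c)"
  shows "aniso_fun \<A> A (\<lambda>w. \<psi> (fst w) * h w)"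
  unfolding aniso_fun_def
proof (intro ballI, rule aniso_rep_local)
  fix c q assume c: "c \<in> \<A>"
  let ?f = "(\<lambda>w. \<psi> (fst w) * h w) \<circ> tm_param \<A> c"
  show "\<exists>V. open V \<and> q \<in> V \<and> smooth_on (tm_over c V) ?f"
  proof (rule cutoff_local[OF \<psi>])
    have "smooth_on (tm_over c UNIV) (\<lambda>z. (\<psi> \<circ> chart_inv c) (fst z))"
      by (rule smooth_on_base[OF c open_UNIV smooth_fun_rep[OF cutoffD(1)[OF \<psi>(1)] c]])
    then have "smooth_on (tm_over c \<Omega>) (\<lambda>z. (\<psi> \<circ> chart_inv c) (fst z))"
      by (rule smooth_on_subset) (auto simp: tm_over_def)
    from smooth_on_mult[OF open_tm_over[OF c \<psi>(2)] this h[OF c]]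
    show "smooth_on (tm_over c \<Omega>) ?f" by (simp add: o_def)
    show "smooth_on (tm_over c V) ?f" if V: "open V" "\<And>q. q \<in> V \<Longrightarrow> \<psi> q = 0" for V
      by (rule smooth_on_cong[OF open_tm_over[OF c V(1)] _ smooth_on_const[of _ 0]])
        (use V(2) c in \<open>auto simp: tm_over_def\<close>)
  qed
qed

lemma aniso_fun_field_coord:
  assumes c: "c \<in> \<A>" and \<psi>: "cutoff U (fst c) \<psi>" and X: "aniso_field \<A> A X"
  shows "aniso_fun \<A> A (\<lambda>w. \<psi> (fst w) * (tcoord \<A> c (fst w) (X w) \<bullet> b))"
proof (rule aniso_fun_cutoff[OF \<psi> chart_open_dom[OF c]])
  fix c' assume c': "c' \<in> \<A>"
  have o: "open (tm_over c' (fst c))" by (rule open_tm_over[OF c' chart_open_dom[OF c]])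
  show "smooth_on (tm_over c' (fst c)) ((\<lambda>w. tcoord \<A> c (fst w) (X w) \<bullet> b) \<circ> tm_param \<A> c')"
  proof (rule smooth_on_cong[OF o])
    show "smooth_on (tm_over c' (fst c)) (\<lambda>z. jac c' c (chart_inv c' (fst z)) (aniso_rep c' X z) \<bullet> b)"
    proof (rule smooth_on_bounded_linear[OF bounded_linear_inner_left o smooth_on_jac_apply[OF c c' o _
            smooth_on_base[OF c' chart_open_dom[OF c] smooth_on_ident]]])
      show "smooth_on (tm_over c' (fst c)) (aniso_rep c' X)"
        using X c' tm_over_subset smooth_on_subset unfolding aniso_field_iff by blast
    qed (auto simp: tm_over_def)
    show "jac c' c (chart_inv c' (fst z)) (aniso_rep c' X z) \<bullet> b = ((\<lambda>w. tcoord \<A> c (fst w) (X w) \<bullet> b) \<circ> tm_param \<A> c') z"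
      if "z \<in> tm_over c' (fst c)" for z
    proof -
      have "chart_inv c' (fst z) \<in> fst c'" "chart_inv c' (fst z) \<in> fst c" using that c' by (auto simp: tm_over_def)
      then show ?thesis using c c' by (simp add: aniso_rep_def tcoord_change)
    qed
  qed
qed

lemma aniso_fun_form_coord:
  assumes c: "c \<in> \<A>" and \<psi>: "cutoff U (fst c) \<psi>" and \<theta>: "aniso_form \<A> A \<theta>"
  shows "aniso_fun \<A> A (\<lambda>w. \<psi> (fst w) * blinfun_apply (\<theta> w) (tvec \<A> c (fst w) b))"
proof (rule aniso_fun_cutoff[OF \<psi> chart_open_dom[OF c]])
  fix c' assume c': "c' \<in> \<A>"
  have o: "open (tm_over c' (fst c))" by (rule open_tm_over[OF c' chart_open_dom[OF c]])
  have cc: "chart_inv c' (fst z) \<in> fst c' \<and> chart_inv c' (fst z) \<in> fst c" if "z \<in> tm_over c' (fst c)" for z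
    using that c' by (auto simp: tm_over_def)
  let ?L = "\<lambda>z e. blinfun_apply (\<theta> (tm_param \<A> c' z)) (tvec \<A> c' (fst (tm_param \<A> c' z)) e)"
  show "smooth_on (tm_over c' (fst c)) ((\<lambda>w. blinfun_apply (\<theta> w) (tvec \<A> c (fst w) b)) \<circ> tm_param \<A> c')"
  proof (rule smooth_on_cong[OF o])
    show "smooth_on (tm_over c' (fst c)) (\<lambda>z. ?L z (jac c c' (chart_inv c' (fst z)) b))"
    \<comment> \<open>The definition of a smooth form tests it on constant coordinate vectors of
      \<open>c'\<close>, while the frame vector of \<open>c\<close> has varying coordinates in that
      chart.\<close>
    proof (rule smooth_on_linear_apply[where L = ?L, OF o])
      show "linear (?L z)" if "z \<in> tm_over c' (fst c)" for z
        using cc[OF that] c' by (intro linear_blinfun_apply_comp linear_tvec) auto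
      show "smooth_on (tm_over c' (fst c)) (\<lambda>z. ?L z e)" for e
        using \<theta> c' tm_over_subset smooth_on_subset unfolding aniso_form_def by blast
      show "smooth_on (tm_over c' (fst c)) (\<lambda>z. jac c c' (chart_inv c' (fst z)) b)"
        by (rule smooth_on_base[OF c' chart_open_dom[OF c] smooth_on_jac[OF c c']])
    qed
    show "?L z (jac c c' (chart_inv c' (fst z)) b) = ((\<lambda>w. blinfun_apply (\<theta> w) (tvec \<A> c (fst w) b)) \<circ> tm_param \<A> c') z"
      if "z \<in> tm_over c' (fst c)" for z
      using cc[OF that] c c' by (simp add: tvec_change)
  qed
qed

text \<open>The tensoriality argument: the field is a combination of cut-off frame fields with
  coefficients that vanish at \<open>v\<close>, plus a remainder whose factor
  \<open>1 - \<psi>^2\<close> vanishes there too. \<open>\<tau>\<close> stands for a tensor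
  evaluated at \<open>v\<close> with all slots but one fixed.\<close>

lemma field_functional_zero:
  fixes \<tau> :: "('m \<times> 'e \<Rightarrow> 'e) \<Rightarrow> real"
  assumes v: "v \<in> A"
    and lin: "\<And>f g X Y. aniso_fun \<A> A f \<Longrightarrow> aniso_fun \<A> A g \<Longrightarrow> aniso_field \<A> A X \<Longrightarrow> aniso_field \<A> A Y \<Longrightarrow>
      \<tau> (\<lambda>w. f w *\<^sub>R X w + g w *\<^sub>R Y w) = f v * \<tau> X + g v * \<tau> Y"
    and X: "aniso_field \<A> A X" "X v = 0"
  shows "\<tau> X = 0"
proof -
  let ?c = "chart_at \<A> (fst v)"
  have c: "?c \<in> \<A>" "fst v \<in> fst ?c" by (rule chart_at)+
  obtain U \<psi> where \<psi>: "cutoff U (fst ?c) \<psi>" "fst v \<in> U" using cutoff_exists[OF chart_open_dom[OF c(1)] c(2)] .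
  define E where "E = (\<lambda>b (w::'m \<times> 'e). \<psi> (fst w) *\<^sub>R tvec \<A> ?c (fst w) b)"
  define k where "k = (\<lambda>b w. \<psi> (fst w) * (tcoord \<A> ?c (fst w) (X w) \<bullet> b))"
  have E: "aniso_field \<A> A (E b)" for b unfolding E_def
    by (rule aniso_field_base[OF cutoff_vector_field[OF \<psi>(1) chart_open_dom[OF c(1)] vector_field_tvec[OF c(1)]]])
  have k: "aniso_fun \<A> A (k b)" for b unfolding k_def by (rule aniso_fun_field_coord[OF c(1) \<psi>(1) X(1)])
  have k0: "k b v = 0" for b using c by (simp add: k_def X(2) linear_0[OF linear_tcoord])
  have g: "aniso_fun \<A> A (\<lambda>w. 1 - \<psi> (fst w) * \<psi> (fst w))"
    by (rule aniso_fun_base, intro smooth_fun_diff smooth_fun_const smooth_fun_mult cutoffD(1)[OF \<psi>(1)] open_UNIV)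
  have z: "aniso_field \<A> A (\<lambda>w. 0)" using aniso_field_base[OF vector_field_zero[OF open_UNIV]] .
  have sum: "aniso_field \<A> A (\<lambda>w. \<Sum>b\<in>I. k b w *\<^sub>R E b w) \<and> \<tau> (\<lambda>w. \<Sum>b\<in>I. k b w *\<^sub>R E b w) = 0" if "finite I" for I
    using that
  proof (induction I)
    case empty
    show ?case using z lin[OF aniso_fun_const[of 0] aniso_fun_const[of 0] z z] by simp
  next
    case (insert b I)
    then show ?case
      using aniso_field_lincomb[OF k[of b] aniso_fun_const[of 1] E[of b]] lin[OF k[of b] aniso_fun_const[of 1] E[of b]] k0
      by simp
  qed
  have "X w = (1 - \<psi> (fst w) * \<psi> (fst w)) *\<^sub>R X w + 1 *\<^sub>R (\<Sum>b\<in>Basis. k b w *\<^sub>R E b w)" for w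
  proof (cases "fst w \<in> fst ?c")
    case True
    have "(\<Sum>b\<in>Basis. k b w *\<^sub>R E b w) = (\<psi> (fst w) * \<psi> (fst w)) *\<^sub>R (\<Sum>b\<in>Basis. (tcoord \<A> ?c (fst w) (X w) \<bullet> b) *\<^sub>R tvec \<A> ?c (fst w) b)"
      by (simp add: k_def E_def scaleR_sum_right algebra_simps)
    also have "(\<Sum>b\<in>Basis. (tcoord \<A> ?c (fst w) (X w) \<bullet> b) *\<^sub>R tvec \<A> ?c (fst w) b) = X w"
      using linear_expand_Basis[OF linear_tvec[OF c(1) True], of "tcoord \<A> ?c (fst w) (X w)"]
        tvec_tcoord[OF c(1) True, of "X w"] by simp
    finally show ?thesis by (simp add: algebra_simps)
  next
    case False
    then show ?thesis using cutoffD(4)[OF \<psi>(1)] by (simp add: k_def)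
  qed
  then have "\<tau> X = \<tau> (\<lambda>w. (1 - \<psi> (fst w) * \<psi> (fst w)) *\<^sub>R X w + 1 *\<^sub>R (\<Sum>b\<in>Basis. k b w *\<^sub>R E b w))"
    by simp
  also have "\<dots> = 0"
    using lin[OF g aniso_fun_const[of 1] X(1) conjunct1[OF sum[OF finite_Basis]]] sum[OF finite_Basis]
      cutoffD(2)[OF \<psi>] by simp
  finally show ?thesis .
qed

text \<open>As for fields, with the coordinate differentials as frame;
  \<open>blinfun_inner_left b\<close> picks out the component along \<open>b\<close>.\<close>

lemma form_functional_zero:
  fixes \<tau> :: "('m \<times> 'e \<Rightarrow> 'e \<Rightarrow>\<^sub>L real) \<Rightarrow> real"
  assumes v: "v \<in> A"
    and lin: "\<And>f g X Y. aniso_fun \<A> A f \<Longrightarrow> aniso_fun \<A> A g \<Longrightarrow> aniso_form \<A> A X \<Longrightarrow> aniso_form \<A> A Y \<Longrightarrow>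
      \<tau> (\<lambda>w. f w *\<^sub>R X w + g w *\<^sub>R Y w) = f v * \<tau> X + g v * \<tau> Y"
    and X: "aniso_form \<A> A X" "X v = 0"
  shows "\<tau> X = 0"
proof -
  let ?c = "chart_at \<A> (fst v)"
  have c: "?c \<in> \<A>" "fst v \<in> fst ?c" by (rule chart_at)+
  obtain U \<psi> where \<psi>: "cutoff U (fst ?c) \<psi>" "fst v \<in> U" using cutoff_exists[OF chart_open_dom[OF c(1)] c(2)] .
  define E where "E = (\<lambda>b (w::'m \<times> 'e). \<psi> (fst w) *\<^sub>R chart_form ?c (blinfun_inner_left b) (fst w))"
  define k where "k = (\<lambda>b w. \<psi> (fst w) * blinfun_apply (X w) (tvec \<A> ?c (fst w) b))"
  have E: "aniso_form \<A> A (E b)" for b unfolding E_def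
    by (rule aniso_form_base[OF cutoff_one_form[OF \<psi>(1) chart_open_dom[OF c(1)] one_form_chart_form[OF c(1)]]])
  have k: "aniso_fun \<A> A (k b)" for b unfolding k_def by (rule aniso_fun_form_coord[OF c(1) \<psi>(1) X(1)])
  have k0: "k b v = 0" for b by (simp add: k_def X(2) zero_blinfun.rep_eq)
  have g: "aniso_fun \<A> A (\<lambda>w. 1 - \<psi> (fst w) * \<psi> (fst w))"
    by (rule aniso_fun_base, intro smooth_fun_diff smooth_fun_const smooth_fun_mult cutoffD(1)[OF \<psi>(1)] open_UNIV)
  have z: "aniso_form \<A> A (\<lambda>w. 0)" using aniso_form_base[OF one_form_zero] .
  have sum: "aniso_form \<A> A (\<lambda>w. \<Sum>b\<in>I. k b w *\<^sub>R E b w) \<and> \<tau> (\<lambda>w. \<Sum>b\<in>I. k b w *\<^sub>R E b w) = 0" if "finite I" for I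
    using that
  proof (induction I)
    case empty
    show ?case using z lin[OF aniso_fun_const[of 0] aniso_fun_const[of 0] z z] by simp
  next
    case (insert b I)
    then show ?case
      using aniso_form_lincomb[OF k[of b] aniso_fun_const[of 1] E[of b]] lin[OF k[of b] aniso_fun_const[of 1] E[of b]] k0
      by simp
  qed
  have "X w = (1 - \<psi> (fst w) * \<psi> (fst w)) *\<^sub>R X w + 1 *\<^sub>R (\<Sum>b\<in>Basis. k b w *\<^sub>R E b w)" for w
  proof (cases "fst w \<in> fst ?c")
    case True
    have "(\<Sum>b\<in>Basis. k b w *\<^sub>R E b w) = (\<psi> (fst w) * \<psi> (fst w)) *\<^sub>R X w"
    proof (rule blinfun_eqI)
      fix u
      have "blinfun_apply (X w) u = blinfun_apply (X w) (tvec \<A> ?c (fst w) (tcoord \<A> ?c (fst w) u))"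
        using tvec_tcoord[OF c(1) True, of u] by simp
      also have "\<dots> = (\<Sum>b\<in>Basis. (tcoord \<A> ?c (fst w) u \<bullet> b) *\<^sub>R blinfun_apply (X w) (tvec \<A> ?c (fst w) b))"
        by (rule linear_expand_Basis[OF linear_blinfun_apply_comp[OF linear_tvec[OF c(1) True]]])
      finally show "blinfun_apply (\<Sum>b\<in>Basis. k b w *\<^sub>R E b w) u = blinfun_apply ((\<psi> (fst w) * \<psi> (fst w)) *\<^sub>R X w) u"
        by (simp add: blinfun.sum_left blinfun.scaleR_left k_def E_def chart_form_apply[OF c(1) True]
            sum_distrib_left algebra_simps)
    qed
    then show ?thesis by (simp add: algebra_simps)
  next
    case False
    then show ?thesis using cutoffD(4)[OF \<psi>(1)] by (simp add: k_def)
  qed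
  then have "\<tau> X = \<tau> (\<lambda>w. (1 - \<psi> (fst w) * \<psi> (fst w)) *\<^sub>R X w + 1 *\<^sub>R (\<Sum>b\<in>Basis. k b w *\<^sub>R E b w))"
    by simp
  also have "\<dots> = 0"
    using lin[OF g aniso_fun_const[of 1] X(1) conjunct1[OF sum[OF finite_Basis]]] sum[OF finite_Basis]
      cutoffD(2)[OF \<psi>] by simp
  finally show ?thesis .
qed

lemma field_functional_cong:
  fixes \<tau> :: "('m \<times> 'e \<Rightarrow> 'e) \<Rightarrow> real"
  assumes v: "v \<in> A"
    and lin: "\<And>f g X Y. aniso_fun \<A> A f \<Longrightarrow> aniso_fun \<A> A g \<Longrightarrow> aniso_field \<A> A X \<Longrightarrow> aniso_field \<A> A Y \<Longrightarrow>
      \<tau> (\<lambda>w. f w *\<^sub>R X w + g w *\<^sub>R Y w) = f v * \<tau> X + g v * \<tau> Y"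
    and X: "aniso_field \<A> A X" "aniso_field \<A> A Y" "X v = Y v"
  shows "\<tau> X = \<tau> Y"
proof -
  let ?d = "\<lambda>w. 1 *\<^sub>R X w + (- 1) *\<^sub>R Y w"
  have "\<tau> ?d = 0"
    by (rule field_functional_zero[where \<tau> = \<tau>, OF v lin
        aniso_field_lincomb[OF aniso_fun_const aniso_fun_const X(1,2)]]) (simp_all add: X(3))
  moreover have "\<tau> ?d = 1 * \<tau> X + (- 1) * \<tau> Y"
    by (rule lin[OF aniso_fun_const aniso_fun_const X(1,2)])
  ultimately show ?thesis by linarith
qed

lemma form_functional_cong:
  fixes \<tau> :: "('m \<times> 'e \<Rightarrow> 'e \<Rightarrow>\<^sub>L real) \<Rightarrow> real"
  assumes v: "v \<in> A"
    and lin: "\<And>f g X Y. aniso_fun \<A> A f \<Longrightarrow> aniso_fun \<A> A g \<Longrightarrow> aniso_form \<A> A X \<Longrightarrow> aniso_form \<A> A Y \<Longrightarrow>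
      \<tau> (\<lambda>w. f w *\<^sub>R X w + g w *\<^sub>R Y w) = f v * \<tau> X + g v * \<tau> Y"
    and X: "aniso_form \<A> A X" "aniso_form \<A> A Y" "X v = Y v"
  shows "\<tau> X = \<tau> Y"
proof -
  let ?d = "\<lambda>w. 1 *\<^sub>R X w + (- 1) *\<^sub>R Y w"
  have "\<tau> ?d = 0"
    by (rule form_functional_zero[where \<tau> = \<tau>, OF v lin
        aniso_form_lincomb[OF aniso_fun_const aniso_fun_const X(1,2)]]) (simp_all add: X(3))
  moreover have "\<tau> ?d = 1 * \<tau> X + (- 1) * \<tau> Y"
    by (rule lin[OF aniso_fun_const aniso_fun_const X(1,2)])
  ultimately show ?thesis by linarith
qed

section \<open>Tensors depend only on the values of their arguments at the point\<close>

lemma aniso_tensorD: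
  assumes "aniso_tensor \<A> A r s T" "length \<theta>s = r" "length Xs = s"
    "\<forall>\<theta>\<in>set \<theta>s. aniso_form \<A> A \<theta>" "\<forall>X\<in>set Xs. aniso_field \<A> A X"
  shows "aniso_fun \<A> A (T \<theta>s Xs)"
    and "\<And>i f g \<theta> \<eta> v. i < r \<Longrightarrow> aniso_fun \<A> A f \<Longrightarrow> aniso_fun \<A> A g \<Longrightarrow> aniso_form \<A> A \<theta> \<Longrightarrow> aniso_form \<A> A \<eta> \<Longrightarrow>
      v \<in> A \<Longrightarrow> T (\<theta>s[i := (\<lambda>w. f w *\<^sub>R \<theta> w + g w *\<^sub>R \<eta> w)]) Xs v =
        f v * T (\<theta>s[i := \<theta>]) Xs v + g v * T (\<theta>s[i := \<eta>]) Xs v"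
    and "\<And>j f g X Y v. j < s \<Longrightarrow> aniso_fun \<A> A f \<Longrightarrow> aniso_fun \<A> A g \<Longrightarrow> aniso_field \<A> A X \<Longrightarrow> aniso_field \<A> A Y \<Longrightarrow>
      v \<in> A \<Longrightarrow> T \<theta>s (Xs[j := (\<lambda>w. f w *\<^sub>R X w + g w *\<^sub>R Y w)]) v =
        f v * T \<theta>s (Xs[j := X]) v + g v * T \<theta>s (Xs[j := Y]) v"
  using assms unfolding aniso_tensor_def by blast+

lemma take_drop_Suc_update:
  assumes "length xs = length ys" "n < length xs"
  shows "take (Suc n) xs @ drop (Suc n) ys = (take n xs @ drop n ys)[n := xs ! n]"
  using assms by (simp add: list_update_append take_Suc_conv_app_nth Cons_nth_drop_Suc[symmetric])

text \<open>Arguments are exchanged one at a time: a hybrid list has its first \<open>n\<close>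
  entries from the new list and the rest from the old, and each exchange concerns a functional of a
  single slot.\<close>

lemma tensor_cong:
  assumes T: "aniso_tensor \<A> A r s T" and v: "v \<in> A"
    and \<theta>: "length \<theta>s = r" "\<forall>\<theta>\<in>set \<theta>s. aniso_form \<A> A \<theta>" "length \<eta>s = r" "\<forall>\<theta>\<in>set \<eta>s. aniso_form \<A> A \<theta>"
      "\<And>i. i < r \<Longrightarrow> (\<theta>s ! i) v = (\<eta>s ! i) v"
    and X: "length Xs = s" "\<forall>X\<in>set Xs. aniso_field \<A> A X" "length Ys = s" "\<forall>X\<in>set Ys. aniso_field \<A> A X"
      "\<And>i. i < s \<Longrightarrow> (Xs ! i) v = (Ys ! i) v"
  shows "T \<theta>s Xs v = T \<eta>s Ys v"
proof -
  have 1: "T (take n \<eta>s @ drop n \<theta>s) Xs v = T \<theta>s Xs v" if "n \<le> r" for n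
    using that
  proof (induction n)
    case (Suc n)
    let ?l = "take n \<eta>s @ drop n \<theta>s"
    have l: "length ?l = r" "\<forall>\<theta>\<in>set ?l. aniso_form \<A> A \<theta>"
      using \<theta> Suc.prems by (auto dest: in_set_takeD in_set_dropD)
    have "T (?l[n := \<eta>s ! n]) Xs v = T (?l[n := \<theta>s ! n]) Xs v"
      by (rule form_functional_cong[OF v, where \<tau> = "\<lambda>\<eta>. T (?l[n := \<eta>]) Xs v"],
          rule aniso_tensorD(2)[OF T l(1) X(1) l(2) X(2)])
        (use Suc.prems \<theta> v in auto)
    also have "?l[n := \<theta>s ! n] = ?l"
      using Suc.prems \<theta> by (simp add: list_update_append nth_append Cons_nth_drop_Suc[symmetric])
    finally show ?case using take_drop_Suc_update[of \<eta>s \<theta>s n] Suc \<theta> by simp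
  qed simp
  have 2: "T \<eta>s (take n Ys @ drop n Xs) v = T \<eta>s Xs v" if "n \<le> s" for n
    using that
  proof (induction n)
    case (Suc n)
    let ?l = "take n Ys @ drop n Xs"
    have l: "length ?l = s" "\<forall>\<theta>\<in>set ?l. aniso_field \<A> A \<theta>"
      using X Suc.prems by (auto dest: in_set_takeD in_set_dropD)
    have "T \<eta>s (?l[n := Ys ! n]) v = T \<eta>s (?l[n := Xs ! n]) v"
      by (rule field_functional_cong[OF v, where \<tau> = "\<lambda>\<eta>. T \<eta>s (?l[n := \<eta>]) v"],
          rule aniso_tensorD(3)[OF T \<theta>(3) l(1) \<theta>(4) l(2)])
        (use Suc.prems X v in auto)
    also have "?l[n := Xs ! n] = ?l"
      using Suc.prems X by (simp add: list_update_append nth_append Cons_nth_drop_Suc[symmetric])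
    finally show ?case using take_drop_Suc_update[of Ys Xs n] Suc X by simp
  qed simp
  show ?thesis using 1[of r] 2[of s] \<theta> X by simp
qed

text \<open>The extensions picked by \<open>SOME\<close> exist and agree at \<open>v\<close> with
  the given arguments, so \<open>tensor_cong\<close> applies.\<close>

lemma tensor_at_eq:
  assumes T: "aniso_tensor \<A> A r s T" and v: "v \<in> A"
    and \<theta>: "length \<theta>s = r" "\<forall>\<theta>\<in>set \<theta>s. aniso_form \<A> A \<theta>"
    and X: "length Xs = s" "\<forall>X\<in>set Xs. aniso_field \<A> A X"
  shows "tensor_at \<A> A T v (map (\<lambda>\<theta>. \<theta> v) \<theta>s) (map (\<lambda>X. X v) Xs) = T \<theta>s Xs v"
proof -
  have "\<exists>\<theta>. aniso_form \<A> A \<theta> \<and> \<theta> v = \<alpha>" for \<alpha>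
    using aniso_form_base[OF ext_covec(1)] ext_covec(2) by blast
  then have f: "aniso_form \<A> A (SOME \<theta>. aniso_form \<A> A \<theta> \<and> \<theta> v = \<alpha>) \<and> (SOME \<theta>. aniso_form \<A> A \<theta> \<and> \<theta> v = \<alpha>) v = \<alpha>" for \<alpha>
    by (rule someI_ex)
  have "\<exists>X. aniso_field \<A> A X \<and> X v = u" for u
    using aniso_field_base[OF ext_vec(1)] ext_vec(2) by blast
  then have x: "aniso_field \<A> A (SOME X. aniso_field \<A> A X \<and> X v = u) \<and> (SOME X. aniso_field \<A> A X \<and> X v = u) v = u" for u
    by (rule someI_ex)
  show ?thesis unfolding tensor_at_def
    by (rule tensor_cong[OF T v]) (use \<theta> X f x in auto)
qed

end

context aniso_conn begin

text \<open>The connection induced by \<open>V\<close> is \<open>cov\<close> at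
  \<open>(p, e)\<close> over the point \<open>p\<close>, so the correction sums on both sides are
  literally the same. Adaptedness serves the leading term, where \<open>tensor_at_eq\<close> also
  identifies \<open>T\<close> along \<open>V\<close> with the classical tensor near
  \<open>p\<close>.\<close>

lemma tensor_deriv_eq_classical:
  assumes v: "(p, e) \<in> A" and ad: "adapted_ext \<A> nabla A (p, e) \<Omega> V"
    and T: "aniso_tensor \<A> A r s T" and l: "length \<alpha>s = r" "length us = s"
  shows "tensor_deriv \<A> nabla A T (p, e) u \<alpha>s us =
    classical_tensor_deriv \<A> (induced_connection \<A> nabla V) (tensor_along \<A> A T V) p u \<alpha>s us"
proof -
  have V: "admissible \<A> A \<Omega> V" "p \<in> \<Omega>" "V p = e" and flat: "\<And>u. cov \<A> nabla (p, e) u V = 0"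
    using ad by (auto simp: adapted_ext_iff)
  have \<Omega>: "open \<Omega>" "\<And>q. q \<in> \<Omega> \<Longrightarrow> (q, V q) \<in> A" using V by (auto simp: admissible_def)
  let ?\<theta>s = "map (ext_covec \<A> p) \<alpha>s" and ?Xs = "map (ext_vec \<A> p) us"
  let ?h = "T (map (\<lambda>\<theta>. \<theta> \<circ> fst) ?\<theta>s) (map (\<lambda>X. X \<circ> fst) ?Xs)"
  have form: "\<forall>\<theta>\<in>set (map (\<lambda>\<theta>. \<theta> \<circ> fst) ?\<theta>s). aniso_form \<A> A \<theta>"
    using aniso_form_base[OF ext_covec(1)] by (auto simp: o_def)
  have field: "\<forall>X\<in>set (map (\<lambda>X. X \<circ> fst) ?Xs). aniso_field \<A> A X"
    using aniso_field_base[OF ext_vec(1)] by (auto simp: o_def)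
  have h: "aniso_fun \<A> A ?h" by (rule aniso_tensorD(1)[OF T _ _ form field]) (use l in auto)
  have "fun_deriv \<A> nabla A ?h (p, e) u = dir_deriv \<A> p u (\<lambda>q. ?h (q, V q))"
    by (rule fun_deriv_adapted[OF v V flat h])
  also have "\<dots> = dir_deriv \<A> p u (\<lambda>q. tensor_along \<A> A T V q (map (\<lambda>\<theta>. \<theta> q) ?\<theta>s) (map (\<lambda>X. X q) ?Xs))"
  proof (rule dir_deriv_cong[OF \<Omega>(1) V(2) smooth_fun_along[OF h V(1)]])
    fix q assume "q \<in> \<Omega>"
    from tensor_at_eq[OF T \<Omega>(2)[OF this] _ form _ field] l
    show "?h (q, V q) = tensor_along \<A> A T V q (map (\<lambda>\<theta>. \<theta> q) ?\<theta>s) (map (\<lambda>X. X q) ?Xs)"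
      by (simp add: tensor_along_def o_def)
  qed
  finally have 1: "fun_deriv \<A> nabla A ?h (p, e) u =
    dir_deriv \<A> p u (\<lambda>q. tensor_along \<A> A T V q (map (\<lambda>\<theta>. \<theta> q) ?\<theta>s) (map (\<lambda>X. X q) ?Xs))" .
  have "induced_connection \<A> nabla V p = cov \<A> nabla (p, e)"
    by (intro ext) (simp add: induced_connection_def V(3))
  then show ?thesis
    unfolding tensor_deriv_def classical_tensor_deriv_def Let_def fst_conv 1 tensor_along_def V(3) by simp
qed

subsection \<open>The derivative of the curvature\<close>

lemma
  assumes V: "admissible \<A> A \<Omega> V" and \<Gamma>: "christoffel c U \<Gamma>"
  shows smooth_on_deriv_along: "smooth_on (snd c ` (fst c \<inter> (U \<inter> \<Omega>))) (\<lambda>x. deriv_along c \<Gamma> V x a)"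
    and linear_deriv_along: "x \<in> snd c ` (fst c \<inter> (U \<inter> \<Omega>)) \<Longrightarrow> linear (deriv_along c \<Gamma> V x)"
proof -
  let ?S = "snd c ` (fst c \<inter> (U \<inter> \<Omega>))"
  have c: "c \<in> \<A>" by (rule christoffelD[OF \<Gamma>])
  have o: "open ?S" using V christoffelD[OF \<Gamma>] by (intro chart_image_open) (auto simp: admissible_def)
  have "vector_field \<A> \<Omega> V" using V by (simp add: admissible_def)
  then have sV: "smooth_on ?S (field_rep \<A> c V)"
    by (rule smooth_on_subset[OF vector_field_rep[OF _ c]]) auto
  show "smooth_on ?S (\<lambda>x. deriv_along c \<Gamma> V x a)"
    unfolding deriv_along_def
    by (intro smooth_on_add smooth_on_blinfun_apply smooth_on_frechet_derivative sV smooth_on_const o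
        smooth_on_gamma_along[OF V \<Gamma>])
  show "linear (deriv_along c \<Gamma> V x)" if "x \<in> ?S"
    using linear_frechet_derivative[OF smooth_on_differentiable[OF sV that]]
    by (simp add: linear_iff deriv_along_def blinfun.add_left blinfun.scaleR_left blinfun.add_right blinfun.scaleR_right algebra_simps)
qed

text \<open>Since the derivative of \<open>V\<close> in direction \<open>Y\<close> vanishes at
  \<open>p\<close>, the Christoffel term drops out; since \<open>deriv_along\<close> vanishes there
  in every direction, so does the derivative of \<open>Y\<close>, and \<open>Y\<close> may be frozen
  at its value.\<close>

lemma second_deriv_along_chart:
  assumes \<Gamma>: "christoffel c U \<Gamma>" "p \<in> U" and v: "(p, e) \<in> A" and ad: "adapted_ext \<A> nabla A (p, e) \<Omega> V"
    and Y: "vector_field \<A> \<Omega> Y"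
  defines "C \<equiv> cov_field (induced_connection \<A> nabla V)"
  shows "tcoord \<A> c p (C X (C Y V) p) =
    frechet_derivative (\<lambda>x. deriv_along c \<Gamma> V x (tcoord \<A> c p (Y p))) (at (snd c p)) (tcoord \<A> c p (X p))"
proof -
  have V: "admissible \<A> A \<Omega> V" "p \<in> \<Omega>" using ad by (auto simp: adapted_ext_iff)
  have \<Omega>: "open \<Omega>" "vector_field \<A> \<Omega> V" using V by (auto simp: admissible_def)
  have c: "c \<in> \<A>" "p \<in> fst c" using christoffelD[OF \<Gamma>(1)] \<Gamma>(2) by auto
  let ?S = "snd c ` (fst c \<inter> (U \<inter> \<Omega>))"
  let ?x = "snd c p"
  have S: "open ?S" "?x \<in> ?S" using \<Omega> c V \<Gamma>(2) christoffelD[OF \<Gamma>(1)] by (auto intro!: chart_image_open)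
  have vf: "vector_field \<A> \<Omega> (C Y V)" unfolding C_def by (rule vector_field_cov_field[OF V(1) Y \<Omega>(2)])
  have rep: "field_rep \<A> c (C Y V) x = deriv_along c \<Gamma> V x (field_rep \<A> c Y x)" if "x \<in> ?S" for x
    unfolding C_def deriv_along_def by (rule cov_field_rep[OF V(1) \<Gamma>(1) \<Omega>(2) that])
  have "((\<lambda>x. deriv_along c \<Gamma> V x (field_rep \<A> c Y x)) has_derivative
     (\<lambda>u. frechet_derivative (\<lambda>x. deriv_along c \<Gamma> V x (field_rep \<A> c Y ?x)) (at ?x) u +
       deriv_along c \<Gamma> V ?x (frechet_derivative (field_rep \<A> c Y) (at ?x) u))) (at ?x)"
    by (rule has_derivative_linear_apply[OF S linear_deriv_along[OF V(1) \<Gamma>(1)]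
        smooth_on_differentiable[OF smooth_on_deriv_along[OF V(1) \<Gamma>(1)] S(2)]
        vector_field_rep_has_derivative[OF Y c V(2)]])
  then have "(field_rep \<A> c (C Y V) has_derivative
     (\<lambda>u. frechet_derivative (\<lambda>x. deriv_along c \<Gamma> V x (field_rep \<A> c Y ?x)) (at ?x) u)) (at ?x)"
    unfolding deriv_along_zero[OF \<Gamma> v ad] add_0_right
    by (rule has_derivative_transform_within_open[OF _ S rep[symmetric]])
  note D = frechet_derivative_at[OF this, symmetric]
  have "C Y V p = tvec \<A> c p (deriv_along c \<Gamma> V ?x (field_rep \<A> c Y ?x))"
    using rep[OF S(2)] c tvec_tcoord[OF c, of "C Y V p"] by simp
  also have "\<dots> = 0" by (simp add: deriv_along_zero[OF \<Gamma> v ad] linear_0[OF linear_tvec[OF c]])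
  finally have "C Y V p = 0" .
  then show ?thesis
    using cov_field_chart[OF V(1) \<Gamma> V(2) vf, of X] c
    by (simp add: C_def[symmetric] D linear_0[OF linear_tcoord[OF c]] del: field_rep_chart)
      (simp add: c)
qed

text \<open>In the chart only \<open>\<Gamma>\<close> depends on the fibre variable, the term with
  the derivative of \<open>W\<close> being constant along the fibre; so \<open>P\<close> is the
  fibre derivative of \<open>\<Gamma>\<close>.\<close>

lemma vert_connection_chart:
  assumes \<Gamma>: "christoffel c U \<Gamma>" "p \<in> U" and v: "(p, e) \<in> A"
    and W: "open \<Omega>" "p \<in> \<Omega>" "vector_field \<A> \<Omega> W"
  shows "tcoord \<A> c p (vert_connection \<A> nabla (p, e) z W k) =
    frechet_derivative \<Gamma> (at (snd c p, tcoord \<A> c p e)) (0, tcoord \<A> c p k) (tcoord \<A> c p z) (tcoord \<A> c p (W p))"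
proof -
  have c: "c \<in> \<A>" "p \<in> fst c" using christoffelD[OF \<Gamma>(1)] \<Gamma>(2) by auto
  let ?t = "tcoord \<A> c p"
  have mem: "(snd c p, ?t e') \<in> tm_over c U \<longleftrightarrow> (p, e') \<in> A" for e' using c \<Gamma>(2) by simp
  let ?DG = "frechet_derivative \<Gamma> (at (snd c p, ?t e))"
  have G: "(\<Gamma> has_derivative ?DG) (at (snd c p, ?t e))"
    by (rule smooth_on_has_derivative[OF christoffelD(4)[OF \<Gamma>(1)]]) (use mem v in simp)
  have "((\<lambda>y. frechet_derivative (field_rep \<A> c W) (at (snd c p)) (?t z) + \<Gamma> y (?t z) (?t (W p)))
     has_derivative (\<lambda>d. ?DG d (?t z) (?t (W p)))) (at (snd c p, ?t e))"
    using has_derivative_add[OF has_derivative_const has_derivative_bilinear_blinfun[OF G has_derivative_const has_derivative_const]]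
    by (simp add: blinfun.zero_left blinfun.zero_right)
  then show ?thesis
    unfolding vert_connection_def
    by (rule vert_deriv_field_chart[OF c _ christoffelD(5)[OF \<Gamma>(1)]])
      (use mem v cov_chart[OF \<Gamma> _ W] in auto)
qed

text \<open>A common step for both curvatures. The derivatives of the argument components, produced
  by differentiating \<open>F\<close>, cancel against those inside the corrected slots, so only the
  derivative of \<open>Q\<close> with frozen arguments remains. \<open>a\<close>, \<open>b\<close>,
  \<open>w\<close> are the Christoffel parts of the slot corrections and \<open>K\<close> that of
  the leading term.\<close>

lemma trilinear_product_rule:
  fixes Q :: "'e \<Rightarrow> 'e \<Rightarrow> 'e \<Rightarrow> 'e \<Rightarrow> 'e"
  assumes c: "c \<in> \<A>" "p \<in> fst c" and S: "open S" "snd c p \<in> S"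
    and lin: "\<And>y b w. y \<in> S \<Longrightarrow> linear (\<lambda>a. Q y a b w)" "\<And>y a w. y \<in> S \<Longrightarrow> linear (\<lambda>b. Q y a b w)"
      "\<And>y a b. y \<in> S \<Longrightarrow> linear (Q y a b)"
    and diff: "\<And>a b w. (\<lambda>y. Q y a b w) differentiable (at (snd c p))"
    and XYZ: "vector_field \<A> \<Omega> X" "vector_field \<A> \<Omega> Y" "vector_field \<A> \<Omega> Z" "p \<in> \<Omega>"
    and F: "\<And>x. x \<in> S \<Longrightarrow> field_rep \<A> c F x = Q x (field_rep \<A> c X x) (field_rep \<A> c Y x) (field_rep \<A> c Z x)"
  defines "t \<equiv> tcoord \<A> c p" and "d \<equiv> \<lambda>X. frechet_derivative (field_rep \<A> c X) (at (snd c p))"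
  shows "d F u + K
     - Q (snd c p) (d X u + a) (t (Y p)) (t (Z p))
     - Q (snd c p) (t (X p)) (d Y u + b) (t (Z p))
     - Q (snd c p) (t (X p)) (t (Y p)) (d Z u + w) =
    frechet_derivative (\<lambda>y. Q y (t (X p)) (t (Y p)) (t (Z p))) (at (snd c p)) u + K
     - Q (snd c p) a (t (Y p)) (t (Z p))
     - Q (snd c p) (t (X p)) b (t (Z p))
     - Q (snd c p) (t (X p)) (t (Y p)) w"
proof -
  note D = vector_field_rep_has_derivative[OF _ c XYZ(4)]
  have "((\<lambda>y. Q y (field_rep \<A> c X y) (field_rep \<A> c Y y) (field_rep \<A> c Z y)) has_derivative
    (\<lambda>u. frechet_derivative (\<lambda>y. Q y (t (X p)) (t (Y p)) (t (Z p))) (at (snd c p)) u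
      + Q (snd c p) (d X u) (t (Y p)) (t (Z p)) + Q (snd c p) (t (X p)) (d Y u) (t (Z p))
      + Q (snd c p) (t (X p)) (t (Y p)) (d Z u))) (at (snd c p))"
    using has_derivative_trilinear_apply[OF S lin diff D[OF XYZ(1)] D[OF XYZ(2)] D[OF XYZ(3)]] c
    by (simp add: t_def d_def)
  from frechet_derivative_at[OF has_derivative_transform_within_open[OF this S F[symmetric]], symmetric]
  have "d F u = frechet_derivative (\<lambda>y. Q y (t (X p)) (t (Y p)) (t (Z p))) (at (snd c p)) u
      + Q (snd c p) (d X u) (t (Y p)) (t (Z p)) + Q (snd c p) (t (X p)) (d Y u) (t (Z p))
      + Q (snd c p) (t (X p)) (t (Y p)) (d Z u)"
    by (simp add: d_def)
  then show ?thesis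
    by (simp add: linear_add[OF lin(1)[OF S(2)]] linear_add[OF lin(2)[OF S(2)]] linear_add[OF lin(3)[OF S(2)]])
qed

text \<open>After \<open>trilinear_product_rule\<close> both derivatives depend on the arguments
  only through their values at \<open>p\<close>. The undifferentiated curvatures agree there, so the
  difference is the derivative of the vertical terms \<open>?E\<close>, and its two instances are
  the \<open>P\<close> terms.\<close>

lemma curv_deriv_eq:
  assumes v: "(p, e) \<in> A" and ad: "adapted_ext \<A> nabla A (p, e) \<Omega> V"
    and X: "vector_field \<A> \<Omega> X" and Y: "vector_field \<A> \<Omega> Y" and Z: "vector_field \<A> \<Omega> Z" and W: "vector_field \<A> \<Omega> W"
  defines "D \<equiv> induced_connection \<A> nabla V"
  shows "curv_deriv \<A> nabla A (p, e) (X p) (Y p) (Z p) (W p) =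
    classical_curv_deriv \<A> D X Y Z W p
    - vert_connection \<A> nabla (p, e) (Z p) W (cov_field D X (cov_field D Y V) p)
    + vert_connection \<A> nabla (p, e) (Y p) W (cov_field D X (cov_field D Z V) p)"
proof -
  let ?c = "chart_at \<A> p"
  obtain U \<Gamma> where \<Gamma>: "christoffel ?c U \<Gamma>" "p \<in> U" using christoffel_exists[OF chart_at] .
  have c: "?c \<in> \<A>" "p \<in> fst ?c" by (rule chart_at)+
  have V: "admissible \<A> A \<Omega> V" "p \<in> \<Omega>" "V p = e" and flat: "\<And>u. cov \<A> nabla (p, e) u V = 0"
    using ad by (auto simp: adapted_ext_iff)
  have \<Omega>: "open \<Omega>" "vector_field \<A> \<Omega> V" using V by (auto simp: admissible_def)
  let ?x = "snd ?c p" and ?S = "snd ?c ` (fst ?c \<inter> (U \<inter> \<Omega>))" and ?r = "field_rep \<A> ?c"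
  let ?z = "(?x, e)"
  let ?u = "X p" and ?y = "Y p" and ?zz = "Z p" and ?w = "W p"
  have S: "open ?S" "?x \<in> ?S" using \<Omega> c V \<Gamma>(2) christoffelD[OF \<Gamma>(1)] by (auto intro!: chart_image_open)
  have VS: "(x, ?r V x) \<in> tm_over ?c U" if "x \<in> ?S" for x by (rule admissible_rep(3)[OF V(1) c(1) that])
  have VD: "((\<lambda>x. (x, ?r V x)) has_derivative (\<lambda>w. (w, frechet_derivative (?r V) (at ?x) w))) (at ?x)"
    by (intro has_derivative_Pair has_derivative_ident vector_field_rep_has_derivative[OF \<Omega>(2) c V(2)])
  have rV: "?r V ?x = e" using c V by simp
  let ?R = "\<lambda>x. aniso_curv_form \<Gamma> (x, ?r V x)" and ?K = "curv_form (gamma_along ?c \<Gamma> V)"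
  let ?DG = "\<lambda>x s. frechet_derivative \<Gamma> (at (x, ?r V x)) (0, s)"
  let ?E = "\<lambda>a b w x. ?DG x (deriv_along ?c \<Gamma> V x a) b w"
  let ?g = "\<lambda>a. \<Gamma> ?z ?u a"
  have linDG: "linear (?DG x)" if "x \<in> ?S" for x
  proof -
    have "linear (\<lambda>s::'e. (0::'e, s))" by (simp add: linear_iff)
    from linear_compose[OF this linear_frechet_derivative[OF smooth_on_differentiable[OF christoffelD(4)[OF \<Gamma>(1)] VS[OF that]]]]
    show ?thesis by (simp add: o_def)
  qed
  have sR: "smooth_on ?S (\<lambda>x. ?R x a b w)" for a b w
    by (rule smooth_on_along[OF V(1) c(1) christoffelD(2)[OF \<Gamma>(1)]
        smooth_on_aniso_curv_form[OF \<Gamma>(1) smooth_on_const smooth_on_const smooth_on_const]])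
  have linR: "linear (\<lambda>a. ?R x a b w)" "linear (\<lambda>b. ?R x a b w)" "linear (?R x a b)" if "x \<in> ?S" for x a b w
    by (rule linear_aniso_curv_form[OF \<Gamma>(1) VS[OF that]])+
  have sDG: "smooth_on ?S (\<lambda>x. ?DG x s b w)" for s b w
    by (rule smooth_on_along[OF V(1) c(1) christoffelD(2)[OF \<Gamma>(1)], where f = "\<lambda>z. frechet_derivative \<Gamma> (at z) (0, s) b w"])
      (intro smooth_on_blinfun_apply smooth_on_const smooth_on_frechet_derivative christoffelD[OF \<Gamma>(1)])
  have lin_dV: "linear (deriv_along ?c \<Gamma> V x)" if "x \<in> ?S" for x
    by (rule linear_deriv_along[OF V(1) \<Gamma>(1) that])
  have s_dV: "smooth_on ?S (\<lambda>x. deriv_along ?c \<Gamma> V x a)" for a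
    by (rule smooth_on_deriv_along[OF V(1) \<Gamma>(1)])
  \<comment> \<open>By the product rule the part that differentiates the fibre derivative of
    \<open>\<Gamma>\<close> is taken with \<open>deriv_along\<close> frozen at its value 0, hence
    vanishes; only the derivative of \<open>deriv_along\<close> is left.\<close>
  have E: "(?E a b w has_derivative
     (\<lambda>u. ?DG ?x (frechet_derivative (\<lambda>x. deriv_along ?c \<Gamma> V x a) (at ?x) u) b w)) (at ?x)" for a b w
  proof -
    have lin: "linear (\<lambda>s. ?DG x s b w)" if "x \<in> ?S" for x
      using linDG[OF that] by (simp add: linear_iff blinfun.add_left blinfun.scaleR_left)
    have "(?E a b w has_derivative
      (\<lambda>u. frechet_derivative (\<lambda>x. ?DG x (deriv_along ?c \<Gamma> V ?x a) b w) (at ?x) u +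
        ?DG ?x (frechet_derivative (\<lambda>x. deriv_along ?c \<Gamma> V x a) (at ?x) u) b w)) (at ?x)"
      by (rule has_derivative_linear_apply[where L = "\<lambda>x s. ?DG x s b w", OF S lin
            smooth_on_differentiable[OF sDG S(2)] smooth_on_has_derivative[OF s_dV S(2)]])
    moreover have "((\<lambda>x. ?DG x (deriv_along ?c \<Gamma> V ?x a) b w) has_derivative (\<lambda>u. 0)) (at ?x)"
      unfolding deriv_along_zero[OF \<Gamma> v ad]
      by (rule has_derivative_transform_within_open[OF has_derivative_const S])
        (simp add: linear_0[OF linDG] blinfun.zero_left)
    from frechet_derivative_at[OF this, symmetric]
    have "frechet_derivative (\<lambda>x. ?DG x (deriv_along ?c \<Gamma> V ?x a) b w) (at ?x) = (\<lambda>u. 0)" .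
    ultimately show ?thesis by simp
  qed
  have K: "?K x a b w = ?R x a b w + ?E a b w x - ?E b a w x" if "x \<in> ?S" for x a b w
    by (rule curv_form_along[OF V(1) \<Gamma>(1) that])
  have DK: "((\<lambda>x. ?K x a b w) has_derivative (\<lambda>u. frechet_derivative (\<lambda>x. ?R x a b w) (at ?x) u
      + ?DG ?x (frechet_derivative (\<lambda>x. deriv_along ?c \<Gamma> V x a) (at ?x) u) b w
      - ?DG ?x (frechet_derivative (\<lambda>x. deriv_along ?c \<Gamma> V x b) (at ?x) u) a w)) (at ?x)" for a b w
    by (rule has_derivative_transform_within_open[OF _ S K[symmetric]])
      (intro has_derivative_diff has_derivative_add E smooth_on_has_derivative[OF sR S(2)])
  have K0: "?K ?x a b w = aniso_curv_form \<Gamma> ?z a b w" for a b w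
    using curv_form_adapted[OF \<Gamma> v ad] by simp
  have linK: "linear (\<lambda>a. ?K x a b w)" "linear (\<lambda>b. ?K x a b w)" "linear (?K x a b)" if "x \<in> ?S" for x a b w
    using linR[OF that] linDG[OF that] lin_dV[OF that]
    by (simp_all add: linear_iff K[OF that] blinfun.add_left blinfun.scaleR_left blinfun.add_right
      blinfun.scaleR_right algebra_simps)
  have cov: "cov \<A> nabla (p, e) ?u F = frechet_derivative (?r F) (at ?x) ?u + ?g (F p)"
    if F: "vector_field \<A> \<Omega> F" for F
    using cov_chart[OF \<Gamma> v \<Omega>(1) V(2) F, of ?u] by simp

  \<comment> \<open>\<open>curv_deriv\<close> uses its own global extensions, which are known to
    share with \<open>Y\<close>, \<open>Z\<close>, \<open>W\<close> only the values at
    \<open>p\<close>; their derivatives may differ, and \<open>trilinear_product_rule\<close>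
    removes them.\<close>
  define Y' Z' W' where Y': "Y' = ext_vec \<A> p ?y" and Z': "Z' = ext_vec \<A> p ?zz" and W': "W' = ext_vec \<A> p ?w"
  have glob: "vector_field \<A> UNIV Y'" "vector_field \<A> UNIV Z'" "vector_field \<A> UNIV W'"
    unfolding Y' Z' W' by (rule ext_vec)+
  have vals: "Y' p = ?y" "Z' p = ?zz" "W' p = ?w" unfolding Y' Z' W' by (simp_all add: ext_vec)
  note loc = glob[THEN vector_field_subset[OF _ subset_UNIV]]
  let ?C = "\<lambda>v. curv \<A> nabla A v Y' Z' W'"
  have aC: "aniso_field \<A> A ?C" by (rule aniso_field_curv[OF glob])
  have vC: "vector_field \<A> \<Omega> (\<lambda>q. ?C (q, V q))" by (rule vector_field_along[OF aC V(1)])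
  have VA: "\<And>q. q \<in> \<Omega> \<Longrightarrow> (q, V q) \<in> A" using V by (simp add: admissible_def)
  have rC: "?r (\<lambda>q. ?C (q, V q)) x = ?R x (?r Y' x) (?r Z' x) (?r W' x)" if "x \<in> ?S" for x
  proof -
    from that obtain q where q: "q \<in> fst ?c" "q \<in> U" "q \<in> \<Omega>" "x = snd ?c q" by blast
    show ?thesis using curv_chart[OF \<Gamma>(1) q(2) VA[OF q(3)] glob] q c by simp
  qed
  have CA: "curv_at \<A> nabla A (p, e) a b w = aniso_curv_form \<Gamma> ?z a b w" for a b w
    using curv_at_chart[OF \<Gamma> v, of a b w] by simp
  have "curv_deriv \<A> nabla A (p, e) ?u ?y ?zz ?w =
    field_deriv \<A> nabla A ?C (p, e) ?u
    - curv_at \<A> nabla A (p, e) (cov \<A> nabla (p, e) ?u Y') ?zz ?w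
    - curv_at \<A> nabla A (p, e) ?y (cov \<A> nabla (p, e) ?u Z') ?w
    - curv_at \<A> nabla A (p, e) ?y ?zz (cov \<A> nabla (p, e) ?u W')"
    by (simp add: curv_deriv_def Let_def Y' Z' W')
  also have "\<dots> = frechet_derivative (?r (\<lambda>q. ?C (q, V q))) (at ?x) ?u + ?g (?C (p, e))
    - ?R ?x (frechet_derivative (?r Y') (at ?x) ?u + ?g ?y) ?zz ?w
    - ?R ?x ?y (frechet_derivative (?r Z') (at ?x) ?u + ?g ?zz) ?w
    - ?R ?x ?y ?zz (frechet_derivative (?r W') (at ?x) ?u + ?g ?w)"
    unfolding field_deriv_adapted[OF v V flat aC] cov[OF vC] cov[OF loc(1)] cov[OF loc(2)] cov[OF loc(3)]
      CA vals V(3) rV ..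
  also have "\<dots> = frechet_derivative (\<lambda>x. ?R x ?y ?zz ?w) (at ?x) ?u + ?g (?C (p, e))
     - ?R ?x (?g ?y) ?zz ?w - ?R ?x ?y (?g ?zz) ?w - ?R ?x ?y ?zz (?g ?w)"
    using trilinear_product_rule[where Q = ?R, OF c S linR smooth_on_differentiable[OF sR S(2)] loc V(2) rC,
        of ?u "?g (?C (p, e))" "?g ?y" "?g ?zz" "?g ?w"]
    by (simp add: vals)
  also have "?C (p, e) = aniso_curv_form \<Gamma> ?z ?y ?zz ?w"
    using CA[of ?y ?zz ?w] by (simp add: curv_at_def Y' Z' W')
  finally have lhs: "curv_deriv \<A> nabla A (p, e) ?u ?y ?zz ?w =
     frechet_derivative (\<lambda>x. ?R x ?y ?zz ?w) (at ?x) ?u + ?g (aniso_curv_form \<Gamma> ?z ?y ?zz ?w)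
     - ?R ?x (?g ?y) ?zz ?w - ?R ?x ?y (?g ?zz) ?w - ?R ?x ?y ?zz (?g ?w)" .

  have Dp: "cov_field D X F p = cov \<A> nabla (p, e) ?u F" for F
    by (simp add: cov_field_def D_def induced_connection_def V(3))
  have CC: "classical_curv \<A> D F G H p = ?K ?x (F p) (G p) (H p)"
    if "vector_field \<A> \<Omega> F" "vector_field \<A> \<Omega> G" "vector_field \<A> \<Omega> H" for F G H
    using classical_curv_chart[OF V(1) \<Gamma> V(2) that] by (simp add: D_def)
  have rK: "?r (classical_curv \<A> D Y Z W) x = ?K x (?r Y x) (?r Z x) (?r W x)" if "x \<in> ?S" for x
  proof -
    from that obtain q where q: "q \<in> fst ?c" "q \<in> U" "q \<in> \<Omega>" "x = snd ?c q" by blast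
    show ?thesis using classical_curv_chart[OF V(1) \<Gamma>(1) q(2,3) Y Z W] q c by (simp add: D_def)
  qed
  have vK: "vector_field \<A> \<Omega> (classical_curv \<A> D Y Z W)"
    unfolding D_def by (rule vector_field_classical_curv[OF V(1) Y Z W])
  have vD: "vector_field \<A> \<Omega> (cov_field D X F)" if "vector_field \<A> \<Omega> F" for F
    unfolding D_def by (rule vector_field_cov_field[OF V(1) X that])
  have "classical_curv_deriv \<A> D X Y Z W p =
    frechet_derivative (?r (classical_curv \<A> D Y Z W)) (at ?x) ?u + ?g (?K ?x ?y ?zz ?w)
    - ?K ?x (frechet_derivative (?r Y) (at ?x) ?u + ?g ?y) ?zz ?w
    - ?K ?x ?y (frechet_derivative (?r Z) (at ?x) ?u + ?g ?zz) ?w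
    - ?K ?x ?y ?zz (frechet_derivative (?r W) (at ?x) ?u + ?g ?w)"
    unfolding classical_curv_deriv_def CC[OF vD[OF Y] Z W] CC[OF Y vD[OF Z] W] CC[OF Y Z vD[OF W]]
      Dp cov[OF vK] cov[OF Y] cov[OF Z] cov[OF W] CC[OF Y Z W] ..
  also have "\<dots> = frechet_derivative (\<lambda>x. ?K x ?y ?zz ?w) (at ?x) ?u + ?g (?K ?x ?y ?zz ?w)
     - ?K ?x (?g ?y) ?zz ?w - ?K ?x ?y (?g ?zz) ?w - ?K ?x ?y ?zz (?g ?w)"
    using trilinear_product_rule[where Q = ?K, OF c S linK differentiableI[OF DK] Y Z W V(2) rK,
        of ?u "?g (?K ?x ?y ?zz ?w)" "?g ?y" "?g ?zz" "?g ?w"]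
    by simp
  \<comment> \<open>Here the two sides part: \<open>?K\<close> and \<open>?R\<close> agree at the
    base point, but their derivatives differ by the two vertical terms.\<close>
  also have "frechet_derivative (\<lambda>x. ?K x ?y ?zz ?w) (at ?x) ?u = frechet_derivative (\<lambda>x. ?R x ?y ?zz ?w) (at ?x) ?u
      + ?DG ?x (frechet_derivative (\<lambda>x. deriv_along ?c \<Gamma> V x ?y) (at ?x) ?u) ?zz ?w
      - ?DG ?x (frechet_derivative (\<lambda>x. deriv_along ?c \<Gamma> V x ?zz) (at ?x) ?u) ?y ?w"
    unfolding frechet_derivative_at[OF DK, symmetric] ..
  finally have rhs: "classical_curv_deriv \<A> D X Y Z W p = frechet_derivative (\<lambda>x. ?R x ?y ?zz ?w) (at ?x) ?u
      + ?DG ?x (frechet_derivative (\<lambda>x. deriv_along ?c \<Gamma> V x ?y) (at ?x) ?u) ?zz ?w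
      - ?DG ?x (frechet_derivative (\<lambda>x. deriv_along ?c \<Gamma> V x ?zz) (at ?x) ?u) ?y ?w + ?g (?K ?x ?y ?zz ?w)
     - ?K ?x (?g ?y) ?zz ?w - ?K ?x ?y (?g ?zz) ?w - ?K ?x ?y ?zz (?g ?w)" .
  have P: "vert_connection \<A> nabla (p, e) k W (cov_field D X (cov_field D F V) p) =
     ?DG ?x (frechet_derivative (\<lambda>x. deriv_along ?c \<Gamma> V x (F p)) (at ?x) ?u) k ?w"
    if "vector_field \<A> \<Omega> F" for F k
    using vert_connection_chart[OF \<Gamma> v \<Omega>(1) V(2) W, of k "cov_field D X (cov_field D F V) p"]
      second_deriv_along_chart[OF \<Gamma> v ad that, of X] by (simp add: D_def rV V(3))
  show ?thesis
    unfolding lhs rhs P[OF Y] P[OF Z] K0 rV by simp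
qed

end

theorem proposition2p13:
  fixes \<A> :: "('m::{t2_space, second_countable_topology}, 'e::euclidean_space) chart set"
    and A :: "('m \<times> 'e) set"
    and nabla :: "'m \<times> 'e \<Rightarrow> ('m \<Rightarrow> 'e) \<Rightarrow> ('m \<Rightarrow> 'e) \<Rightarrow> 'e"
    and v :: "'m \<times> 'e"
  assumes "smooth_manifold \<A>"
    and "tm_open \<A> A" and "fst ` A = UNIV"
    and "aniso_connection \<A> A nabla"
    and "v \<in> A"
  shows "(\<exists>\<Omega> V. adapted_ext \<A> nabla A v \<Omega> V) \<and>
    (\<forall>\<Omega> V D. adapted_ext \<A> nabla A v \<Omega> V \<and> D = induced_connection \<A> nabla V \<longrightarrow>
      (\<forall>r s T X. aniso_tensor \<A> A r s T \<and> aniso_field \<A> A X \<longrightarrow>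
         (\<forall>\<alpha>s us. length \<alpha>s = r \<and> length us = s \<longrightarrow>
            tensor_deriv \<A> nabla A T v (X v) \<alpha>s us =
            classical_tensor_deriv \<A> D (tensor_along \<A> A T V) (fst v) (X v) \<alpha>s us)) \<and>
      (\<forall>X Y Z. vector_field \<A> \<Omega> X \<and> vector_field \<A> \<Omega> Y \<and> vector_field \<A> \<Omega> Z \<longrightarrow>
         curv_at \<A> nabla A v (X (fst v)) (Y (fst v)) (Z (fst v)) = classical_curv \<A> D X Y Z (fst v) \<and>
         ((\<forall>q\<in>\<Omega>. lie_bracket \<A> X Y q = 0) \<longrightarrow>
            curv_at \<A> nabla A v (X (fst v)) (Y (fst v)) (Z (fst v)) =
            cov_field D X (cov_field D Y Z) (fst v) - cov_field D Y (cov_field D X Z) (fst v))) \<and>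
      (\<forall>X Y Z W. (\<forall>F\<in>{X, Y, Z, W}. vector_field \<A> \<Omega> F) \<and>
         (\<forall>F\<in>{X, Y, Z, W}. \<forall>G\<in>{X, Y, Z, W}. \<forall>q\<in>\<Omega>. lie_bracket \<A> F G q = 0) \<longrightarrow>
         curv_deriv \<A> nabla A v (X (fst v)) (Y (fst v)) (Z (fst v)) (W (fst v)) =
         classical_curv_deriv \<A> D X Y Z W (fst v)
         - vert_connection \<A> nabla v (Z (fst v)) W (cov_field D X (cov_field D Y V) (fst v))
         + vert_connection \<A> nabla v (Y (fst v)) W (cov_field D X (cov_field D Z V) (fst v))))"
proof -
  interpret aniso_conn \<A> A nabla
    by unfold_locales (use assms in auto)
  obtain p e where v: "v = (p, e)" by (cases v)
  have vA: "(p, e) \<in> A" using assms(5) v by simp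
  show ?thesis
    unfolding v fst_conv
  proof (intro conjI allI impI; (elim conjE)?)
    show "\<exists>\<Omega> V. adapted_ext \<A> nabla A (p, e) \<Omega> V" using adapted_ext_exists[OF vA] by metis
  next
    fix \<Omega> V D r s T X and \<alpha>s :: "('e \<Rightarrow>\<^sub>L real) list" and us :: "'e list"
    assume "adapted_ext \<A> nabla A (p, e) \<Omega> V" "D = induced_connection \<A> nabla V"
      "aniso_tensor \<A> A r s T" "length \<alpha>s = r" "length us = s"
    then show "tensor_deriv \<A> nabla A T (p, e) (X (p, e)) \<alpha>s us =
            classical_tensor_deriv \<A> D (tensor_along \<A> A T V) p (X (p, e)) \<alpha>s us"
      using tensor_deriv_eq_classical[OF vA] by simp
  next
    fix \<Omega> V D X Y Z
    assume *: "adapted_ext \<A> nabla A (p, e) \<Omega> V" "D = induced_connection \<A> nabla V"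
      "vector_field \<A> \<Omega> X" "vector_field \<A> \<Omega> Y" "vector_field \<A> \<Omega> Z"
    show eq: "curv_at \<A> nabla A (p, e) (X p) (Y p) (Z p) = classical_curv \<A> D X Y Z p"
      using curv_at_eq_classical_curv[OF vA *(1,3-5)] *(2) by simp
    assume "\<forall>q\<in>\<Omega>. lie_bracket \<A> X Y q = 0"
    moreover have V: "admissible \<A> A \<Omega> V" "p \<in> \<Omega>" "V p = e" using *(1) by (auto simp: adapted_ext_iff)
    \<comment> \<open>The bracket term of \<open>classical_curv\<close> has direction 0, but
      \<open>cov\<close> picks an extension of the zero vector that may differ from the zero field;
      the chart formula shows that the result is 0.\<close>
    moreover have "cov \<A> nabla (p, e) 0 Z = 0"
    proof -
      obtain U \<Gamma> where \<Gamma>: "christoffel (chart_at \<A> p) U \<Gamma>" "p \<in> U" using christoffel_exists[OF chart_at] .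
      have "linear (frechet_derivative (field_rep \<A> (chart_at \<A> p) Z) (at (snd (chart_at \<A> p) p)))"
        using has_derivative_linear vector_field_rep_has_derivative[OF *(5) chart_at V(2)] by blast
      then show ?thesis
        using cov_chart[OF \<Gamma> vA _ V(2) *(5), of 0] V(1)
        by (simp add: admissible_def linear_0 blinfun.zero_right blinfun.zero_left)
    qed
    ultimately show "curv_at \<A> nabla A (p, e) (X p) (Y p) (Z p) =
            cov_field D X (cov_field D Y Z) p - cov_field D Y (cov_field D X Z) p"
      unfolding eq classical_curv_def *(2) by (simp add: cov_field_def[of _ "lie_bracket \<A> X Y"] induced_connection_def)
  next
    fix \<Omega> V D X Y Z W
    assume *: "adapted_ext \<A> nabla A (p, e) \<Omega> V" "D = induced_connection \<A> nabla V"
      "\<forall>F\<in>{X, Y, Z, W}. vector_field \<A> \<Omega> F"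
    show "curv_deriv \<A> nabla A (p, e) (X p) (Y p) (Z p) (W p) =
         classical_curv_deriv \<A> D X Y Z W p
         - vert_connection \<A> nabla (p, e) (Z p) W (cov_field D X (cov_field D Y V) p)
         + vert_connection \<A> nabla (p, e) (Y p) W (cov_field D X (cov_field D Z V) p)"
      unfolding *(2) by (rule curv_deriv_eq[OF vA *(1)]) (use *(3) in auto)
  qed
qed

end
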